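(* Let $(\mathfrak g,\varphi_i,\xi_i,\eta_i,g)$ be an almost $3$-contact metric Lie algebra with abelian structure. Then the structure is canonical if and only if both of the following hold: 1. the vertical subspace $\mathfrak v$ is a subalgebra of $\mathfrak g$, so that $[\xi_i,\xi_j]=2\delta\xi_k$ for every even permutation $(i,j,k)$ of $(1,2,3)$, with $\delta\in\mathbb R$; 2. $\mathrm{ad}_{\xi_i}|_{\mathfrak h}=\frac{\beta}{2}\varphi_i|_{\mathfrak h}$ for every $i=1,2,3$ and for some $\beta\in\mathbb R$. If the structure is canonical, the canonical connection of a Lie group $G$ with Lie algebra $\mathfrak g$, endowed with the corresponding left invariant structure, has torsion $$T=c+\sum_{i=1}^3\eta_i\wedge d\eta_i+2(\beta+2\delta)\,\eta_1\wedge\eta_2\wedge\eta_3,$$ where $c$ is the $3$-form defined on $\mathfrak h$ by $c(X,Y,Z)=-g([X,Y],Z)-g([Y,Z],X)-g([Z,X],Y)$.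
   Context: An almost contact structure on a real Lie algebra $\mathfrak g$ is a triple $(\varphi,\xi,\eta)$, $\varphi\in\mathrm{End}(\mathfrak g)$, $\xi\in\mathfrak g$, $\eta\in\mathfrak g^*$, with $\varphi^2=-I+\eta\otimes\xi$ and $\eta(\xi)=1$. It is abelian if $\mathrm{ad}_\xi\circ\varphi=\varphi\circ\mathrm{ad}_\xi$ and $[\varphi X,\varphi Y]=[X,Y]$ for all $X,Y\in\operatorname{Ker}\eta$. An almost $3$-contact metric Lie algebra is a real Lie algebra $\mathfrak g$ of dimension $4n+3$, $n\ge1$, with three almost contact structures $(\varphi_i,\xi_i,\eta_i)$, $i=1,2,3$, such that for every even permutation $(i,j,k)$ of $(1,2,3)$: $\varphi_k=\varphi_i\varphi_j-\eta_j\otimes\xi_i=-\varphi_j\varphi_i+\eta_i\otimes\xi_j$, $\xi_k=\varphi_i\xi_j=-\varphi_j\xi_i$, $\eta_k=\eta_i\circ\varphi_j=-\eta_j\circ\varphi_i$, together with an inner product $g$ satisfying $g(\varphi_iX,\varphi_iY)=g(X,Y)-\eta_i(X)\eta_i(Y)$ for all $X,Y$ and $i$. The structure is abelian if each $(\varphi_i,\xi_i,\eta_i)$ is abelian. Set $\mathfrak h=\bigcap_i\operatorname{Ker}\eta_i$, $\mathfrak v=\langle\xi_1,\xi_2,\xi_3\rangle$. The same definitions, read pointwise with tensor fields, give almost $3$-contact metric manifolds $(M,\varphi_i,\xi_i,\eta_i,g)$, with $\mathcal H=\bigcap_i\operatorname{Ker}\eta_i$. Notation on such a manifold: $\Phi_i(X,Y)=g(X,\varphi_iY)$;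 $N_{\varphi_i}=[\varphi_i,\varphi_i]+d\eta_i\otimes\xi_i$, where $[\varphi,\varphi](X,Y)=[\varphi X,\varphi Y]+\varphi^2[X,Y]-\varphi[\varphi X,Y]-\varphi[X,\varphi Y]$; $N_{\varphi_i}(X,Y,Z)=g(N_{\varphi_i}(X,Y),Z)$. Conventions: $d\eta(X,Y)=X\eta(Y)-Y\eta(X)-\eta([X,Y])$ (so $d\eta(X,Y)=-\eta([X,Y])$ on left invariant objects), and wedge products are without normalizing factors, e.g. $(\eta\wedge\omega)(X,Y,Z)$ is the cyclic sum of $\eta(X)\omega(Y,Z)$ for a $1$-form $\eta$ and a $2$-form $\omega$. An almost $3$-contact metric manifold is canonical if: (i) each $N_{\varphi_i}$ is totally skew-symmetric on $\mathcal H$; (ii) each $\xi_i$ is Killing; (iii) for all $X,Y,Z\in\Gamma(\mathcal H)$ and all $i,j$, $N_{\varphi_i}(X,Y,Z)-d\Phi_i(\varphi_iX,\varphi_iY,\varphi_iZ)=N_{\varphi_j}(X,Y,Z)-d\Phi_j(\varphi_jX,\varphi_jY,\varphi_jZ)$; (iv) there is $\beta\in C^\infty(M)$ such that the tensors $A_{ij}(X,Y)=g((\mathcal L_{\xi_j}\varphi_i)X,Y)+d\eta_j(X,\varphi_iY)+d\eta_j(\varphi_iX,Y)$ satisfy $A_{ii}(X,Y)=0$ and $A_{ij}(X,Y)=-A_{ji}(X,Y)=\beta\,\Phi_k(X,Y)$ for all $X,Y\in\Gamma(\mathcal H)$ and every even permutation $(i,j,k)$ of $(1,2,3)$. An almost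 $3$-contact metric structure on $\mathfrak g$ is called canonical if any Lie group $G$ with Lie algebra $\mathfrak g$, with the corresponding left invariant structure, is canonical. It is known that a manifold is canonical, with function $\beta$, if and only if it admits a metric connection $\nabla$ with totally skew-symmetric torsion (i.e. $T(X,Y,Z)=g(T(X,Y),Z)$ is a $3$-form) such that $\nabla_X\varphi_i=\beta(\eta_k(X)\varphi_j-\eta_j(X)\varphi_k)$ for all vector fields $X$ and even permutations $(i,j,k)$ of $(1,2,3)$; this connection is unique and called the canonical connection. The $3$-form $c$ on $\mathfrak h$ is extended to $\mathfrak g$ by zero on $\mathfrak v$. *)

theory Defs
  imports "HOL-Analysis.Analysis" "HOL-Library.Function_Algebras"
begin

section \<open>Indices\<close>

text \<open>The index set \<open>{1,2,3}\<close> is the numeral type \<open>3\<close>, in which \<open>3 = 0\<close>.\<close>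

definition even_perm :: "3 \<Rightarrow> 3 \<Rightarrow> 3 \<Rightarrow> bool" where
  "even_perm i j k \<longleftrightarrow> (i, j, k) \<in> {(1, 2, 3), (2, 3, 1), (3, 1, 2)}"


section \<open>Abelian almost 3-contact metric Lie algebras\<close>

definition real_lie_bracket :: "('a::real_vector \<Rightarrow> 'a \<Rightarrow> 'a) \<Rightarrow> bool" where
  "real_lie_bracket br \<longleftrightarrow> bilinear br \<and> (\<forall>X. br X X = 0) \<and>
     (\<forall>X Y Z. br X (br Y Z) + br Y (br Z X) + br Z (br X Y) = 0)"

definition almost_contact_alg :: "('a::real_vector \<Rightarrow> 'a) \<Rightarrow> 'a \<Rightarrow> ('a \<Rightarrow> real) \<Rightarrow> bool" where
  "almost_contact_alg \<phi> \<xi> \<eta> \<longleftrightarrow> linear \<phi> \<and> linear \<eta> \<and>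
     (\<forall>X. \<phi> (\<phi> X) = - X + \<eta> X *\<^sub>R \<xi>) \<and> \<eta> \<xi> = 1"

definition abelian_almost_contact ::
  "('a::real_vector \<Rightarrow> 'a \<Rightarrow> 'a) \<Rightarrow> ('a \<Rightarrow> 'a) \<Rightarrow> 'a \<Rightarrow> ('a \<Rightarrow> real) \<Rightarrow> bool" where
  "abelian_almost_contact br \<phi> \<xi> \<eta> \<longleftrightarrow>
     (\<forall>X. br \<xi> (\<phi> X) = \<phi> (br \<xi> X)) \<and>
     (\<forall>X Y. \<eta> X = 0 \<longrightarrow> \<eta> Y = 0 \<longrightarrow> br (\<phi> X) (\<phi> Y) = br X Y)"

text \<open>The inner product of the structure is the one of the Euclidean space \<open>'a\<close>; every
  finite-dimensional real inner product space is of this form.\<close>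

definition almost_3contact_metric_lie_algebra ::
  "('a::euclidean_space \<Rightarrow> 'a \<Rightarrow> 'a) \<Rightarrow> (3 \<Rightarrow> 'a \<Rightarrow> 'a) \<Rightarrow> (3 \<Rightarrow> 'a) \<Rightarrow> (3 \<Rightarrow> 'a \<Rightarrow> real) \<Rightarrow> bool" where
  "almost_3contact_metric_lie_algebra br \<phi> \<xi> \<eta> \<longleftrightarrow>
     real_lie_bracket br \<and>
     (\<exists>n\<ge>1. DIM('a) = 4 * n + 3) \<and>
     (\<forall>i. almost_contact_alg (\<phi> i) (\<xi> i) (\<eta> i)) \<and>
     (\<forall>i j k. even_perm i j k \<longrightarrow>
        (\<forall>X. \<phi> k X = \<phi> i (\<phi> j X) - \<eta> j X *\<^sub>R \<xi> i \<and>
             \<phi> k X = - \<phi> j (\<phi> i X) + \<eta> i X *\<^sub>R \<xi> j) \<and>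
        \<xi> k = \<phi> i (\<xi> j) \<and> \<xi> k = - \<phi> j (\<xi> i) \<and>
        (\<forall>X. \<eta> k X = \<eta> i (\<phi> j X) \<and> \<eta> k X = - \<eta> j (\<phi> i X))) \<and>
     (\<forall>i X Y. \<phi> i X \<bullet> \<phi> i Y = X \<bullet> Y - \<eta> i X * \<eta> i Y)"

definition abelian_structure ::
  "('a::real_vector \<Rightarrow> 'a \<Rightarrow> 'a) \<Rightarrow> (3 \<Rightarrow> 'a \<Rightarrow> 'a) \<Rightarrow> (3 \<Rightarrow> 'a) \<Rightarrow> (3 \<Rightarrow> 'a \<Rightarrow> real) \<Rightarrow> bool" where
  "abelian_structure br \<phi> \<xi> \<eta> \<longleftrightarrow> (\<forall>i. abelian_almost_contact br (\<phi> i) (\<xi> i) (\<eta> i))"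

definition horizontal :: "(3 \<Rightarrow> 'a \<Rightarrow> real) \<Rightarrow> 'a set" where
  "horizontal \<eta> = {X. \<forall>i. \<eta> i X = 0}"

definition vertical :: "(3 \<Rightarrow> 'a::real_vector) \<Rightarrow> 'a set" where
  "vertical \<xi> = span (range \<xi>)"

definition lie_subalgebra :: "('a::real_vector \<Rightarrow> 'a \<Rightarrow> 'a) \<Rightarrow> 'a set \<Rightarrow> bool" where
  "lie_subalgebra br S \<longleftrightarrow> subspace S \<and> (\<forall>X\<in>S. \<forall>Y\<in>S. br X Y \<in> S)"

definition vertical_bracket_law ::
  "('a::real_vector \<Rightarrow> 'a \<Rightarrow> 'a) \<Rightarrow> (3 \<Rightarrow> 'a) \<Rightarrow> real \<Rightarrow> bool" where
  "vertical_bracket_law br \<xi> \<delta> \<longleftrightarrow>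
     (\<forall>i j k. even_perm i j k \<longrightarrow> br (\<xi> i) (\<xi> j) = (2 * \<delta>) *\<^sub>R \<xi> k)"

definition horizontal_ad_law ::
  "('a::real_vector \<Rightarrow> 'a \<Rightarrow> 'a) \<Rightarrow> (3 \<Rightarrow> 'a \<Rightarrow> 'a) \<Rightarrow> (3 \<Rightarrow> 'a) \<Rightarrow> (3 \<Rightarrow> 'a \<Rightarrow> real) \<Rightarrow> real \<Rightarrow> bool" where
  "horizontal_ad_law br \<phi> \<xi> \<eta> \<beta> \<longleftrightarrow>
     (\<forall>i. \<forall>X\<in>horizontal \<eta>. br (\<xi> i) X = (\<beta> / 2) *\<^sub>R \<phi> i X)"

subsection \<open>Forms on the Lie algebra\<close>

text \<open>Exterior derivative of a left invariant 1-form, and wedge products without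
  normalizing factors.\<close>

definition alg_d :: "('a \<Rightarrow> 'a \<Rightarrow> 'a) \<Rightarrow> ('a \<Rightarrow> real) \<Rightarrow> 'a \<Rightarrow> 'a \<Rightarrow> real" where
  "alg_d br \<eta> X Y = - \<eta> (br X Y)"

definition wedge11 :: "('a \<Rightarrow> real) \<Rightarrow> ('a \<Rightarrow> real) \<Rightarrow> 'a \<Rightarrow> 'a \<Rightarrow> real" where
  "wedge11 \<alpha> \<beta> X Y = \<alpha> X * \<beta> Y - \<alpha> Y * \<beta> X"

definition wedge12 ::
  "('a \<Rightarrow> real) \<Rightarrow> ('a \<Rightarrow> 'a \<Rightarrow> real) \<Rightarrow> 'a \<Rightarrow> 'a \<Rightarrow> 'a \<Rightarrow> real" where
  "wedge12 \<alpha> \<omega> X Y Z = \<alpha> X * \<omega> Y Z + \<alpha> Y * \<omega> Z X + \<alpha> Z * \<omega> X Y"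

definition horizontal_part ::
  "(3 \<Rightarrow> 'a::real_vector) \<Rightarrow> (3 \<Rightarrow> 'a \<Rightarrow> real) \<Rightarrow> 'a \<Rightarrow> 'a" where
  "horizontal_part \<xi> \<eta> X = X - (\<Sum>i\<in>UNIV. \<eta> i X *\<^sub>R \<xi> i)"

text \<open>The form \<open>c\<close> on the horizontal space, extended by zero on the vertical space.\<close>

definition c_form ::
  "('a::euclidean_space \<Rightarrow> 'a \<Rightarrow> 'a) \<Rightarrow> (3 \<Rightarrow> 'a) \<Rightarrow> (3 \<Rightarrow> 'a \<Rightarrow> real) \<Rightarrow> 'a \<Rightarrow> 'a \<Rightarrow> 'a \<Rightarrow> real" where
  "c_form br \<xi> \<eta> X Y Z =
     (let X' = horizontal_part \<xi> \<eta> X; Y' = horizontal_part \<xi> \<eta> Y; Z' = horizontal_part \<xi> \<eta> Z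
      in - (br X' Y' \<bullet> Z') - (br Y' Z' \<bullet> X') - (br Z' X' \<bullet> Y'))"

definition torsion_form ::
  "('a::euclidean_space \<Rightarrow> 'a \<Rightarrow> 'a) \<Rightarrow> (3 \<Rightarrow> 'a) \<Rightarrow> (3 \<Rightarrow> 'a \<Rightarrow> real) \<Rightarrow> real \<Rightarrow> real
     \<Rightarrow> 'a \<Rightarrow> 'a \<Rightarrow> 'a \<Rightarrow> real" where
  "torsion_form br \<xi> \<eta> \<beta> \<delta> X Y Z =
     c_form br \<xi> \<eta> X Y Z
     + (\<Sum>i\<in>UNIV. wedge12 (\<eta> i) (alg_d br (\<eta> i)) X Y Z)
     + 2 * (\<beta> + 2 * \<delta>) * wedge12 (\<eta> 1) (wedge11 (\<eta> 2) (\<eta> 3)) X Y Z"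


section \<open>Smooth manifolds and vector fields\<close>

primrec C_k_on :: "nat \<Rightarrow> 'a::real_normed_vector set \<Rightarrow> ('a \<Rightarrow> 'b::real_normed_vector) \<Rightarrow> bool" where
  "C_k_on 0 S f \<longleftrightarrow> continuous_on S f"
| "C_k_on (Suc k) S f \<longleftrightarrow> (\<forall>x\<in>S. f differentiable (at x)) \<and>
     (\<forall>v. C_k_on k S (\<lambda>x. frechet_derivative f (at x) v))"

text \<open>Meant for open \<open>S\<close> in a finite-dimensional space.\<close>

definition smooth_on :: "'a::real_normed_vector set \<Rightarrow> ('a \<Rightarrow> 'b::real_normed_vector) \<Rightarrow> bool" where
  "smooth_on S f \<longleftrightarrow> (\<forall>k. C_k_on k S f)"

text \<open>A manifold is a whole type \<open>'p\<close> with an atlas of charts \<open>(U, x)\<close>; the parametrization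
  inverse to the chart is \<open>inv_into U x\<close>. Atlases need not be maximal.\<close>

type_synonym ('p, 'm) atlas = "('p set \<times> ('p \<Rightarrow> 'm)) set"

definition smooth_atlas ::
  "('p::{t2_space,second_countable_topology}, 'm::euclidean_space) atlas \<Rightarrow> bool" where
  "smooth_atlas A \<longleftrightarrow>
     (\<Union>(U, x)\<in>A. U) = UNIV \<and>
     (\<forall>(U, x)\<in>A. open U \<and> open (x ` U) \<and> homeomorphism U (x ` U) x (inv_into U x)) \<and>
     (\<forall>(U, x)\<in>A. \<forall>(V, y)\<in>A. smooth_on (x ` (U \<inter> V)) (y \<circ> inv_into U x))"

definition smooth_map ::
  "('p::topological_space, 'm::euclidean_space) atlas
     \<Rightarrow> ('q::topological_space, 'n::euclidean_space) atlas \<Rightarrow> ('p \<Rightarrow> 'q) \<Rightarrow> bool" where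
  "smooth_map A B F \<longleftrightarrow> continuous_on UNIV F \<and>
     (\<forall>(U, x)\<in>A. \<forall>(V, y)\<in>B. smooth_on (x ` (U \<inter> F -` V)) (y \<circ> F \<circ> inv_into U x))"

definition smooth_functions :: "('p, 'm::euclidean_space) atlas \<Rightarrow> ('p \<Rightarrow> real) set" where
  "smooth_functions A = {f. \<forall>(U, x)\<in>A. smooth_on (x ` U) (f \<circ> inv_into U x)}"

definition prod_atlas :: "('p, 'm) atlas \<Rightarrow> ('q, 'n) atlas \<Rightarrow> ('p \<times> 'q, 'm \<times> 'n) atlas" where
  "prod_atlas A B = {(U \<times> V, map_prod x y) | U x V y. (U, x) \<in> A \<and> (V, y) \<in> B}"

text \<open>Vector fields are derivations of the algebra of smooth functions, extended by zero to all
  functions, so that equality of vector fields is equality in HOL. Sums, products and constants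
  of functions (and sums of vector fields) are the pointwise ones.\<close>

type_synonym 'p vfield = "('p \<Rightarrow> real) \<Rightarrow> 'p \<Rightarrow> real"

definition vector_fields :: "('p, 'm::euclidean_space) atlas \<Rightarrow> 'p vfield set" where
  "vector_fields A = {X.
     (\<forall>f. f \<notin> smooth_functions A \<longrightarrow> X f = 0) \<and>
     (\<forall>f\<in>smooth_functions A. X f \<in> smooth_functions A) \<and>
     (\<forall>f\<in>smooth_functions A. \<forall>h\<in>smooth_functions A.
        X (f + h) = X f + X h \<and> X (f * h) = f * X h + h * X f) \<and>
     (\<forall>f\<in>smooth_functions A. \<forall>a. X ((\<lambda>_. a) * f) = (\<lambda>_. a) * X f)}"

definition vf_mult :: "('p \<Rightarrow> real) \<Rightarrow> 'p vfield \<Rightarrow> 'p vfield" (infixr "\<cdot>" 75) where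
  "h \<cdot> X = (\<lambda>f. h * X f)"

definition vf_bracket :: "'p vfield \<Rightarrow> 'p vfield \<Rightarrow> 'p vfield" where
  "vf_bracket X Y = (\<lambda>f. X (Y f) - Y (X f))"

text \<open>Tensor fields are \<open>C\<^sup>\<infinity>\<close>-multilinear maps on vector fields.\<close>

definition one_form :: "('p, 'm::euclidean_space) atlas \<Rightarrow> ('p vfield \<Rightarrow> 'p \<Rightarrow> real) \<Rightarrow> bool" where
  "one_form A \<omega> \<longleftrightarrow>
     (\<forall>X\<in>vector_fields A. \<omega> X \<in> smooth_functions A) \<and>
     (\<forall>X\<in>vector_fields A. \<forall>Y\<in>vector_fields A. \<omega> (X + Y) = \<omega> X + \<omega> Y) \<and>
     (\<forall>h\<in>smooth_functions A. \<forall>X\<in>vector_fields A. \<omega> (h \<cdot> X) = h * \<omega> X)"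

definition endo_field :: "('p, 'm::euclidean_space) atlas \<Rightarrow> ('p vfield \<Rightarrow> 'p vfield) \<Rightarrow> bool" where
  "endo_field A \<phi> \<longleftrightarrow>
     (\<forall>X\<in>vector_fields A. \<phi> X \<in> vector_fields A) \<and>
     (\<forall>X\<in>vector_fields A. \<forall>Y\<in>vector_fields A. \<phi> (X + Y) = \<phi> X + \<phi> Y) \<and>
     (\<forall>h\<in>smooth_functions A. \<forall>X\<in>vector_fields A. \<phi> (h \<cdot> X) = h \<cdot> \<phi> X)"

definition riemannian_metric ::
  "('p, 'm::euclidean_space) atlas \<Rightarrow> ('p vfield \<Rightarrow> 'p vfield \<Rightarrow> 'p \<Rightarrow> real) \<Rightarrow> bool" where
  "riemannian_metric A g \<longleftrightarrow>
     (\<forall>Y\<in>vector_fields A. one_form A (\<lambda>X. g X Y)) \<and>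
     (\<forall>X\<in>vector_fields A. \<forall>Y\<in>vector_fields A. g X Y = g Y X) \<and>
     (\<forall>X\<in>vector_fields A. \<forall>p. g X X p \<ge> 0 \<and> (g X X p = 0 \<longrightarrow> (\<forall>f. X f p = 0)))"

definition ext_d1 :: "('p vfield \<Rightarrow> 'p \<Rightarrow> real) \<Rightarrow> 'p vfield \<Rightarrow> 'p vfield \<Rightarrow> 'p \<Rightarrow> real" where
  "ext_d1 \<omega> X Y = X (\<omega> Y) - Y (\<omega> X) - \<omega> (vf_bracket X Y)"

definition ext_d2 ::
  "('p vfield \<Rightarrow> 'p vfield \<Rightarrow> 'p \<Rightarrow> real) \<Rightarrow> 'p vfield \<Rightarrow> 'p vfield \<Rightarrow> 'p vfield \<Rightarrow> 'p \<Rightarrow> real" where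
  "ext_d2 \<Omega> X Y Z = X (\<Omega> Y Z) + Y (\<Omega> Z X) + Z (\<Omega> X Y)
     - \<Omega> (vf_bracket X Y) Z - \<Omega> (vf_bracket Y Z) X - \<Omega> (vf_bracket Z X) Y"


section \<open>Almost 3-contact metric manifolds\<close>

record 'p a3c_structure =
  phi :: "3 \<Rightarrow> 'p vfield \<Rightarrow> 'p vfield"
  xi :: "3 \<Rightarrow> 'p vfield"
  eta :: "3 \<Rightarrow> 'p vfield \<Rightarrow> 'p \<Rightarrow> real"
  met :: "'p vfield \<Rightarrow> 'p vfield \<Rightarrow> 'p \<Rightarrow> real"

definition almost_3contact_metric_manifold ::
  "('p::{t2_space,second_countable_topology}, 'm::euclidean_space) atlas \<Rightarrow> 'p a3c_structure \<Rightarrow> bool" where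
  "almost_3contact_metric_manifold A S \<longleftrightarrow>
     smooth_atlas A \<and>
     (\<exists>n\<ge>1. DIM('m) = 4 * n + 3) \<and>
     (\<forall>i. endo_field A (phi S i) \<and> xi S i \<in> vector_fields A \<and> one_form A (eta S i) \<and>
        (\<forall>X\<in>vector_fields A. phi S i (phi S i X) = - X + eta S i X \<cdot> xi S i) \<and>
        eta S i (xi S i) = 1) \<and>
     (\<forall>i j k. even_perm i j k \<longrightarrow>
        (\<forall>X\<in>vector_fields A.
           phi S k X = phi S i (phi S j X) - eta S j X \<cdot> xi S i \<and>
           phi S k X = - phi S j (phi S i X) + eta S i X \<cdot> xi S j) \<and>
        xi S k = phi S i (xi S j) \<and> xi S k = - phi S j (xi S i) \<and>
        (\<forall>X\<in>vector_fields A.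
           eta S k X = eta S i (phi S j X) \<and> eta S k X = - eta S j (phi S i X))) \<and>
     riemannian_metric A (met S) \<and>
     (\<forall>i. \<forall>X\<in>vector_fields A. \<forall>Y\<in>vector_fields A.
        met S (phi S i X) (phi S i Y) = met S X Y - eta S i X * eta S i Y)"

definition horizontal_fields ::
  "('p, 'm::euclidean_space) atlas \<Rightarrow> 'p a3c_structure \<Rightarrow> 'p vfield set" where
  "horizontal_fields A S = {X \<in> vector_fields A. \<forall>i. eta S i X = 0}"

definition fund_form :: "'p a3c_structure \<Rightarrow> 3 \<Rightarrow> 'p vfield \<Rightarrow> 'p vfield \<Rightarrow> 'p \<Rightarrow> real" where
  "fund_form S i X Y = met S X (phi S i Y)"

definition N_tensor :: "'p a3c_structure \<Rightarrow> 3 \<Rightarrow> 'p vfield \<Rightarrow> 'p vfield \<Rightarrow> 'p vfield" where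
  "N_tensor S i X Y =
     vf_bracket (phi S i X) (phi S i Y) + phi S i (phi S i (vf_bracket X Y))
     - phi S i (vf_bracket (phi S i X) Y) - phi S i (vf_bracket X (phi S i Y))
     + ext_d1 (eta S i) X Y \<cdot> xi S i"

definition N_form ::
  "'p a3c_structure \<Rightarrow> 3 \<Rightarrow> 'p vfield \<Rightarrow> 'p vfield \<Rightarrow> 'p vfield \<Rightarrow> 'p \<Rightarrow> real" where
  "N_form S i X Y Z = met S (N_tensor S i X Y) Z"

definition skew3_on ::
  "'v set \<Rightarrow> ('v \<Rightarrow> 'v \<Rightarrow> 'v \<Rightarrow> 'p \<Rightarrow> real) \<Rightarrow> bool" where
  "skew3_on V T \<longleftrightarrow> (\<forall>X\<in>V. \<forall>Y\<in>V. \<forall>Z\<in>V. T X Y Z = - T Y X Z \<and> T X Y Z = - T X Z Y)"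

definition killing ::
  "('p, 'm::euclidean_space) atlas \<Rightarrow> ('p vfield \<Rightarrow> 'p vfield \<Rightarrow> 'p \<Rightarrow> real) \<Rightarrow> 'p vfield \<Rightarrow> bool" where
  "killing A g V \<longleftrightarrow> (\<forall>X\<in>vector_fields A. \<forall>Y\<in>vector_fields A.
     V (g X Y) - g (vf_bracket V X) Y - g X (vf_bracket V Y) = 0)"

definition lie_deriv_endo ::
  "'p vfield \<Rightarrow> ('p vfield \<Rightarrow> 'p vfield) \<Rightarrow> 'p vfield \<Rightarrow> 'p vfield" where
  "lie_deriv_endo V \<phi> X = vf_bracket V (\<phi> X) - \<phi> (vf_bracket V X)"

definition A_tensor ::
  "'p a3c_structure \<Rightarrow> 3 \<Rightarrow> 3 \<Rightarrow> 'p vfield \<Rightarrow> 'p vfield \<Rightarrow> 'p \<Rightarrow> real" where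
  "A_tensor S i j X Y =
     met S (lie_deriv_endo (xi S j) (phi S i) X) Y
     + ext_d1 (eta S j) X (phi S i Y) + ext_d1 (eta S j) (phi S i X) Y"

definition canonical_with ::
  "('p::{t2_space,second_countable_topology}, 'm::euclidean_space) atlas \<Rightarrow> 'p a3c_structure
     \<Rightarrow> ('p \<Rightarrow> real) \<Rightarrow> bool" where
  "canonical_with A S b \<longleftrightarrow>
     almost_3contact_metric_manifold A S \<and>
     (\<forall>i. skew3_on (horizontal_fields A S) (N_form S i)) \<and>
     (\<forall>i. killing A (met S) (xi S i)) \<and>
     (\<forall>i j. \<forall>X\<in>horizontal_fields A S. \<forall>Y\<in>horizontal_fields A S. \<forall>Z\<in>horizontal_fields A S.
        N_form S i X Y Z - ext_d2 (fund_form S i) (phi S i X) (phi S i Y) (phi S i Z)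
        = N_form S j X Y Z - ext_d2 (fund_form S j) (phi S j X) (phi S j Y) (phi S j Z)) \<and>
     b \<in> smooth_functions A \<and>
     (\<forall>i. \<forall>X\<in>horizontal_fields A S. \<forall>Y\<in>horizontal_fields A S. A_tensor S i i X Y = 0) \<and>
     (\<forall>i j k. even_perm i j k \<longrightarrow>
        (\<forall>X\<in>horizontal_fields A S. \<forall>Y\<in>horizontal_fields A S.
           A_tensor S i j X Y = b * fund_form S k X Y \<and>
           - A_tensor S j i X Y = b * fund_form S k X Y))"

definition canonical ::
  "('p::{t2_space,second_countable_topology}, 'm::euclidean_space) atlas \<Rightarrow> 'p a3c_structure \<Rightarrow> bool" where
  "canonical A S \<longleftrightarrow> (\<exists>b. canonical_with A S b)"

subsection \<open>Connections\<close>

definition affine_connection ::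
  "('p, 'm::euclidean_space) atlas \<Rightarrow> ('p vfield \<Rightarrow> 'p vfield \<Rightarrow> 'p vfield) \<Rightarrow> bool" where
  "affine_connection A D \<longleftrightarrow>
     (\<forall>Y\<in>vector_fields A. endo_field A (\<lambda>X. D X Y)) \<and>
     (\<forall>X\<in>vector_fields A. \<forall>Y\<in>vector_fields A. \<forall>Z\<in>vector_fields A.
        D X (Y + Z) = D X Y + D X Z) \<and>
     (\<forall>X\<in>vector_fields A. \<forall>Y\<in>vector_fields A. \<forall>h\<in>smooth_functions A.
        D X (h \<cdot> Y) = X h \<cdot> Y + h \<cdot> D X Y)"

definition metric_connection ::
  "('p, 'm::euclidean_space) atlas \<Rightarrow> ('p vfield \<Rightarrow> 'p vfield \<Rightarrow> 'p \<Rightarrow> real)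
     \<Rightarrow> ('p vfield \<Rightarrow> 'p vfield \<Rightarrow> 'p vfield) \<Rightarrow> bool" where
  "metric_connection A g D \<longleftrightarrow> affine_connection A D \<and>
     (\<forall>X\<in>vector_fields A. \<forall>Y\<in>vector_fields A. \<forall>Z\<in>vector_fields A.
        X (g Y Z) = g (D X Y) Z + g Y (D X Z))"

definition torsion3 ::
  "('p vfield \<Rightarrow> 'p vfield \<Rightarrow> 'p \<Rightarrow> real) \<Rightarrow> ('p vfield \<Rightarrow> 'p vfield \<Rightarrow> 'p vfield)
     \<Rightarrow> 'p vfield \<Rightarrow> 'p vfield \<Rightarrow> 'p vfield \<Rightarrow> 'p \<Rightarrow> real" where
  "torsion3 g D X Y Z = g (D X Y - D Y X - vf_bracket X Y) Z"

text \<open>The canonical connection of a canonical manifold with function \<open>b\<close>.\<close>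

definition canonical_connection ::
  "('p, 'm::euclidean_space) atlas \<Rightarrow> 'p a3c_structure \<Rightarrow> ('p \<Rightarrow> real)
     \<Rightarrow> ('p vfield \<Rightarrow> 'p vfield \<Rightarrow> 'p vfield) \<Rightarrow> bool" where
  "canonical_connection A S b D \<longleftrightarrow>
     metric_connection A (met S) D \<and>
     skew3_on (vector_fields A) (torsion3 (met S) D) \<and>
     (\<forall>i j k. even_perm i j k \<longrightarrow>
        (\<forall>X\<in>vector_fields A. \<forall>Y\<in>vector_fields A.
           D X (phi S i Y) - phi S i (D X Y)
           = b \<cdot> (eta S k X \<cdot> phi S j Y - eta S j X \<cdot> phi S k Y)))"


section \<open>Lie groups and left invariant structures\<close>

definition lie_group ::
  "('p::{t2_space,second_countable_topology}, 'm::euclidean_space) atlas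
     \<Rightarrow> ('p \<Rightarrow> 'p \<Rightarrow> 'p) \<Rightarrow> 'p \<Rightarrow> ('p \<Rightarrow> 'p) \<Rightarrow> bool" where
  "lie_group A mul e iv \<longleftrightarrow>
     smooth_atlas A \<and> group mul e iv \<and>
     smooth_map (prod_atlas A A) A (\<lambda>(p, q). mul p q) \<and> smooth_map A A iv"

definition left_invariant_fields ::
  "('p, 'm::euclidean_space) atlas \<Rightarrow> ('p \<Rightarrow> 'p \<Rightarrow> 'p) \<Rightarrow> 'p vfield set" where
  "left_invariant_fields A mul =
     {X \<in> vector_fields A. \<forall>q f. X (f \<circ> mul q) = X f \<circ> mul q}"

text \<open>\<open>\<iota>\<close> identifies the Lie algebra \<open>('a, br)\<close> with the Lie algebra of left invariant fields.\<close>

definition lie_algebra_iso ::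
  "('p, 'm::euclidean_space) atlas \<Rightarrow> ('p \<Rightarrow> 'p \<Rightarrow> 'p) \<Rightarrow> ('a::real_vector \<Rightarrow> 'a \<Rightarrow> 'a)
     \<Rightarrow> ('a \<Rightarrow> 'p vfield) \<Rightarrow> bool" where
  "lie_algebra_iso A mul br \<iota> \<longleftrightarrow>
     bij_betw \<iota> UNIV (left_invariant_fields A mul) \<and>
     (\<forall>X Y. \<iota> (X + Y) = \<iota> X + \<iota> Y) \<and>
     (\<forall>a X. \<iota> (a *\<^sub>R X) = (\<lambda>_. a) \<cdot> \<iota> X) \<and>
     (\<forall>X Y. \<iota> (br X Y) = vf_bracket (\<iota> X) (\<iota> Y))"

text \<open>The Maurer-Cartan form: \<open>maurer_cartan \<iota> X p\<close> is the element of the Lie algebra whose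
  left invariant field has the same value at \<open>p\<close> as \<open>X\<close>. A tensor on the Lie algebra
  is transported to a left invariant one by applying it to the values of this form.\<close>

definition maurer_cartan :: "('a \<Rightarrow> 'p vfield) \<Rightarrow> 'p vfield \<Rightarrow> 'p \<Rightarrow> 'a" where
  "maurer_cartan \<iota> X p = (THE v. \<forall>f. X f p = \<iota> v f p)"

definition left_invariant_structure ::
  "('a::euclidean_space \<Rightarrow> 'p vfield) \<Rightarrow> (3 \<Rightarrow> 'a \<Rightarrow> 'a) \<Rightarrow> (3 \<Rightarrow> 'a) \<Rightarrow> (3 \<Rightarrow> 'a \<Rightarrow> real)
     \<Rightarrow> 'p a3c_structure" where
  "left_invariant_structure \<iota> \<phi> \<xi> \<eta> =
     \<lparr> phi = (\<lambda>i X f p. \<iota> (\<phi> i (maurer_cartan \<iota> X p)) f p),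
       xi = (\<lambda>i. \<iota> (\<xi> i)),
       eta = (\<lambda>i X p. \<eta> i (maurer_cartan \<iota> X p)),
       met = (\<lambda>X Y p. maurer_cartan \<iota> X p \<bullet> maurer_cartan \<iota> Y p) \<rparr>"

definition left_invariant_form3 ::
  "('a \<Rightarrow> 'p vfield) \<Rightarrow> ('a \<Rightarrow> 'a \<Rightarrow> 'a \<Rightarrow> real)
     \<Rightarrow> 'p vfield \<Rightarrow> 'p vfield \<Rightarrow> 'p vfield \<Rightarrow> 'p \<Rightarrow> real" where
  "left_invariant_form3 \<iota> \<tau> X Y Z =
     (\<lambda>p. \<tau> (maurer_cartan \<iota> X p) (maurer_cartan \<iota> Y p) (maurer_cartan \<iota> Z p))"

end

(*
On the Lie algebra, the abelian conditions make every N_i and every A_ii vanish on the horizontal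
space and make (iii) automatic, so being canonical means that all ad xi_i are skew and that
[ad xi_i, phi_j] = beta phi_k horizontally. Put C_i = ad xi_i - (beta/2) phi_i on the horizontal space.
Applying the abelian condition to the pairs (xi_k, X) gives C_k = C_i phi_j = phi_j C_i, which
is symmetric as well as skew, hence zero; the same identities force the brackets [xi_i, xi_j] to be
vertical.

On the group, the left invariant fields form a global frame, so a vector field X becomes a smooth
Lie algebra valued function x, with [X, Y] corresponding to X y - Y x + [x, y]. In each of the tensors
in question the derivative terms cancel, and what remains is the expression on the Lie algebra.
That the frame spans all vector fields, with smooth coefficients, is not immediate when vector
fields are derivations of smooth functions: a derivation at p is a directional derivative by
Hadamard's lemma, and the coefficients of X at p are obtained by applying X to
q |-> f (p^-1 q) at q = p for coordinate functions f at the identity.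
*)
theory Submission
  imports Defs
begin

section \<open>Smooth functions on open subsets of normed spaces\<close>

text \<open>Vector fields are derivations of global functions only, so coordinates of a chart can be
  used just after they have been cut off and extended; this is the reason for the bump functions
  built from exp(-1/t). The function b in the definition of canonical is not constant by assumption.
  At each point its value satisfies the algebraic conditions, and these determine it because 4n + 3
  > 3 leaves a nonzero horizontal vector. The symbols \<open>K\<close> of the canonical connection
  come from Koszul's formula plus half of the expected torsion. With P the bracket of horizontal
  parts, the terms g(P(X, Y), Z) and g(P(Z, X), Y) cancel and -g(P(Y, Z), X) remains; in front of
  the volume form Koszul's formula contributes \<delta> and half the torsion \<beta> - \<delta>, so
  that \<delta> disappears from \<open>K\<close>. A given canonical connection need not be left
  invariant a priori, so its symbols are compared with \<open>K\<close> at each point separately: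
  the difference of the two is a 3-form, and its compatibility with all three \<phi>_i makes it
  zero.\<close>

lemma C_k_on_cong:
  assumes "open S" "\<And>x. x \<in> S \<Longrightarrow> f x = g x"
  shows "C_k_on k S f \<longleftrightarrow> C_k_on k S g"
proof -
  have imp: "C_k_on k S g" if "C_k_on k S f" "\<And>x. x \<in> S \<Longrightarrow> f x = g x" for f g :: "'a \<Rightarrow> 'b" and k
    using that
  proof (induction k arbitrary: f g)
    case 0
    then show ?case by (simp cong: continuous_on_cong)
  next
    case (Suc k)
    have der: "(g has_derivative frechet_derivative f (at x)) (at x)" if "x \<in> S" for x
      using Suc.prems that \<open>open S\<close>
      by (auto simp: frechet_derivative_works intro: has_derivative_transform_within_open)
    have "C_k_on k S (\<lambda>x. frechet_derivative g (at x) v)" for v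
    proof (rule Suc.IH)
      show "C_k_on k S (\<lambda>x. frechet_derivative f (at x) v)" using Suc.prems(1) by simp
      show "frechet_derivative f (at x) v = frechet_derivative g (at x) v" if "x \<in> S" for x
        using frechet_derivative_at[OF der[OF that]] by simp
    qed
    then show ?case
      using der by (auto simp: differentiable_def)
  qed
  show ?thesis
    using imp[of k f g] imp[of k g f] assms(2) by (metis (no_types))
qed

lemma C_k_on_SucI:
  assumes "open S" "\<And>x. x \<in> S \<Longrightarrow> (f has_derivative f' x) (at x)"
    and "\<And>v. C_k_on k S (\<lambda>x. f' x v)"
  shows "C_k_on (Suc k) S f"
proof -
  have "C_k_on k S (\<lambda>x. frechet_derivative f (at x) v)" for v
    using assms(3)[of v] frechet_derivative_at[OF assms(2)]
    by (subst C_k_on_cong[OF assms(1), where g = "\<lambda>x. f' x v"]) auto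
  then show ?thesis
    using assms(2) by (auto simp: differentiable_def)
qed

lemma C_k_on_SucD:
  assumes "C_k_on (Suc k) S f" "x \<in> S"
  shows "(f has_derivative frechet_derivative f (at x)) (at x)"
  using assms by (auto simp: frechet_derivative_works)

lemma C_k_on_SucD2: "C_k_on (Suc k) S f \<Longrightarrow> C_k_on k S (\<lambda>x. frechet_derivative f (at x) v)"
  by simp

lemma C_k_on_Suc_imp: "C_k_on (Suc k) S f \<Longrightarrow> C_k_on k S f"
proof (induction k arbitrary: f)
  case 0
  then show ?case
    by (auto intro!: continuous_at_imp_continuous_on differentiable_imp_continuous_within)
next
  case (Suc k)
  show ?case
    unfolding C_k_on.simps(2)[of k]
    using Suc.prems unfolding C_k_on.simps(2)[of "Suc k"]
    by (intro conjI allI Suc.IH) blast+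
qed

lemma C_k_on_subset: "C_k_on k S f \<Longrightarrow> T \<subseteq> S \<Longrightarrow> C_k_on k T f"
  by (induction k arbitrary: f) (auto intro: continuous_on_subset)

lemma C_k_on_local:
  assumes "\<And>x. x \<in> S \<Longrightarrow> \<exists>T. open T \<and> x \<in> T \<and> C_k_on k T f"
  shows "C_k_on k S f"
  using assms
proof (induction k arbitrary: f)
  case 0
  have "isCont f x" if x: "x \<in> S" for x
  proof -
    from 0[OF x] obtain T where "open T" "x \<in> T" "continuous_on T f" by auto
    then show ?thesis by (simp add: continuous_on_eq_continuous_at)
  qed
  then show ?case
    by (simp add: continuous_at_imp_continuous_on)
next
  case (Suc k)
  have T: "\<exists>T. open T \<and> x \<in> T \<and> (\<forall>x\<in>T. f differentiable (at x)) \<and>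
      (\<forall>v. C_k_on k T (\<lambda>x. frechet_derivative f (at x) v))" if "x \<in> S" for x
    using Suc.prems[OF that] by simp
  have "C_k_on k S (\<lambda>x. frechet_derivative f (at x) v)" for v
    by (rule Suc.IH) (use T in blast)
  moreover have "f differentiable (at x)" if "x \<in> S" for x
    using T[OF that] by blast
  ultimately show ?case by simp
qed

lemma C_k_on_const: "open S \<Longrightarrow> C_k_on k S (\<lambda>x. c)"
proof (induction k arbitrary: c)
  case (Suc k)
  show ?case
    by (rule C_k_on_SucI[OF Suc.prems has_derivative_const Suc.IH[OF Suc.prems]])
qed auto

lemma C_k_on_add:
  assumes "open S" "C_k_on k S f" "C_k_on k S g"
  shows "C_k_on k S (\<lambda>x. f x + g x)"
  using assms(2,3)
proof (induction k arbitrary: f g)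
  case 0
  then show ?case by (auto intro: continuous_on_add)
next
  case (Suc k)
  show ?case
    by (intro C_k_on_SucI[OF assms(1) has_derivative_add[OF Suc.prems[THEN C_k_on_SucD]]]
        Suc.IH Suc.prems[THEN C_k_on_SucD2])
qed

lemma C_k_on_sum:
  assumes "open S" "\<And>i. i \<in> I \<Longrightarrow> C_k_on k S (f i)"
  shows "C_k_on k S (\<lambda>x. \<Sum>i\<in>I. f i x)"
  using assms(2)
  by (induction I rule: infinite_finite_induct) (auto intro: C_k_on_const C_k_on_add assms(1))

lemma C_k_on_linear:
  assumes "open S" "bounded_linear L" "C_k_on k S f"
  shows "C_k_on k S (\<lambda>x. L (f x))"
  using assms(3)
proof (induction k arbitrary: f)
  case 0
  then show ?case using assms(2) by (auto intro: bounded_linear.continuous_on)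
next
  case (Suc k)
  show ?case
    by (intro C_k_on_SucI[OF assms(1) bounded_linear.has_derivative[OF assms(2)
            Suc.prems[THEN C_k_on_SucD]]] Suc.IH Suc.prems[THEN C_k_on_SucD2])
qed

lemma C_k_on_bilinear:
  assumes "open S" "bounded_bilinear B" "C_k_on k S f" "C_k_on k S g"
  shows "C_k_on k S (\<lambda>x. B (f x) (g x))"
  using assms(3,4)
proof (induction k arbitrary: f g)
  case 0
  then show ?case using assms(2) by (auto intro: bounded_bilinear.continuous_on)
next
  case (Suc k)
  have "C_k_on k S f" "C_k_on k S g"
    using Suc.prems by (auto intro: C_k_on_Suc_imp)
  then show ?case
    by (intro C_k_on_SucI[OF assms(1) bounded_bilinear.FDERIV[OF assms(2)
            Suc.prems[THEN C_k_on_SucD]]]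
        C_k_on_add assms(1) Suc.IH Suc.prems[THEN C_k_on_SucD2])
qed

lemma C_k_on_id: "open S \<Longrightarrow> C_k_on k S (\<lambda>x. x)"
  by (cases k) (auto intro!: C_k_on_SucI[OF _ has_derivative_ident] C_k_on_const)

lemma has_derivative_expand:
  fixes g :: "'a::euclidean_space \<Rightarrow> 'b::real_normed_vector"
  assumes "(g has_derivative g') F"
  shows "g' v = (\<Sum>b\<in>Basis. (v \<bullet> b) *\<^sub>R g' b)"
proof -
  interpret bounded_linear g' using assms by (rule has_derivative_bounded_linear)
  have "g' v = g' (\<Sum>b\<in>Basis. (v \<bullet> b) *\<^sub>R b)" by (simp add: euclidean_representation)
  then show ?thesis by (simp add: sum scaleR)
qed

text \<open>\<open>C_k_on\<close> only speaks of derivatives in a fixed direction, but in the chain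
  rule g is differentiated in the direction f'(x) v, which moves with x. Expanding that direction
  over \<open>Basis\<close> turns the derivative into a finite sum of products of C^k functions;
  this is what the Euclidean middle space is for.\<close>

lemma C_k_on_compose:
  fixes f :: "'a::real_normed_vector \<Rightarrow> 'b::euclidean_space"
    and g :: "'b \<Rightarrow> 'c::real_normed_vector"
  assumes "open S" "C_k_on k S f" "f ` S \<subseteq> T" "C_k_on k T g"
  shows "C_k_on k S (\<lambda>x. g (f x))"
  using assms(2,4)
proof (induction k arbitrary: g)
  case 0
  then show ?case using assms(3) by (auto intro: continuous_on_compose2)
next
  case (Suc k)
  have f: "C_k_on k S f"
    using Suc.prems by (auto intro: C_k_on_Suc_imp)
  have g': "(g has_derivative frechet_derivative g (at (f x))) (at (f x))" if "x \<in> S" for x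
    using Suc.prems(2) assms(3) that by (intro C_k_on_SucD) auto
  have der: "((\<lambda>x. g (f x)) has_derivative
      (\<lambda>v. \<Sum>b\<in>Basis. (frechet_derivative f (at x) v \<bullet> b) *\<^sub>R frechet_derivative g (at (f x)) b)) (at x)"
    if "x \<in> S" for x
    using has_derivative_compose[OF C_k_on_SucD[OF Suc.prems(1) that] g'[OF that]]
    by (subst (asm) has_derivative_expand[OF g'[OF that]])
  show ?case
    by (intro C_k_on_SucI[OF assms(1) der] C_k_on_sum assms(1)
        C_k_on_bilinear[OF _ bounded_bilinear_scaleR] C_k_on_bilinear[OF _ bounded_bilinear_inner]
        C_k_on_const Suc.IH)
      (use Suc.prems f in simp_all)
qed

lemma smooth_on_cong:
  assumes "open S" "\<And>x. x \<in> S \<Longrightarrow> f x = g x"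
  shows "smooth_on S f \<longleftrightarrow> smooth_on S g"
  using C_k_on_cong[OF assms] by (auto simp: smooth_on_def)

lemma smooth_on_eq:
  assumes "smooth_on S f" "open S" "\<And>x. x \<in> S \<Longrightarrow> f x = g x"
  shows "smooth_on S g"
  using smooth_on_cong[OF assms(2,3)] assms(1) by auto

lemma smooth_on_subset: "smooth_on S f \<Longrightarrow> T \<subseteq> S \<Longrightarrow> smooth_on T f"
  by (auto simp: smooth_on_def intro: C_k_on_subset)

lemma smooth_on_local:
  "(\<And>x. x \<in> S \<Longrightarrow> \<exists>T. open T \<and> x \<in> T \<and> smooth_on T f) \<Longrightarrow> smooth_on S f"
  unfolding smooth_on_def by (meson C_k_on_local)

lemma smooth_on_const: "open S \<Longrightarrow> smooth_on S (\<lambda>x. c)"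
  by (simp add: smooth_on_def C_k_on_const)

lemma smooth_on_id: "open S \<Longrightarrow> smooth_on S (\<lambda>x. x)"
  by (simp add: smooth_on_def C_k_on_id)

lemma smooth_on_add:
  "open S \<Longrightarrow> smooth_on S f \<Longrightarrow> smooth_on S g \<Longrightarrow> smooth_on S (\<lambda>x. f x + g x)"
  by (simp add: smooth_on_def C_k_on_add)

lemma smooth_on_sum:
  "open S \<Longrightarrow> (\<And>i. i \<in> I \<Longrightarrow> smooth_on S (f i)) \<Longrightarrow> smooth_on S (\<lambda>x. \<Sum>i\<in>I. f i x)"
  by (simp add: smooth_on_def C_k_on_sum)

lemma smooth_on_linear:
  "open S \<Longrightarrow> bounded_linear L \<Longrightarrow> smooth_on S f \<Longrightarrow> smooth_on S (\<lambda>x. L (f x))"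
  by (simp add: smooth_on_def C_k_on_linear)

lemma smooth_on_bilinear:
  "open S \<Longrightarrow> bounded_bilinear B \<Longrightarrow> smooth_on S f \<Longrightarrow> smooth_on S g \<Longrightarrow>
    smooth_on S (\<lambda>x. B (f x) (g x))"
  by (simp add: smooth_on_def C_k_on_bilinear)

lemmas smooth_on_mult = smooth_on_bilinear[OF _ bounded_bilinear_mult]
  and smooth_on_inner = smooth_on_bilinear[OF _ bounded_bilinear_inner]
  and smooth_on_scaleR = smooth_on_bilinear[OF _ bounded_bilinear_scaleR]

lemma smooth_on_compose:
  fixes f :: "'a::real_normed_vector \<Rightarrow> 'b::euclidean_space"
  shows "open S \<Longrightarrow> smooth_on S f \<Longrightarrow> f ` S \<subseteq> T \<Longrightarrow> smooth_on T g \<Longrightarrow> smooth_on S (\<lambda>x. g (f x))"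
  unfolding smooth_on_def by (blast intro: C_k_on_compose)

lemma smooth_on_Pair:
  assumes "open S" "smooth_on S f" "smooth_on S g"
  shows "smooth_on S (\<lambda>x. (f x, g x))"
proof -
  have "smooth_on S (\<lambda>x. (f x, 0) + (0, g x))"
    by (intro smooth_on_add assms smooth_on_linear[where L = "\<lambda>u. (u, 0)"]
        smooth_on_linear[where L = "\<lambda>u. (0, u)"])
      (auto intro: bounded_linear_Pair bounded_linear_ident bounded_linear_zero)
  then show ?thesis by simp
qed

lemma smooth_on_frechet_derivative:
  assumes "smooth_on S f"
  shows "smooth_on S (\<lambda>x. frechet_derivative f (at x) v)"
  unfolding smooth_on_def
proof
  fix k
  have "C_k_on (Suc k) S f" using assms by (simp add: smooth_on_def del: C_k_on.simps)
  then show "C_k_on k S (\<lambda>x. frechet_derivative f (at x) v)" by simp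
qed

lemma smooth_on_has_derivative:
  assumes "smooth_on S f" "x \<in> S"
  shows "(f has_derivative frechet_derivative f (at x)) (at x)"
proof (rule C_k_on_SucD)
  show "C_k_on (Suc 0) S f" using assms(1) unfolding smooth_on_def by blast
qed fact

lemma smooth_on_imp_continuous_on: "smooth_on S f \<Longrightarrow> continuous_on S f"
  unfolding smooth_on_def by (metis C_k_on.simps(1))

text \<open>The derivative of \<open>inverse\<close> is a product of copies of
  \<open>inverse\<close>, so the induction on the order of differentiability feeds itself.\<close>

lemma smooth_on_inverse:
  fixes f :: "'a::real_normed_vector \<Rightarrow> real"
  assumes "open S" "smooth_on S f" "\<And>x. x \<in> S \<Longrightarrow> f x \<noteq> 0"
  shows "smooth_on S (\<lambda>x. inverse (f x))"
proof -
  have op: "open (- {0::real})" by auto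
  have "C_k_on k (- {0}) (inverse :: real \<Rightarrow> real)" for k
  proof (induction k)
    case 0
    then show ?case by (auto intro: continuous_intros)
  next
    case (Suc k)
    show ?case
    proof (rule C_k_on_SucI[OF op has_derivative_inverse'])
      fix v :: real
      have "C_k_on k (- {0}) (\<lambda>x. (- v) * (inverse x * inverse x))"
        by (intro C_k_on_bilinear[OF _ bounded_bilinear_mult] C_k_on_const Suc op)
      then show "C_k_on k (- {0}) (\<lambda>x. - (inverse x * v * inverse x))"
        by (simp add: mult_ac)
    qed auto
  qed
  then show ?thesis
    using assms by (intro smooth_on_compose[of S f "- {0}" inverse]) (auto simp: smooth_on_def)
qed

section \<open>Bump functions\<close>

text \<open>\<open>flat 0\<close> is the classical function exp(-1/t), continued by 0. The powers of
  1/t are carried along because the derivative of \<open>flat n\<close> is a combination of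
  \<open>flat (n + 1)\<close> and \<open>flat (n + 2)\<close>: the span of the family is closed
  under differentiation.\<close>

definition flat :: "nat \<Rightarrow> real \<Rightarrow> real" where
  "flat n t = (if t > 0 then inverse t ^ n * exp (- inverse t) else 0)"

text \<open>With s = 1/t the claim from the right is that exp(s) outgrows every power of s; on the
  left the function is zero.\<close>

lemma flat_tendsto_0: "(flat n \<longlongrightarrow> 0) (at 0)"
proof -
  have "((\<lambda>t. inverse t ^ n / exp (inverse t)) \<longlongrightarrow> (0::real)) (at_right 0)"
    by (rule filterlim_compose[OF tendsto_power_div_exp_0 filterlim_inverse_at_top_right])
  then have "(flat n \<longlongrightarrow> 0) (at_right 0)"
    by (rule Lim_transform_eventually)
      (auto simp: eventually_at_filter flat_def exp_minus divide_inverse)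
  moreover have "(flat n \<longlongrightarrow> 0) (at_left 0)"
    by (rule tendsto_eventually) (auto simp: eventually_at_filter flat_def)
  ultimately show ?thesis
    by (simp add: filterlim_split_at)
qed

lemma flat_has_field_derivative:
  "(flat n has_field_derivative (flat (n + 2) t - real n * flat (n + 1) t)) (at t)"
proof -
  consider "t > 0" | "t < 0" | "t = 0" by linarith
  then show ?thesis
  proof cases
    case 1
    have "((\<lambda>t. inverse t ^ n * exp (- inverse t)) has_field_derivative
        real n * (- (inverse t * 1 * inverse t) * inverse t ^ (n - Suc 0)) * exp (- inverse t) +
        exp (- inverse t) * - (- (inverse t * 1 * inverse t)) * inverse t ^ n) (at t)"
      using 1 by (intro DERIV_mult DERIV_power DERIV_inverse' DERIV_chain2[OF DERIV_exp]
          DERIV_minus DERIV_ident) auto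
    then have "((\<lambda>t. inverse t ^ n * exp (- inverse t)) has_field_derivative
        flat (n + 2) t - real n * flat (n + 1) t) (at t)"
      by (rule DERIV_cong) (use 1 in \<open>cases n; simp_all add: flat_def algebra_simps\<close>)
    then show ?thesis
      by (rule has_field_derivative_transform_within_open[of _ _ _ "{0<..}"])
        (use 1 in \<open>auto simp: flat_def\<close>)
  next
    case 2
    have "((\<lambda>t. 0) has_field_derivative flat (n + 2) t - real n * flat (n + 1) t) (at t)"
      using 2 by (simp add: flat_def)
    then show ?thesis
      by (rule has_field_derivative_transform_within_open[of _ _ _ "{..<0}"])
        (use 2 in \<open>auto simp: flat_def\<close>)
  next
    case 3
    \<comment> \<open>At 0 the difference quotient of \<open>flat n\<close> is
      \<open>flat (Suc n)\<close>, so this is the limit already known, one order higher.\<close>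
    have "((\<lambda>h. (flat n (0 + h) - flat n 0) / h) \<longlongrightarrow> 0) (at 0)"
      by (rule Lim_transform_eventually[OF flat_tendsto_0[of "Suc n"]])
        (auto simp: eventually_at_filter flat_def divide_inverse mult_ac)
    then show ?thesis
      using 3 by (simp add: DERIV_def flat_def)
  qed
qed

lemma smooth_on_flat: "smooth_on UNIV (flat n)"
proof -
  have "C_k_on k UNIV (flat n)" for k
  proof (induction k arbitrary: n)
    case 0
    have "isCont (flat n) t" for t
      using flat_has_field_derivative by (rule DERIV_isCont)
    then show ?case by (simp add: continuous_at_imp_continuous_on)
  next
    case (Suc k)
    show ?case
    proof (rule C_k_on_SucI[OF open_UNIV])
      show "(flat n has_derivative (\<lambda>v. (flat (n + 2) t - real n * flat (n + 1) t) * v)) (at t)" for t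
        using flat_has_field_derivative[of n t] by (simp add: has_field_derivative_def)
      have "C_k_on k UNIV (\<lambda>t. (flat (n + 2) t + (- real n) * flat (n + 1) t) * v)" for v
        by (intro C_k_on_bilinear[OF _ bounded_bilinear_mult] C_k_on_add C_k_on_const Suc open_UNIV)
      then show "C_k_on k UNIV (\<lambda>t. (flat (n + 2) t - real n * flat (n + 1) t) * v)" for v
        by simp
    qed
  qed
  then show ?thesis by (simp add: smooth_on_def)
qed

lemma smooth_step:
  obtains s :: "real \<Rightarrow> real"
  where "smooth_on UNIV s" "\<And>t. t \<le> 0 \<Longrightarrow> s t = 0" "\<And>t. t \<ge> 1 \<Longrightarrow> s t = 1"
proof
  \<comment> \<open>The step is f(t) / (f(t) + f(1 - t)) with f = \<open>flat 0\<close>; the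
    denominator never vanishes because t and 1 - t are not both nonpositive. Writing 1 - t with a
    sum and a product fits the closure rules \<open>smooth_on_add\<close> and
    \<open>smooth_on_mult\<close>.\<close>
  let ?d = "\<lambda>t. flat 0 t + flat 0 (1 + (- 1) * t)"
  have pos: "?d t \<noteq> 0" for t
  proof -
    have "flat 0 t \<ge> 0" "flat 0 (1 + (- 1) * t) \<ge> 0" "flat 0 t > 0 \<or> flat 0 (1 + (- 1) * t) > 0"
      by (auto simp: flat_def)
    then show ?thesis by linarith
  qed
  show "smooth_on UNIV (\<lambda>t. flat 0 t * inverse (?d t))"
    by (intro smooth_on_mult smooth_on_inverse smooth_on_add pos smooth_on_const
        smooth_on_id smooth_on_compose[OF _ _ _ smooth_on_flat[of 0]]) auto
qed (auto simp: flat_def)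

lemma smooth_bump:
  fixes p :: "'m::euclidean_space"
  assumes "r > 0"
  obtains \<psi> :: "'m \<Rightarrow> real"
  where "smooth_on UNIV \<psi>" "\<And>x. x \<in> ball p (r / 2) \<Longrightarrow> \<psi> x = 1" "\<And>x. x \<notin> ball p r \<Longrightarrow> \<psi> x = 0"
proof -
  obtain s :: "real \<Rightarrow> real"
    where s: "smooth_on UNIV s" "\<And>t. t \<le> 0 \<Longrightarrow> s t = 0" "\<And>t. t \<ge> 1 \<Longrightarrow> s t = 1"
    using smooth_step by blast
  \<comment> \<open>The argument is 2 - 2 |x - p|^2 / r^2: it is at least 1 where |x - p|^2 <= r^2 /
    2, which includes the ball of radius r / 2, and at most 0 from radius r on. The squared norm
    keeps it smooth at p.\<close>
  define \<psi> where "\<psi> = (\<lambda>x. s (2 + (- 2 / r\<^sup>2) * ((x + - p) \<bullet> (x + - p))))"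
  have n: "(x + - p) \<bullet> (x + - p) = (dist p x)\<^sup>2" for x
    by (simp add: dist_norm norm_minus_commute flip: power2_norm_eq_inner)
  show thesis
  proof
    show "smooth_on UNIV \<psi>"
      unfolding \<psi>_def
      by (intro smooth_on_compose[OF _ _ _ s(1)] smooth_on_add smooth_on_mult
          smooth_on_inner smooth_on_const smooth_on_id open_UNIV) auto
  next
    fix x assume "x \<in> ball p (r / 2)"
    then have "(dist p x)\<^sup>2 \<le> (r / 2)\<^sup>2" by (intro power_mono) auto
    then have "(dist p x)\<^sup>2 * 4 \<le> r\<^sup>2" by (simp add: power_divide)
    then have "(dist p x)\<^sup>2 * 2 \<le> r\<^sup>2" using zero_le_power2[of "dist p x"] by linarith
    then show "\<psi> x = 1"
      unfolding \<psi>_def n using assms by (intro s) (simp add: field_simps)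
  next
    fix x assume "x \<notin> ball p r"
    then have "(dist p x)\<^sup>2 \<ge> r\<^sup>2" using assms by (intro power_mono) auto
    then show "\<psi> x = 0"
      unfolding \<psi>_def n using assms by (intro s) (simp add: field_simps)
  qed
qed

section \<open>Hadamard's lemma\<close>

lemma segment_in_ball:
  fixes p :: "'a::real_normed_vector"
  assumes "x \<in> ball p r" "0 \<le> t" "t \<le> 1"
  shows "p + t *\<^sub>R (x - p) \<in> ball p r"
proof -
  have "t * norm (x - p) \<le> norm (x - p)" using assms by (simp add: mult_left_le_one_le)
  then show ?thesis using assms by (simp add: dist_norm norm_minus_commute)
qed

lemma continuous_on_segment_family:
  fixes h :: "'m::euclidean_space \<Rightarrow> real"
  assumes "continuous_on (ball p r) h"
  shows "continuous_on (ball p r \<times> cbox 0 1) (\<lambda>(x, t). t ^ n * h (p + t *\<^sub>R (x - p)))"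
proof -
  have 1: "continuous_on (ball p r \<times> cbox 0 1) (\<lambda>z. p + snd z *\<^sub>R (fst z - p))" by (intro continuous_intros)
  have 2: "(\<lambda>z. p + snd z *\<^sub>R (fst z - p)) ` (ball p r \<times> cbox 0 1) \<subseteq> ball p r" 
    by (clarsimp simp del: mem_ball) (rule segment_in_ball, simp_all)
  have "continuous_on (ball p r \<times> cbox 0 1) (\<lambda>z. h (p + snd z *\<^sub>R (fst z - p)))"
    by (rule continuous_on_compose2[OF assms 1 2])
  then show ?thesis
    unfolding split_beta
    by (intro continuous_on_mult continuous_on_power continuous_on_snd continuous_on_id)
qed

lemma continuous_on_slice:
  "continuous_on (U \<times> V) (\<lambda>(x, t). F x t) \<Longrightarrow> x \<in> U \<Longrightarrow> continuous_on V (F x)"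
  using continuous_on_compose2[of "U \<times> V" "\<lambda>(x, t). F x t" V "Pair x"]
    continuous_on_Pair[OF continuous_on_const continuous_on_id, of V x]
  by (simp add: image_subset_iff)

lemma C_k_on_imp_continuous_on: "C_k_on k S f \<Longrightarrow> continuous_on S f"
proof (induction k)
  case (Suc k)
  show ?case by (rule Suc.IH[OF C_k_on_Suc_imp[OF Suc.prems]])
qed simp

text \<open>Differentiating under the integral sign brings out a factor t from the inner derivative,
  so the statement is generalised to the weights \<open>t ^ n\<close>, and the induction raises n by
  one while lowering k.\<close>

lemma C_k_on_segment_integral:
  fixes h :: "'m::euclidean_space \<Rightarrow> real"
  assumes "C_k_on k (ball p r) h"
  shows "C_k_on k (ball p r) (\<lambda>x. integral (cbox 0 1) (\<lambda>t. t ^ n * h (p + t *\<^sub>R (x - p))))"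
  using assms
proof (induction k arbitrary: n h)
  case 0
  then have "continuous_on (ball p r) h" by simp
  then show ?case
    unfolding C_k_on.simps
    by (rule integral_continuous_on_param[OF continuous_on_segment_family[of p r h n]])
next
  case (Suc k)
  let ?B = "ball p r"
  let ?h' = "\<lambda>b x. frechet_derivative h (at x) b"
  have ch: "continuous_on ?B h" and ch': "\<And>b. continuous_on ?B (?h' b)"
    by (rule C_k_on_imp_continuous_on[OF Suc.prems])
      (rule C_k_on_imp_continuous_on[OF C_k_on_SucD2[OF Suc.prems]])
  \<comment> \<open>\<open>leibniz_rule\<close> wants the derivative in x as a bounded linear map
    depending continuously on (x, t), hence the sum of \<open>blinfun_inner_right\<close>, whose
    coefficients are weighted directional derivatives of h.\<close>
  define F where "F x t = (\<Sum>b\<in>Basis. (t ^ Suc n * ?h' b (p + t *\<^sub>R (x - p))) *\<^sub>R blinfun_inner_right b)"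
    for x t
  have F_apply: "blinfun_apply (F x t) v = (\<Sum>b\<in>Basis. (v \<bullet> b) * (t ^ Suc n * ?h' b (p + t *\<^sub>R (x - p))))"
    for x t v
    by (simp add: F_def blinfun.sum_left blinfun.scaleR_left inner_commute mult_ac)
  have F_cont: "continuous_on (?B \<times> cbox 0 1) (\<lambda>(x, t). F x t)"
    using continuous_on_segment_family[OF ch'[of _], of "Suc n"] unfolding F_def split_beta
    by (intro continuous_on_sum continuous_on_scaleR continuous_on_const)
  have int: "(\<lambda>t. t ^ n * h (p + t *\<^sub>R (x - p))) integrable_on cbox 0 1"
    if "continuous_on ?B h" "x \<in> ?B" for h x n
    by (rule integrable_continuous[OF continuous_on_slice[OF continuous_on_segment_family[OF that(1), of n] that(2)]])
  have der1: "((\<lambda>x. t ^ n * h (p + t *\<^sub>R (x - p))) has_derivative blinfun_apply (F x t)) (at x within ?B)"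
    if "x \<in> ?B" "t \<in> cbox 0 1" for x t
  proof -
    let ?y = "p + t *\<^sub>R (x - p)"
    have h: "(h has_derivative frechet_derivative h (at ?y)) (at ?y)"
      using that by (intro C_k_on_SucD[OF Suc.prems] segment_in_ball) auto
    have "((\<lambda>x. h (p + t *\<^sub>R (x - p))) has_derivative (\<lambda>v. frechet_derivative h (at ?y) (t *\<^sub>R v))) (at x within ?B)"
      by (rule has_derivative_compose[where f = "\<lambda>x. p + t *\<^sub>R (x - p)" and g = h, OF _ h]) (auto intro!: derivative_eq_intros)
    then have "((\<lambda>x. t ^ n * h (p + t *\<^sub>R (x - p))) has_derivative
        (\<lambda>v. t ^ n * frechet_derivative h (at ?y) (t *\<^sub>R v))) (at x within ?B)"
      by (rule has_derivative_mult_right)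
    moreover have "t ^ n * frechet_derivative h (at ?y) (t *\<^sub>R v) = F x t v" for v
      unfolding F_apply using has_derivative_expand[OF h, of "t *\<^sub>R v"]
      by (simp add: sum_distrib_left mult_ac)
    ultimately show ?thesis by simp
  qed
  show ?case
  proof (rule C_k_on_SucI[OF open_ball])
    fix x assume x: "x \<in> ?B"
    have der2: "((\<lambda>x. integral (cbox 0 1) (\<lambda>t. t ^ n * h (p + t *\<^sub>R (x - p)))) has_derivative
       integral (cbox 0 1) (F x)) (at x within ?B)"
      by (rule leibniz_rule[OF der1 int[OF ch] F_cont x convex_ball])
    have eq: "blinfun_apply (integral (cbox 0 1) (F x)) v =
        (\<Sum>b\<in>Basis. (v \<bullet> b) * integral (cbox 0 1) (\<lambda>t. t ^ Suc n * ?h' b (p + t *\<^sub>R (x - p))))" for v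
    proof -
      have "F x integrable_on cbox 0 1"
        by (rule integrable_continuous[OF continuous_on_slice[OF F_cont x]])
      then have "blinfun_apply (integral (cbox 0 1) (F x)) v = integral (cbox 0 1) (\<lambda>t. F x t v)"
        by (rule blinfun_apply_integral)
      also have "\<dots> = (\<Sum>b\<in>Basis. integral (cbox 0 1) (\<lambda>t. (v \<bullet> b) * (t ^ Suc n * ?h' b (p + t *\<^sub>R (x - p)))))"
        unfolding F_apply
        by (intro integral_sum integrable_on_mult_right int[OF ch' x] finite_Basis)
      finally show ?thesis by simp
    qed
    note der2
    moreover have "at x within ?B = at x"
      by (rule at_within_open[OF x open_ball])
    moreover have "blinfun_apply (integral (cbox 0 1) (F x)) =
        (\<lambda>v. \<Sum>b\<in>Basis. (v \<bullet> b) * integral (cbox 0 1) (\<lambda>t. t ^ Suc n * ?h' b (p + t *\<^sub>R (x - p))))"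
      by (rule ext) (rule eq)
    ultimately show "((\<lambda>x. integral (cbox 0 1) (\<lambda>t. t ^ n * h (p + t *\<^sub>R (x - p)))) has_derivative
      (\<lambda>v. \<Sum>b\<in>Basis. (v \<bullet> b) * integral (cbox 0 1) (\<lambda>t. t ^ Suc n * ?h' b (p + t *\<^sub>R (x - p))))) (at x)"
      by (simp only:)
  next
    fix v
    show "C_k_on k ?B (\<lambda>x. \<Sum>b\<in>Basis. (v \<bullet> b) * integral (cbox 0 1) (\<lambda>t. t ^ Suc n * ?h' b (p + t *\<^sub>R (x - p))))"
      by (intro C_k_on_sum C_k_on_bilinear[OF _ bounded_bilinear_mult] C_k_on_const open_ball
          Suc.IH[of "?h' _" "Suc n"] C_k_on_SucD2 Suc.prems)
  qed
qed

text \<open>The fundamental theorem of calculus along the segment from p to x: \<open>g b x\<close>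
  is the mean over t of the derivative of f in direction b at p + t (x - p). At x = p the integrand
  is constant, which gives the value of \<open>g b\<close> there.\<close>

lemma smooth_hadamard:
  fixes f :: "'m::euclidean_space \<Rightarrow> real"
  assumes "smooth_on (ball p r) f"
  obtains g where "\<And>b. smooth_on (ball p r) (g b)"
    "\<And>b. g b p = frechet_derivative f (at p) b"
    "\<And>x. x \<in> ball p r \<Longrightarrow> f x = f p + (\<Sum>b\<in>Basis. ((x - p) \<bullet> b) * g b x)"
proof
  let ?f' = "\<lambda>b x. frechet_derivative f (at x) b"
  define g where "g b x = integral (cbox 0 1) (\<lambda>t. t ^ 0 * ?f' b (p + t *\<^sub>R (x - p)))" for b x
  have sm: "smooth_on (ball p r) (?f' b)" for b
    using assms by (rule smooth_on_frechet_derivative)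
  show "smooth_on (ball p r) (g b)" for b
    using C_k_on_segment_integral[of _ p r "?f' b" 0] sm[of b]
    unfolding smooth_on_def g_def by blast
  show "g b p = frechet_derivative f (at p) b" for b
    by (simp add: g_def)
  fix x assume x: "x \<in> ball p r"
  have der: "((\<lambda>t. f (p + t *\<^sub>R (x - p))) has_vector_derivative
      (\<Sum>b\<in>Basis. ((x - p) \<bullet> b) * ?f' b (p + t *\<^sub>R (x - p)))) (at t within {0..1})"
    if t: "t \<in> {0..1}" for t :: real
  proof -
    let ?y = "p + t *\<^sub>R (x - p)"
    have f: "(f has_derivative frechet_derivative f (at ?y)) (at ?y)"
      using t by (intro smooth_on_has_derivative[OF assms] segment_in_ball x) auto
    have "((\<lambda>t. f (p + t *\<^sub>R (x - p))) has_derivative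
        (\<lambda>s. frechet_derivative f (at ?y) (s *\<^sub>R (x - p)))) (at t within {0..1})"
      by (rule has_derivative_compose[where f = "\<lambda>t. p + t *\<^sub>R (x - p)" and g = f, OF _ f]) (auto intro!: derivative_eq_intros)
    moreover have "frechet_derivative f (at ?y) (s *\<^sub>R (x - p)) =
        s *\<^sub>R (\<Sum>b\<in>Basis. ((x - p) \<bullet> b) * ?f' b ?y)" for s
      using has_derivative_expand[OF f, of "s *\<^sub>R (x - p)"] by (simp add: sum_distrib_left mult_ac)
    ultimately show ?thesis by (simp add: has_vector_derivative_def)
  qed
  have c: "continuous_on (cbox 0 1) (\<lambda>t. ?f' b (p + t *\<^sub>R (x - p)))" for b
    by (rule continuous_on_compose2[OF smooth_on_imp_continuous_on[OF sm[of b]]])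
      (intro continuous_intros, use segment_in_ball[OF x] in \<open>auto simp del: mem_ball\<close>)
  have "integral (cbox 0 1) (\<lambda>t. \<Sum>b\<in>Basis. ((x - p) \<bullet> b) * ?f' b (p + t *\<^sub>R (x - p))) = f x - f p"
    using fundamental_theorem_of_calculus[OF _ der] by (auto dest: integral_unique)
  also have "integral (cbox 0 1) (\<lambda>t. \<Sum>b\<in>Basis. ((x - p) \<bullet> b) * ?f' b (p + t *\<^sub>R (x - p))) =
      (\<Sum>b\<in>Basis. integral (cbox 0 1) (\<lambda>t. ((x - p) \<bullet> b) * ?f' b (p + t *\<^sub>R (x - p))))"
    by (intro integral_sum integrable_on_mult_right integrable_continuous c finite_Basis)
  finally show "f x = f p + (\<Sum>b\<in>Basis. ((x - p) \<bullet> b) * g b x)"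
    by (simp add: g_def)
qed

section \<open>Charts, smooth functions and point derivations\<close>

definition chart :: "'p::topological_space set \<Rightarrow> ('p \<Rightarrow> 'm::euclidean_space) \<Rightarrow> bool" where
  "chart U x \<longleftrightarrow> open U \<and> open (x ` U) \<and> homeomorphism U (x ` U) x (inv_into U x)"

lemma chart_inj_on: "chart U x \<Longrightarrow> inj_on x U"
  unfolding chart_def homeomorphism_def by (metis inj_onI)

lemma chart_inv [simp]: "chart U x \<Longrightarrow> p \<in> U \<Longrightarrow> inv_into U x (x p) = p"
  using chart_inj_on inv_into_f_f by metis

lemma chartD:
  assumes "chart U x"
  shows "open U" "open (x ` U)" "continuous_on U x" "continuous_on (x ` U) (inv_into U x)"
  using assms unfolding chart_def homeomorphism_def by blast+

lemma chart_open_image: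
  assumes "chart U x" "open N" "N \<subseteq> U"
  shows "open (x ` N)"
proof -
  have "x ` N = x ` U \<inter> inv_into U x -` N"
  proof (intro set_eqI iffI)
    fix a assume "a \<in> x ` U \<inter> inv_into U x -` N"
    then obtain p where "p \<in> U" "a = x p" "inv_into U x a \<in> N" by auto
    then show "a \<in> x ` N" using assms(1) by auto
  qed (use assms in auto)
  then show ?thesis
    using continuous_open_preimage[OF chartD(4,2)[OF assms(1)] assms(2)] by simp
qed

lemma chart_open_preimage:
  assumes "chart U x" "open B" "open W" "W \<subseteq> U"
  shows "open (W \<inter> x -` B)"
proof (rule continuous_open_preimage)
  show "continuous_on W x"
    by (rule continuous_on_subset[OF chartD(3)[OF assms(1)] assms(4)])
qed (use assms in auto)

lemma chart_prod:
  assumes "chart U x" "chart V y"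
  shows "chart (U \<times> V) (map_prod x y)"
    and "\<And>p q. p \<in> U \<Longrightarrow> q \<in> V \<Longrightarrow> inv_into (U \<times> V) (map_prod x y) (x p, y q) = (p, q)"
proof -
  have inj: "inj_on (map_prod x y) (U \<times> V)"
    by (intro map_prod_inj_on chart_inj_on assms)
  show inv: "inv_into (U \<times> V) (map_prod x y) (x p, y q) = (p, q)" if "p \<in> U" "q \<in> V" for p q
    using inv_into_f_f[OF inj, of "(p, q)"] that by simp
  have im: "map_prod x y ` (U \<times> V) = x ` U \<times> y ` V"
    by (rule map_prod_surj_on) auto
  note cx = chartD[OF assms(1)] and cy = chartD[OF assms(2)]
  have fst_snd: "fst ` (S \<times> T) \<subseteq> S" "snd ` (S \<times> T) \<subseteq> T" for S :: "'e set" and T :: "'f set"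
    by auto
  have c1: "continuous_on (U \<times> V) (map_prod x y)"
    unfolding map_prod_def split_beta
    by (intro continuous_on_Pair continuous_on_compose2[OF cx(3)] continuous_on_compose2[OF cy(3)]
        continuous_on_fst continuous_on_snd continuous_on_id fst_snd)
  have "continuous_on (x ` U \<times> y ` V) (\<lambda>z. (inv_into U x (fst z), inv_into V y (snd z)))"
    by (intro continuous_on_Pair continuous_on_compose2[OF cx(4)] continuous_on_compose2[OF cy(4)]
        continuous_on_fst continuous_on_snd continuous_on_id fst_snd)
  then have c2: "continuous_on (x ` U \<times> y ` V) (inv_into (U \<times> V) (map_prod x y))"
    by (rule continuous_on_eq) (use inv assms in auto)
  have "inv_into (U \<times> V) (map_prod x y) ` (x ` U \<times> y ` V) = U \<times> V"
    unfolding im[symmetric] by (rule inv_into_image_cancel[OF inj subset_refl])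
  then have "homeomorphism (U \<times> V) (x ` U \<times> y ` V) (map_prod x y) (inv_into (U \<times> V) (map_prod x y))"
    using c1 c2 im inv by (intro homeomorphismI) auto
  then show "chart (U \<times> V) (map_prod x y)"
    unfolding chart_def im by (intro conjI open_Times cx cy)
qed

text \<open>Near each point f o F is the composite of two chart expressions. On the source side only
  the single pair (U, x) is assumed to be a chart, so that the lemma applies to
  \<open>prod_atlas A A\<close> without showing that the latter is an atlas.\<close>

lemma smooth_map_pullback:
  assumes "smooth_map B A F" "\<Union>(fst ` A) = UNIV"
    and "\<And>V y. (V, y) \<in> A \<Longrightarrow> chart V y" "(U, x) \<in> B" "chart U x" "f \<in> smooth_functions A"
  shows "smooth_on (x ` U) (\<lambda>a. f (F (inv_into U x a)))"
proof (rule smooth_on_local)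
  fix a assume "a \<in> x ` U"
  then obtain p where p: "p \<in> U" "a = x p" by auto
  obtain V y where V: "(V, y) \<in> A" "F p \<in> V"
  proof -
    have "F p \<in> \<Union>(fst ` A)" using assms(2) by simp
    then show thesis using that by auto
  qed
  let ?N = "U \<inter> F -` V"
  have "open (F -` V)"
    using assms(1) assms(3)[OF V(1)]
    by (auto simp: smooth_map_def chart_def intro: open_vimage)
  then have op: "open (x ` ?N)"
    using assms(5) by (intro chart_open_image[OF assms(5)]) (auto simp: chart_def)
  have s1: "smooth_on (x ` ?N) (\<lambda>a. y (F (inv_into U x a)))"
    using assms(1,4) V(1) unfolding smooth_map_def by (fastforce simp: o_def)
  have s2: "smooth_on (y ` V) (\<lambda>b. f (inv_into V y b))"
    using assms(6) V(1) unfolding smooth_functions_def by (fastforce simp: o_def)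
  have "smooth_on (x ` ?N) (\<lambda>a. f (inv_into V y (y (F (inv_into U x a)))))"
    by (rule smooth_on_compose[OF op s1 _ s2]) (use assms(5) in auto)
  then have "smooth_on (x ` ?N) (\<lambda>a. f (F (inv_into U x a)))"
    by (rule smooth_on_eq[OF _ op]) (use assms(5) assms(3)[OF V(1)] in auto)
  then show "\<exists>T. open T \<and> a \<in> T \<and> smooth_on T (\<lambda>a. f (F (inv_into U x a)))"
    using op p V by (intro exI[of _ "x ` ?N"]) auto
qed

definition point_derivation :: "('p, 'm::euclidean_space) atlas \<Rightarrow> 'p \<Rightarrow> (('p \<Rightarrow> real) \<Rightarrow> real) \<Rightarrow> bool" where
  "point_derivation A p d \<longleftrightarrow>
     (\<forall>f\<in>smooth_functions A. \<forall>h\<in>smooth_functions A.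
        d (f + h) = d f + d h \<and> d (f * h) = f p * d h + h p * d f) \<and>
     (\<forall>f\<in>smooth_functions A. \<forall>a. d ((\<lambda>_. a) * f) = a * d f)"

lemma vector_field_point_derivation:
  "X \<in> vector_fields A \<Longrightarrow> point_derivation A p (\<lambda>f. X f p)"
  unfolding vector_fields_def point_derivation_def by auto

locale smooth_manifold =
  fixes A :: "('p::{t2_space,second_countable_topology}, 'm::euclidean_space) atlas"
  assumes atlas: "smooth_atlas A"
begin

lemma chart: "(U, x) \<in> A \<Longrightarrow> chart U x"
  using atlas unfolding smooth_atlas_def chart_def by fast

lemma chart_at: obtains U x where "(U, x) \<in> A" "p \<in> U"
proof -
  have "(\<Union>(U, x)\<in>A. U) = UNIV" using atlas unfolding smooth_atlas_def by (rule conjunct1)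
  then have "p \<in> (\<Union>(U, x)\<in>A. U)" by simp
  then show thesis using that by auto
qed

lemma charts_cover: "\<Union>(fst ` A) = UNIV"
proof (intro set_eqI iffI UNIV_I)
  fix p
  obtain U x where "(U, x) \<in> A" "p \<in> U" by (rule chart_at)
  then show "p \<in> \<Union>(fst ` A)" by (force intro: UnionI[of U])
qed

lemma smooth_functionsD:
  "f \<in> smooth_functions A \<Longrightarrow> (U, x) \<in> A \<Longrightarrow> smooth_on (x ` U) (\<lambda>a. f (inv_into U x a))"
  unfolding smooth_functions_def by (fastforce simp: o_def)

text \<open>One chart around each point suffices: the transition maps carry smoothness to the other
  charts.\<close>

lemma smooth_functionsI:
  assumes "\<And>p. \<exists>U x N. (U, x) \<in> A \<and> open N \<and> p \<in> N \<and> N \<subseteq> U \<and> smooth_on (x ` N) (\<lambda>a. f (inv_into U x a))"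
  shows "f \<in> smooth_functions A"
proof -
  have "smooth_on (y ` V) (\<lambda>b. f (inv_into V y b))" if V: "(V, y) \<in> A" for V y
  proof (rule smooth_on_local)
    fix b assume "b \<in> y ` V"
    then obtain p where p: "p \<in> V" "b = y p" by auto
    obtain U x N where U: "(U, x) \<in> A" "open N" "p \<in> N" "N \<subseteq> U"
      "smooth_on (x ` N) (\<lambda>a. f (inv_into U x a))"
      using assms[of p] by blast
    note cU = chart[OF U(1)] and cV = chart[OF V]
    let ?T = "y ` (V \<inter> N)"
    have op: "open ?T"
      using cV U(2) by (intro chart_open_image[OF cV]) (auto simp: chart_def)
    have "smooth_on (y ` (V \<inter> U)) (\<lambda>b. x (inv_into V y b))"
      using atlas V U(1) unfolding smooth_atlas_def by (fastforce simp: o_def)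
    then have "smooth_on ?T (\<lambda>b. x (inv_into V y b))"
      by (rule smooth_on_subset) (use U in auto)
    then have "smooth_on ?T (\<lambda>b. f (inv_into U x (x (inv_into V y b))))"
      by (rule smooth_on_compose[OF op _ _ U(5)]) (use cV in auto)
    then have "smooth_on ?T (\<lambda>b. f (inv_into V y b))"
      by (rule smooth_on_eq[OF _ op]) (use cU cV U(4) in auto)
    then show "\<exists>T. open T \<and> b \<in> T \<and> smooth_on T (\<lambda>b. f (inv_into V y b))"
      using op p U(3) by (intro exI[of _ ?T]) auto
  qed
  then show ?thesis
    unfolding smooth_functions_def by (auto simp: o_def)
qed

lemma smooth_functions_const: "(\<lambda>_. c) \<in> smooth_functions A"
  unfolding smooth_functions_def using chart by (auto simp: o_def chart_def intro!: smooth_on_const)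

lemma smooth_functions_add:
  assumes "f \<in> smooth_functions A" "h \<in> smooth_functions A"
  shows "(\<lambda>p. f p + h p) \<in> smooth_functions A"
proof -
  have "smooth_on (x ` U) (\<lambda>a. f (inv_into U x a) + h (inv_into U x a))" if "(U, x) \<in> A" for U x
    using chart[OF that] assms that by (intro smooth_on_add smooth_functionsD) (auto simp: chart_def)
  then show ?thesis unfolding smooth_functions_def by (auto simp: o_def)
qed

lemma smooth_functions_mult:
  assumes "f \<in> smooth_functions A" "h \<in> smooth_functions A"
  shows "(\<lambda>p. f p * h p) \<in> smooth_functions A"
proof -
  have "smooth_on (x ` U) (\<lambda>a. f (inv_into U x a) * h (inv_into U x a))" if "(U, x) \<in> A" for U x
    using chart[OF that] assms that by (intro smooth_on_mult smooth_functionsD) (auto simp: chart_def)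
  then show ?thesis unfolding smooth_functions_def by (auto simp: o_def)
qed

lemma smooth_functions_sum:
  "(\<And>i. i \<in> I \<Longrightarrow> f i \<in> smooth_functions A) \<Longrightarrow> (\<lambda>p. \<Sum>i\<in>I. f i p) \<in> smooth_functions A"
  by (induction I rule: infinite_finite_induct)
    (simp_all add: smooth_functions_const smooth_functions_add)

text \<open>Derivations act on global functions, so locally defined functions (coordinates, Hadamard
  coefficients) are multiplied by a bump function before a derivation is applied; on the smaller
  neighbourhood N they are unchanged.\<close>

lemma extend_smooth:
  assumes "(U, x) \<in> A" "open W" "p \<in> W" "W \<subseteq> U" "smooth_on (x ` W) g"
  obtains F N where "F \<in> smooth_functions A" "open N" "p \<in> N" "N \<subseteq> W"
    "\<And>q. q \<in> N \<Longrightarrow> F q = g (x q)" "\<And>q. q \<notin> W \<Longrightarrow> F q = (0::real)"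
proof -
  note c = chart[OF assms(1)]
  have opW: "open (x ` W)" by (rule chart_open_image[OF c assms(2,4)])
  obtain r where r: "r > 0" "cball (x p) r \<subseteq> x ` W"
    using opW assms(3) by (meson open_contains_cball imageI)
  obtain \<psi> :: "'m \<Rightarrow> real" where \<psi>: "smooth_on UNIV \<psi>"
    "\<And>a. a \<in> ball (x p) (r / 2) \<Longrightarrow> \<psi> a = 1" "\<And>a. a \<notin> ball (x p) r \<Longrightarrow> \<psi> a = 0"
    using smooth_bump[OF r(1)] by metis
  define F where "F q = (if q \<in> W then \<psi> (x q) * g (x q) else 0)" for q
  define N where "N = W \<inter> x -` ball (x p) (r / 2)"
  \<comment> \<open>K contains the support of F. Being compact in a Hausdorff space it is closed, so
    around a point outside W the set V - K is a neighbourhood on which F is identically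
    zero.\<close>
  define K where "K = inv_into U x ` cball (x p) r"
  have "continuous_on (cball (x p) r) (inv_into U x)"
    using r(2) assms(4) by (intro continuous_on_subset[OF chartD(4)[OF c]]) blast
  then have "closed K"
    unfolding K_def by (intro compact_imp_closed compact_continuous_image) auto
  have KW: "K \<subseteq> W"
  proof
    fix q assume "q \<in> K"
    then obtain w where "w \<in> W" "q = inv_into U x (x w)"
      using r(2) by (auto simp: K_def)
    then show "q \<in> W" using c assms(4) by auto
  qed
  have zero: "F q = 0" if "q \<notin> K" for q
  proof (cases "q \<in> W")
    case True
    have "x q \<notin> cball (x p) r"
    proof
      assume "x q \<in> cball (x p) r"
      then have "inv_into U x (x q) \<in> K" by (auto simp: K_def)
      then show False using that True c assms(4) by auto
    qed
    then have "\<psi> (x q) = 0" by (intro \<psi>(3)) auto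
    then show ?thesis by (simp add: F_def)
  qed (simp add: F_def)
  show thesis
  proof
    show "F \<in> smooth_functions A"
    proof (rule smooth_functionsI)
      fix q
      show "\<exists>U x N. (U, x) \<in> A \<and> open N \<and> q \<in> N \<and> N \<subseteq> U \<and> smooth_on (x ` N) (\<lambda>a. F (inv_into U x a))"
      proof (cases "q \<in> W")
        case True
        have "smooth_on (x ` W) (\<lambda>a. \<psi> a * g a)"
          by (intro smooth_on_mult opW assms(5) smooth_on_subset[OF \<psi>(1)] subset_UNIV)
        then have "smooth_on (x ` W) (\<lambda>a. F (inv_into U x a))"
          by (rule smooth_on_eq[OF _ opW]) (use c assms(4) in \<open>auto simp: F_def subset_iff\<close>)
        then show ?thesis using True assms by blast
      next
        case False
        obtain V y where V: "(V, y) \<in> A" "q \<in> V" by (rule chart_at)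
        have op: "open (V - K)"
          using chart[OF V(1)] \<open>closed K\<close> by (auto simp: chart_def)
        have op': "open (y ` (V - K))"
          by (rule chart_open_image[OF chart[OF V(1)] op]) auto
        have "smooth_on (y ` (V - K)) (\<lambda>a. F (inv_into V y a))"
          by (rule smooth_on_eq[OF smooth_on_const[OF op', of 0] op'])
            (use chart[OF V(1)] zero in auto)
        then show ?thesis using op V False KW by blast
      qed
    qed
    show "open N" unfolding N_def by (rule chart_open_preimage[OF c _ assms(2,4)]) auto
    show "F q = g (x q)" if "q \<in> N" for q using that \<psi>(2) by (auto simp: N_def F_def)
  qed (use assms r in \<open>auto simp: N_def F_def\<close>)
qed

lemma coordinate_functions:
  assumes "(U, x) \<in> A" "p \<in> U"
  obtains F N where "\<And>b. b \<in> Basis \<Longrightarrow> F b \<in> smooth_functions A" "open N" "p \<in> N" "N \<subseteq> U"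
    "\<And>q b. q \<in> N \<Longrightarrow> b \<in> Basis \<Longrightarrow> F b q = x q \<bullet> b"
proof -
  note c = chart[OF assms(1)]
  have op: "open U" "open (x ` U)" using c by (auto simp: chart_def)
  have "\<forall>b\<in>Basis. \<exists>F N. F \<in> smooth_functions A \<and> open N \<and> p \<in> N \<and> N \<subseteq> U \<and> (\<forall>q\<in>N. F q = x q \<bullet> b)"
  proof
    fix b :: 'm
    have "smooth_on (x ` U) (\<lambda>a. a \<bullet> b)"
      using op by (intro smooth_on_inner smooth_on_id smooth_on_const)
    from extend_smooth[OF assms(1) op(1) assms(2) subset_refl this]
    show "\<exists>F N. F \<in> smooth_functions A \<and> open N \<and> p \<in> N \<and> N \<subseteq> U \<and> (\<forall>q\<in>N. F q = x q \<bullet> b)"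
      by metis
  qed
  then obtain F N where FN: "\<And>b. b \<in> Basis \<Longrightarrow> F b \<in> smooth_functions A \<and> open (N b) \<and> p \<in> N b \<and>
      N b \<subseteq> U \<and> (\<forall>q\<in>N b. F b q = x q \<bullet> b)"
    by metis
  show thesis
  proof (rule that[of F "\<Inter>b\<in>Basis. N b"])
    show "open (\<Inter>b\<in>Basis. N b)" using FN by (intro open_INT) auto
    show "(\<Inter>b\<in>Basis. N b) \<subseteq> U" using FN nonempty_Basis by blast
  qed (use FN in auto)
qed

lemma point_derivation_const:
  assumes "point_derivation A p d"
  shows "d (\<lambda>_. c) = 0"
proof -
  let ?u = "\<lambda>_::'p. 1 :: real"
  have "d (?u * ?u) = 1 * d ?u + 1 * d ?u"
    using assms smooth_functions_const unfolding point_derivation_def by blast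
  moreover have "?u * ?u = ?u" by (simp add: fun_eq_iff)
  ultimately have "d ?u = 0" by simp
  moreover have "d ((\<lambda>_. c) * ?u) = c * d ?u"
    using assms smooth_functions_const unfolding point_derivation_def by blast
  moreover have "(\<lambda>_. c) * ?u = (\<lambda>_. c)" by (simp add: fun_eq_iff)
  ultimately show ?thesis by simp
qed

lemma point_derivation_add:
  assumes "point_derivation A p d" "f \<in> smooth_functions A" "h \<in> smooth_functions A"
  shows "d (\<lambda>q. f q + h q) = d f + d h"
  using assms unfolding point_derivation_def plus_fun_def by blast

lemma point_derivation_mult:
  assumes "point_derivation A p d" "f \<in> smooth_functions A" "h \<in> smooth_functions A"
  shows "d (\<lambda>q. f q * h q) = f p * d h + h p * d f"
  using assms unfolding point_derivation_def times_fun_def by blast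

lemma point_derivation_scale:
  assumes "point_derivation A p d" "f \<in> smooth_functions A"
  shows "d (\<lambda>q. a * f q) = a * d f"
  using assms unfolding point_derivation_def times_fun_def by blast

lemma point_derivation_sum:
  assumes "point_derivation A p d" "finite I" "\<And>i. i \<in> I \<Longrightarrow> f i \<in> smooth_functions A"
  shows "d (\<lambda>q. \<Sum>i\<in>I. f i q) = (\<Sum>i\<in>I. d (f i))"
  using assms(2,3)
proof (induction I)
  case empty
  then show ?case by (simp add: point_derivation_const[OF assms(1)])
next
  case (insert i I)
  then show ?case
    using point_derivation_add[OF assms(1), of "f i" "\<lambda>q. \<Sum>i\<in>I. f i q"]
    by (simp add: smooth_functions_sum)
qed

text \<open>With a cut-off \<Psi> equal to 1 at p and 0 off W, the product of \<Psi> and k = f - h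
  is identically zero; the product rule then gives 0 = \<Psi>(p) d(k) + k(p) d(\<Psi>) =
  d(k).\<close>

lemma point_derivation_local:
  assumes "point_derivation A p d" "f \<in> smooth_functions A" "h \<in> smooth_functions A"
    and "open W" "p \<in> W" "\<And>q. q \<in> W \<Longrightarrow> f q = h q"
  shows "d f = d h"
proof -
  obtain U x where U: "(U, x) \<in> A" "p \<in> U" by (rule chart_at)
  note c = chart[OF U(1)]
  have opW: "open (U \<inter> W)" using c assms(4) by (auto simp: chart_def)
  have "smooth_on (x ` (U \<inter> W)) (\<lambda>_. 1 :: real)"
    by (intro smooth_on_const chart_open_image[OF c opW]) auto
  then obtain \<Psi> N where \<Psi>': "\<Psi> \<in> smooth_functions A" "open N" "p \<in> N" "N \<subseteq> U \<inter> W"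
    "\<And>q. q \<in> N \<Longrightarrow> \<Psi> q = 1" "\<And>q. q \<notin> U \<inter> W \<Longrightarrow> \<Psi> q = 0"
    by (rule extend_smooth[OF U(1) opW IntI[OF U(2) assms(5)] Int_lower1]) (rule that)
  then have \<Psi>: "\<Psi> \<in> smooth_functions A" "\<Psi> p = 1" "\<And>q. q \<notin> U \<inter> W \<Longrightarrow> \<Psi> q = 0"
    by auto
  define k where "k q = f q + (- 1) * h q" for q
  have "(\<lambda>q. (- 1) * h q) \<in> smooth_functions A"
    by (intro smooth_functions_mult smooth_functions_const assms)
  note dk = point_derivation_add[OF assms(1,2) this] point_derivation_scale[OF assms(1,3), of "- 1"]
  have k: "k \<in> smooth_functions A"
    unfolding k_def by (intro smooth_functions_add smooth_functions_mult smooth_functions_const assms)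
  have "(\<lambda>q. \<Psi> q * k q) = (\<lambda>_. 0)"
    using \<Psi>(3) assms(6) by (auto simp: k_def fun_eq_iff)
  then have "0 = \<Psi> p * d k + k p * d \<Psi>"
    using point_derivation_mult[OF assms(1) \<Psi>(1) k] point_derivation_const[OF assms(1)] by metis
  then have "d k = 0" using assms(5,6) \<Psi>(2) by (simp add: k_def)
  moreover have "d k = d f - d h" using dk by (simp add: k_def[abs_def])
  ultimately show ?thesis by simp
qed

text \<open>By Hadamard's lemma a derivation at \<open>p\<close> only sees the first-order Taylor expansion.\<close>

lemma point_derivation_eq_frechet:
  assumes d: "point_derivation A p d" and U: "(U, x) \<in> A" and N: "open N" "p \<in> N" "N \<subseteq> U"
    and F: "\<And>b. b \<in> Basis \<Longrightarrow> F b \<in> smooth_functions A"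
      "\<And>q b. q \<in> N \<Longrightarrow> b \<in> Basis \<Longrightarrow> F b q = x q \<bullet> b"
    and f: "f \<in> smooth_functions A"
  shows "d f = frechet_derivative (\<lambda>a. f (inv_into U x a)) (at (x p)) (\<Sum>b\<in>Basis. d (F b) *\<^sub>R b)"
proof -
  note c = chart[OF U]
  let ?f = "\<lambda>a. f (inv_into U x a)"
  have opN: "open (x ` N)" by (rule chart_open_image[OF c N(1,3)])
  obtain r where r: "r > 0" "ball (x p) r \<subseteq> x ` N"
    using opN N(2) by (meson open_contains_ball imageI)
  have sm: "smooth_on (x ` U) ?f" by (rule smooth_functionsD[OF f U])
  have "smooth_on (ball (x p) r) ?f"
    by (rule smooth_on_subset[OF sm]) (use r N in auto)
  then obtain g where g: "\<And>b. smooth_on (ball (x p) r) (g b)"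
    "\<And>b. g b (x p) = frechet_derivative ?f (at (x p)) b"
    "\<And>a. a \<in> ball (x p) r \<Longrightarrow> ?f a = ?f (x p) + (\<Sum>b\<in>Basis. ((a - x p) \<bullet> b) * g b a)"
    by (rule smooth_hadamard) (rule that)
  define W where "W = N \<inter> x -` ball (x p) r"
  have W: "open W" "p \<in> W" "W \<subseteq> U"
    using chart_open_preimage[OF c open_ball N(1,3)] N r(1) by (auto simp: W_def)
  \<comment> \<open>The Hadamard coefficients \<open>g b\<close> live only on a ball in the chart;
    the derivation needs global functions \<open>G b\<close> agreeing with them near p.\<close>
  have "\<forall>b. \<exists>G N'. G \<in> smooth_functions A \<and> open N' \<and> p \<in> N' \<and> (\<forall>q\<in>N'. G q = g b (x q))"
  proof
    fix b
    have "smooth_on (x ` W) (g b)" by (rule smooth_on_subset[OF g(1)]) (auto simp: W_def)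
    from extend_smooth[OF U W this]
    show "\<exists>G N'. G \<in> smooth_functions A \<and> open N' \<and> p \<in> N' \<and> (\<forall>q\<in>N'. G q = g b (x q))"
      by metis
  qed
  then obtain G N' where G: "\<And>b. G b \<in> smooth_functions A" "\<And>b. open (N' b)" "\<And>b. p \<in> N' b"
    "\<And>b q. q \<in> N' b \<Longrightarrow> G b q = g b (x q)"
    by metis
  have Gp: "G b p = frechet_derivative ?f (at (x p)) b" for b
    using G(3,4) g(2) by auto
  let ?T = "\<lambda>b q. (F b q + - (x p \<bullet> b)) * G b q"
  have F': "(\<lambda>q. F b q + - (x p \<bullet> b)) \<in> smooth_functions A" if "b \<in> Basis" for b
    by (intro smooth_functions_add smooth_functions_const F(1) that)
  have T: "?T b \<in> smooth_functions A" if "b \<in> Basis" for b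
    by (intro smooth_functions_mult G(1) F' that)
  have "d f = d (\<lambda>q. f p + (\<Sum>b\<in>Basis. ?T b q))"
  proof (rule point_derivation_local[OF d f])
    show "(\<lambda>q. f p + (\<Sum>b\<in>Basis. ?T b q)) \<in> smooth_functions A"
      by (intro smooth_functions_add smooth_functions_const smooth_functions_sum T)
    show "open (W \<inter> (\<Inter>b\<in>Basis. N' b))" using G(2) W(1) by (intro open_Int open_INT) auto
    show "p \<in> W \<inter> (\<Inter>b\<in>Basis. N' b)" using G(3) W(2) by auto
    fix q assume q: "q \<in> W \<inter> (\<Inter>b\<in>Basis. N' b)"
    have "f q = ?f (x q)" "f p = ?f (x p)" using c q W(3) N by auto
    moreover have "x q \<in> ball (x p) r" using q by (auto simp: W_def)
    ultimately have "f q = f p + (\<Sum>b\<in>Basis. ((x q - x p) \<bullet> b) * g b (x q))"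
      using g(3) by metis
    also have "\<dots> = f p + (\<Sum>b\<in>Basis. ?T b q)"
      using q F(2)[of q] G(4) by (auto simp: W_def inner_diff_left intro!: sum.cong)
    finally show "f q = f p + (\<Sum>b\<in>Basis. ?T b q)" .
  qed
  also have "\<dots> = (\<Sum>b\<in>Basis. d (?T b))"
    using point_derivation_add[OF d smooth_functions_const smooth_functions_sum, of Basis ?T "f p"] T
    by (simp add: point_derivation_const[OF d] point_derivation_sum[OF d])
  also have "\<dots> = (\<Sum>b\<in>Basis. d (F b) * frechet_derivative ?f (at (x p)) b)"
  proof (rule sum.cong[OF refl])
    fix b :: 'm assume b: "b \<in> Basis"
    \<comment> \<open>The factor F_b - x(p) \<bullet> b vanishes at p, so only the term with
      \<open>d (F b)\<close> survives, multiplied by \<open>G b p\<close>, the partial derivative of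
      f in the chart.\<close>
    have "d (?T b) = (F b p + - (x p \<bullet> b)) * d (G b) + G b p * d (\<lambda>q. F b q + - (x p \<bullet> b))"
      by (rule point_derivation_mult[OF d F'[OF b] G(1)])
    moreover have "d (\<lambda>q. F b q + - (x p \<bullet> b)) = d (F b)"
      using point_derivation_add[OF d F(1)[OF b] smooth_functions_const[of "- (x p \<bullet> b)"]]
      unfolding point_derivation_const[OF d] by simp
    ultimately show "d (?T b) = d (F b) * frechet_derivative ?f (at (x p)) b"
      using F(2)[OF N(2) b] by (simp add: Gp)
  qed
  also have "\<dots> = frechet_derivative ?f (at (x p)) (\<Sum>b\<in>Basis. d (F b) *\<^sub>R b)"
  proof -
    have der: "(?f has_derivative frechet_derivative ?f (at (x p))) (at (x p))"
      using N by (intro smooth_on_has_derivative[OF sm]) auto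
    show ?thesis
      by (subst has_derivative_expand[OF der]) (simp add: inner_sum_left_Basis)
  qed
  finally show ?thesis .
qed

end

section \<open>Left invariant frames on Lie groups\<close>

text \<open>All that the later calculus uses of the group: a global frame, pointwise a basis, whose
  brackets have constant coefficients and in which smooth fields have smooth coefficients. The
  multiplication no longer occurs.\<close>

locale left_invariant_frame = smooth_manifold A
  for A :: "('p::{t2_space,second_countable_topology}, 'm::euclidean_space) atlas" +
  fixes \<iota> :: "'a::euclidean_space \<Rightarrow> 'p vfield" and br :: "'a \<Rightarrow> 'a \<Rightarrow> 'a"
  assumes frame_vf: "\<iota> v \<in> vector_fields A"
    and frame_add: "\<iota> (u + v) = \<iota> u + \<iota> v"
    and frame_scale: "\<iota> (a *\<^sub>R v) = (\<lambda>_. a) \<cdot> \<iota> v"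
    and frame_bracket: "\<iota> (br u v) = vf_bracket (\<iota> u) (\<iota> v)"
    and frame_spans: "X \<in> vector_fields A \<Longrightarrow> \<exists>v. \<forall>f. X f p = \<iota> v f p"
    and frame_inj: "(\<And>f. \<iota> u f p = \<iota> v f p) \<Longrightarrow> u = v"
    and frame_smooth: "X \<in> vector_fields A \<Longrightarrow> (\<lambda>p. maurer_cartan \<iota> X p \<bullet> c) \<in> smooth_functions A"

lemma has_derivative_snd_slot:
  assumes "(G has_derivative G') (at (a, b))"
  shows "((\<lambda>b. G (a, b)) has_derivative (\<lambda>w. G' (0, w))) (at b)"
  by (rule has_derivative_compose[where g = G and f = "Pair a", OF _ assms])
    (intro has_derivative_Pair has_derivative_const has_derivative_ident)

locale lie_group_manifold =
  fixes A :: "('p::{t2_space,second_countable_topology}, 'm::euclidean_space) atlas"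
    and mul :: "'p \<Rightarrow> 'p \<Rightarrow> 'p" and e :: 'p and iv :: "'p \<Rightarrow> 'p"
  assumes lie_group: "lie_group A mul e iv"
begin

sublocale smooth_manifold A
  using lie_group by unfold_locales (simp add: lie_group_def)

sublocale G: group mul e iv
  using lie_group by (simp add: lie_group_def)

lemma mul_inv_cancel [simp]: "mul p (mul (iv p) q) = q" "mul (iv p) (mul p q) = q"
  by (simp_all flip: G.assoc)

lemma mul_smooth_in_charts:
  assumes "f \<in> smooth_functions A" "(U, x) \<in> A" "(V, y) \<in> A"
  shows "smooth_on (x ` U \<times> y ` V) (\<lambda>z. f (mul (inv_into U x (fst z)) (inv_into V y (snd z))))"
proof -
  note cx = chart[OF assms(2)] and cy = chart[OF assms(3)]
  have im: "map_prod x y ` (U \<times> V) = x ` U \<times> y ` V"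
    by (rule map_prod_surj_on) auto
  have "smooth_map (prod_atlas A A) A (\<lambda>(p, q). mul p q)"
    using lie_group by (simp add: lie_group_def)
  moreover have "(U \<times> V, map_prod x y) \<in> prod_atlas A A"
    using assms unfolding prod_atlas_def by blast
  ultimately have "smooth_on (x ` U \<times> y ` V)
      (\<lambda>a. f ((\<lambda>(p, q). mul p q) (inv_into (U \<times> V) (map_prod x y) a)))"
    using smooth_map_pullback[OF _ charts_cover chart _ chart_prod(1)[OF cx cy] assms(1)]
    unfolding im by blast
  then show ?thesis
    by (rule smooth_on_eq)
      (use chartD(2)[OF cx] chartD(2)[OF cy] chart_prod(2)[OF cx cy] cx cy in
        \<open>auto intro: open_Times\<close>)
qed

text \<open>The function f(q^-1 r) has to be smooth in q and r together, because in
  \<open>frame_coeff\<close> the point p is both a parameter and the place of differentiation. N is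
  shrunk so that inversion maps it into a single chart.\<close>

lemma quotient_smooth_in_charts:
  assumes "f \<in> smooth_functions A" "(U, x) \<in> A" "p \<in> U"
  obtains N where "open N" "p \<in> N" "N \<subseteq> U"
    "smooth_on (x ` N \<times> x ` U) (\<lambda>z. f (mul (iv (inv_into U x (fst z))) (inv_into U x (snd z))))"
proof -
  note cx = chart[OF assms(2)]
  obtain W z where W: "(W, z) \<in> A" "iv p \<in> W" by (rule chart_at)
  note cz = chart[OF W(1)]
  have iv: "smooth_map A A iv" using lie_group by (simp add: lie_group_def)
  let ?N = "U \<inter> iv -` W"
  have "open (iv -` W)"
    using iv chartD(1)[OF cz] by (auto simp: smooth_map_def intro: open_vimage)
  then have opN: "open ?N" using chartD(1)[OF cx] by auto
  then have opN': "open (x ` ?N)" by (intro chart_open_image[OF cx]) auto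
  have op: "open (x ` ?N \<times> x ` U)" by (intro open_Times opN' chartD(2)[OF cx])
  have s: "smooth_on (x ` ?N) (\<lambda>a. z (iv (inv_into U x a)))"
    using iv assms(2) W(1) unfolding smooth_map_def by (fastforce simp: o_def)
  define P where "P c = (z (iv (inv_into U x (fst c))), snd c)" for c :: "'m \<times> 'm"
  have "smooth_on (x ` ?N \<times> x ` U) P"
    unfolding P_def
    by (intro smooth_on_Pair op smooth_on_compose[OF op _ _ s] smooth_on_linear[OF op bounded_linear_fst]
        smooth_on_linear[OF op bounded_linear_snd] smooth_on_id) auto
  moreover have "P ` (x ` ?N \<times> x ` U) \<subseteq> z ` W \<times> x ` U"
    using cx by (auto simp: P_def)
  ultimately have "smooth_on (x ` ?N \<times> x ` U)
      (\<lambda>c. f (mul (inv_into W z (fst (P c))) (inv_into U x (snd (P c)))))"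
    by (rule smooth_on_compose[OF op _ _ mul_smooth_in_charts[OF assms(1) W(1) assms(2)]])
  then have "smooth_on (x ` ?N \<times> x ` U) (\<lambda>c. f (mul (iv (inv_into U x (fst c))) (inv_into U x (snd c))))"
    by (rule smooth_on_eq[OF _ op]) (use cx cz in \<open>auto simp: P_def\<close>)
  then show thesis using that opN assms(3) W(2) by blast
qed

lemma left_translation_smooth:
  assumes "f \<in> smooth_functions A"
  shows "(\<lambda>q. f (mul p q)) \<in> smooth_functions A"
proof -
  obtain U x where U: "(U, x) \<in> A" "p \<in> U" by (rule chart_at)
  have "smooth_on (y ` V) (\<lambda>b. f (mul p (inv_into V y b)))" if V: "(V, y) \<in> A" for V y
  proof -
    note op = chartD(2)[OF chart[OF V]]
    have "smooth_on (y ` V) (\<lambda>b. (x p, b))"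
      by (intro smooth_on_Pair smooth_on_const smooth_on_id op)
    from smooth_on_compose[OF op this _ mul_smooth_in_charts[OF assms U(1) V]]
    show ?thesis using U(2) chart[OF U(1)] by auto
  qed
  then show ?thesis unfolding smooth_functions_def by (auto simp: o_def)
qed

text \<open>Left invariance is demanded for all functions, and fields are zero on those that are not
  smooth; translation must therefore neither create nor destroy smoothness.\<close>

lemma left_translation_smooth_iff:
  "(\<lambda>q. f (mul p q)) \<in> smooth_functions A \<longleftrightarrow> f \<in> smooth_functions A"
  using left_translation_smooth[of f p] left_translation_smooth[of "\<lambda>q. f (mul p q)" "iv p"] by auto

end

section \<open>Left invariant fields and frame coefficients relative to a chart at the
  identity\<close>

locale lie_group_chart = lie_group_manifold A mul e iv
  for A :: "('p::{t2_space,second_countable_topology}, 'm::euclidean_space) atlas" and mul e iv +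
  fixes V y and F :: "'m \<Rightarrow> 'p \<Rightarrow> real" and N
  assumes V: "(V, y) \<in> A" and N: "open N" "e \<in> N" "N \<subseteq> V"
    and F_smooth: "b \<in> Basis \<Longrightarrow> F b \<in> smooth_functions A"
    and F_coord: "q \<in> N \<Longrightarrow> b \<in> Basis \<Longrightarrow> F b q = y q \<bullet> b"
begin

text \<open>The tangent vector at \<open>e\<close> with coordinates w, moved to p by left
  translation and applied to f. The value 0 on nonsmooth functions is the convention of
  \<open>vector_fields\<close>.\<close>

definition left_field :: "'m \<Rightarrow> 'p vfield" where
  "left_field w f p = (if f \<in> smooth_functions A
     then frechet_derivative (\<lambda>a. f (mul p (inv_into V y a))) (at (y e)) w else 0)"

lemma inv_chart_e [simp]: "inv_into V y (y e) = e"
  using chart[OF V] N by auto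

lemma left_field_derivative:
  assumes "f \<in> smooth_functions A"
  shows "((\<lambda>a. f (mul p (inv_into V y a))) has_derivative (\<lambda>w. left_field w f p)) (at (y e))"
proof -
  have "smooth_on (y ` V) (\<lambda>a. f (mul p (inv_into V y a)))"
    by (rule smooth_functionsD[OF left_translation_smooth[OF assms] V])
  then show ?thesis
    using smooth_on_has_derivative[of "y ` V" _ "y e"] N assms by (auto simp: left_field_def)
qed

lemma left_field_eqI:
  assumes "f \<in> smooth_functions A"
    "((\<lambda>a. f (mul p (inv_into V y a))) has_derivative D) (at (y e))"
  shows "left_field w f p = D w"
  using has_derivative_unique[OF left_field_derivative[OF assms(1)] assms(2)] by metis

text \<open>In charts the value at p is the partial derivative in the second slot of the jointly
  smooth map (p, a) |-> f(p y^-1(a)), taken along the slice a = y(e), hence smooth in p.\<close>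

lemma left_field_smooth:
  assumes "f \<in> smooth_functions A"
  shows "left_field w f \<in> smooth_functions A"
proof -
  have "smooth_on (x ` U) (\<lambda>a. left_field w f (inv_into U x a))" if U: "(U, x) \<in> A" for U x
  proof -
    let ?G = "\<lambda>z. f (mul (inv_into U x (fst z)) (inv_into V y (snd z)))"
    note op = chartD(2)[OF chart[OF U]]
    have s: "smooth_on (x ` U \<times> y ` V) ?G" by (rule mul_smooth_in_charts[OF assms U V])
    have "smooth_on (x ` U) (\<lambda>a. (a, y e))"
      by (intro smooth_on_Pair smooth_on_const smooth_on_id op)
    from smooth_on_compose[OF op this _ smooth_on_frechet_derivative[OF s, of "(0, w)"]]
    have "smooth_on (x ` U) (\<lambda>a. frechet_derivative ?G (at (a, y e)) (0, w))"
      using N by auto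
    then show ?thesis
    proof (rule smooth_on_eq[OF _ op])
      fix a assume "a \<in> x ` U"
      then have "(?G has_derivative frechet_derivative ?G (at (a, y e))) (at (a, y e))"
        using N by (intro smooth_on_has_derivative[OF s]) auto
      from has_derivative_snd_slot[OF this]
      show "frechet_derivative ?G (at (a, y e)) (0, w) = left_field w f (inv_into U x a)"
        by (intro left_field_eqI[OF assms, symmetric]) simp
    qed
  qed
  then show ?thesis unfolding smooth_functions_def by (auto simp: o_def)
qed

lemma left_field_vf: "left_field w \<in> vector_fields A"
proof -
  have "left_field w (\<lambda>p. f p + h p) p = left_field w f p + left_field w h p"
    "left_field w (\<lambda>p. f p * h p) p = f p * left_field w h p + h p * left_field w f p"
    "left_field w (\<lambda>p. a * f p) p = a * left_field w f p"
    if fh: "f \<in> smooth_functions A" "h \<in> smooth_functions A" for f h a p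
  proof -
    note df = left_field_derivative[OF fh(1)] and dh = left_field_derivative[OF fh(2)]
    show "left_field w (\<lambda>p. f p + h p) p = left_field w f p + left_field w h p"
      by (rule left_field_eqI[OF smooth_functions_add[OF fh] has_derivative_add[OF df dh]])
    show "left_field w (\<lambda>p. a * f p) p = a * left_field w f p"
      by (rule left_field_eqI[OF smooth_functions_mult[OF smooth_functions_const fh(1)]
            has_derivative_mult_right[OF df]])
    have "left_field w (\<lambda>p. f p * h p) p = f p * left_field w h p + left_field w f p * h p"
      using left_field_eqI[OF smooth_functions_mult[OF fh] has_derivative_mult[OF df dh], of w]
      by simp
    then show "left_field w (\<lambda>p. f p * h p) p = f p * left_field w h p + h p * left_field w f p"
      by simp
  qed
  then show ?thesis
    unfolding vector_fields_def plus_fun_def times_fun_def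
    using left_field_smooth by (auto simp: fun_eq_iff) (simp add: left_field_def)
qed

lemma left_field_left_invariant: "left_field w \<in> left_invariant_fields A mul"
proof -
  have "left_field w (f \<circ> mul q) p = (left_field w f \<circ> mul q) p" for f q p
    using left_translation_smooth_iff[of f q]
    by (simp add: left_field_def o_def G.assoc)
  then show ?thesis
    using left_field_vf by (auto simp: left_invariant_fields_def)
qed

lemma left_field_coordinate:
  assumes b: "b \<in> Basis"
  shows "left_field w (F b) e = w \<bullet> b"
proof (rule left_field_eqI[OF F_smooth[OF b]])
  have op: "open (y ` N)" by (rule chart_open_image[OF chart[OF V] N(1,3)])
  have "((\<lambda>a. a \<bullet> b) has_derivative (\<lambda>w. w \<bullet> b)) (at (y e))"
    by (auto intro!: derivative_eq_intros)
  then show "((\<lambda>a. F b (mul e (inv_into V y a))) has_derivative (\<lambda>w. w \<bullet> b)) (at (y e))"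
  proof (rule has_derivative_transform_within_open[OF _ op])
    fix a assume "a \<in> y ` N"
    then obtain q where "q \<in> N" "a = y q" by auto
    then show "a \<bullet> b = F b (mul e (inv_into V y a))"
      using chart[OF V] N F_coord[OF _ b] by auto
  qed (use N in auto)
qed

definition frame_coeff :: "'p vfield \<Rightarrow> 'p \<Rightarrow> 'm" where
  "frame_coeff X p = (\<Sum>b\<in>Basis. X (\<lambda>q. F b (mul (iv p) q)) p *\<^sub>R b)"

text \<open>The value of X at p, moved to the identity by left translation, is a point derivation at
  \<open>e\<close>; the claim is \<open>point_derivation_eq_frechet\<close> for it and the
  translated function q |-> f(p q).\<close>

lemma vector_field_eq_left_field:
  assumes X: "X \<in> vector_fields A"
  shows "X f p = left_field (frame_coeff X p) f p"
proof (cases "f \<in> smooth_functions A")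
  case False
  then show ?thesis using X by (simp add: vector_fields_def left_field_def)
next
  case True
  let ?d = "\<lambda>g. X (\<lambda>q. g (mul (iv p) q)) p"
  note dX = vector_field_point_derivation[OF X, of p]
  have "point_derivation A e ?d"
    unfolding point_derivation_def plus_fun_def times_fun_def
    using point_derivation_add[OF dX left_translation_smooth left_translation_smooth]
      point_derivation_mult[OF dX left_translation_smooth left_translation_smooth]
      point_derivation_scale[OF dX left_translation_smooth]
    by simp
  from point_derivation_eq_frechet[OF this V N F_smooth F_coord left_translation_smooth[OF True, of p]]
  show ?thesis using True by (simp add: left_field_def frame_coeff_def)
qed

text \<open>Differentiation takes place at p while the function q |-> F_b(p^-1 q) itself varies with
  p. In coordinates F' near p the coefficient becomes the sum of X(F'_c) times the second-slot
  partial derivatives of (p, q) |-> F_b(p^-1 q) on the diagonal, which is smooth.\<close>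

lemma frame_coeff_smooth:
  assumes X: "X \<in> vector_fields A" and b: "b \<in> Basis"
  shows "(\<lambda>p. frame_coeff X p \<bullet> b) \<in> smooth_functions A"
proof (rule smooth_functionsI)
  fix p
  obtain U x where U: "(U, x) \<in> A" "p \<in> U" by (rule chart_at)
  note cx = chart[OF U(1)]
  obtain F' N1 where F': "\<And>b. b \<in> Basis \<Longrightarrow> F' b \<in> smooth_functions A" and N1: "open N1" "p \<in> N1" "N1 \<subseteq> U"
    and F'_coord: "\<And>q b. q \<in> N1 \<Longrightarrow> b \<in> Basis \<Longrightarrow> F' b q = x q \<bullet> b"
    by (rule coordinate_functions[OF U]) (rule that)
  let ?G = "\<lambda>z. F b (mul (iv (inv_into U x (fst z))) (inv_into U x (snd z)))"
  obtain N2 where N2: "open N2" "p \<in> N2" "N2 \<subseteq> U" and s: "smooth_on (x ` N2 \<times> x ` U) ?G"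
    by (rule quotient_smooth_in_charts[OF F_smooth[OF b] U]) (rule that)
  let ?N = "N1 \<inter> N2"
  have op: "open (x ` ?N)" using N1 N2 by (intro chart_open_image[OF cx]) auto
  have Xs: "X (F' c) \<in> smooth_functions A" if "c \<in> Basis" for c
    using X F'[OF that] by (simp add: vector_fields_def)
  have s1: "smooth_on (x ` ?N) (\<lambda>a. X (F' c) (inv_into U x a))" if "c \<in> Basis" for c
    by (rule smooth_on_subset[OF smooth_functionsD[OF Xs[OF that] U(1)]]) (use N1 in auto)
  have diag: "smooth_on (x ` ?N) (\<lambda>a. (a, a))" "(\<lambda>a. (a, a)) ` x ` ?N \<subseteq> x ` N2 \<times> x ` U"
    using op N1 by (auto intro!: smooth_on_Pair smooth_on_id)
  have s2: "smooth_on (x ` ?N) (\<lambda>a. frechet_derivative ?G (at (a, a)) (0, c))" for c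
    by (rule smooth_on_compose[OF op diag smooth_on_frechet_derivative[OF s]])
  have "smooth_on (x ` ?N) (\<lambda>a. \<Sum>c\<in>Basis. X (F' c) (inv_into U x a) * frechet_derivative ?G (at (a, a)) (0, c))"
    by (intro smooth_on_sum smooth_on_mult s1 s2 op)
  then have "smooth_on (x ` ?N) (\<lambda>a. frame_coeff X (inv_into U x a) \<bullet> b)"
  proof (rule smooth_on_eq[OF _ op])
    fix a assume "a \<in> x ` ?N"
    then obtain q where q: "q \<in> ?N" "a = x q" by auto
    then have qU: "q \<in> U" using N1 by auto
    have inv: "inv_into U x a = q" using q(2) qU cx by simp
    have G: "(?G has_derivative frechet_derivative ?G (at (a, a))) (at (a, a))"
      using diag(2) q by (intro smooth_on_has_derivative[OF s]) auto
    have dG: "((\<lambda>b'. F b (mul (iv q) (inv_into U x b'))) has_derivative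
        (\<lambda>w. frechet_derivative ?G (at (a, a)) (0, w))) (at a)"
      using has_derivative_snd_slot[OF G] by (simp add: inv)
    have "frame_coeff X q \<bullet> b = X (\<lambda>r. F b (mul (iv q) r)) q"
      using b by (simp add: frame_coeff_def inner_sum_left_Basis)
    also have "\<dots> = frechet_derivative (\<lambda>b'. F b (mul (iv q) (inv_into U x b'))) (at (x q))
        (\<Sum>c\<in>Basis. X (F' c) q *\<^sub>R c)"
      using q(1) by (intro point_derivation_eq_frechet[OF vector_field_point_derivation[OF X] U(1) N1(1) _ N1(3)
            F' F'_coord left_translation_smooth[OF F_smooth[OF b]]]) auto
    also have "\<dots> = frechet_derivative ?G (at (a, a)) (0, \<Sum>c\<in>Basis. X (F' c) q *\<^sub>R c)"
      using fun_cong[OF frechet_derivative_at[OF dG]] unfolding q(2)[symmetric] by simp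
    also have "\<dots> = (\<Sum>c\<in>Basis. X (F' c) q * frechet_derivative ?G (at (a, a)) (0, c))"
      by (subst has_derivative_expand[OF dG]) (simp add: inner_sum_left_Basis)
    finally show "(\<Sum>c\<in>Basis. X (F' c) (inv_into U x a) * frechet_derivative ?G (at (a, a)) (0, c)) =
        frame_coeff X (inv_into U x a) \<bullet> b"
      by (simp add: inv)
  qed
  then show "\<exists>U x N. (U, x) \<in> A \<and> open N \<and> p \<in> N \<and> N \<subseteq> U \<and>
      smooth_on (x ` N) (\<lambda>a. frame_coeff X (inv_into U x a) \<bullet> b)"
    using U N1 N2 by (intro exI[of _ U] exI[of _ x] exI[of _ ?N]) auto
qed

lemma left_invariant_eq_left_field:
  assumes "X \<in> left_invariant_fields A mul"
  shows "X = left_field (frame_coeff X e)"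
proof (intro ext)
  fix f p
  have X: "X \<in> vector_fields A" "\<And>q f. X (f \<circ> mul q) = X f \<circ> mul q"
    using assms by (auto simp: left_invariant_fields_def)
  have "X f p = X (f \<circ> mul p) e" unfolding X(2) by simp
  also have "\<dots> = left_field (frame_coeff X e) (f \<circ> mul p) e" by (rule vector_field_eq_left_field[OF X(1)])
  also have "\<dots> = left_field (frame_coeff X e) f p"
    using left_field_left_invariant[of "frame_coeff X e"] by (simp add: left_invariant_fields_def)
  finally show "X f p = left_field (frame_coeff X e) f p" .
qed

lemma frame_coeff_left_field: "frame_coeff (left_field w) p = w"
proof -
  have inv: "left_field w (\<lambda>q. f (mul (iv p) q)) p = left_field w f e" for f
    using left_field_left_invariant[of w] fun_cong[of "left_field w (f \<circ> mul (iv p))" "left_field w f \<circ> mul (iv p)" p]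
    by (simp add: left_invariant_fields_def o_def)
  show ?thesis
    by (simp add: frame_coeff_def inv left_field_coordinate euclidean_representation)
qed

end

lemma (in lie_group_manifold) lie_group_chart_exists:
  obtains V y F N where "lie_group_chart A mul e iv V y F N"
proof -
  obtain V y where V: "(V, y) \<in> A" "e \<in> V" by (rule chart_at)
  obtain F N where FN: "\<And>b. b \<in> Basis \<Longrightarrow> F b \<in> smooth_functions A" "open N" "e \<in> N" "N \<subseteq> V"
    "\<And>q b. q \<in> N \<Longrightarrow> b \<in> Basis \<Longrightarrow> F b q = y q \<bullet> b"
    by (rule coordinate_functions[OF V]) (rule that)
  then show thesis
    by (intro that[of V y F N]) (unfold_locales, use V in auto)
qed

text \<open>\<open>left_field\<close> and \<iota> both parametrise the left invariant fields
  bijectively, so they differ by a linear isomorphism J. It gives the equality of dimensions, and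
  its inverse K turns \<open>frame_coeff\<close> into \<open>maurer_cartan\<close>.\<close>

lemma left_invariant_frameI:
  fixes \<iota> :: "'a::euclidean_space \<Rightarrow> 'p::{t2_space,second_countable_topology} vfield"
    and A :: "('p, 'm::euclidean_space) atlas"
  assumes "lie_group A mul e iv" "lie_algebra_iso A mul br \<iota>"
  shows "left_invariant_frame A \<iota> br" "DIM('m) = DIM('a)"
proof -
  interpret lie_group_manifold A mul e iv by unfold_locales (rule assms)
  obtain V y F N where chart: "lie_group_chart A mul e iv V y F N" by (rule lie_group_chart_exists)
  interpret lie_group_chart A mul e iv V y F N by (rule chart)
  have bij: "bij_betw \<iota> UNIV (left_invariant_fields A mul)"
    and add: "\<And>u v. \<iota> (u + v) = \<iota> u + \<iota> v" and scale: "\<And>a v. \<iota> (a *\<^sub>R v) = (\<lambda>_. a) \<cdot> \<iota> v"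
    and brk: "\<And>u v. \<iota> (br u v) = vf_bracket (\<iota> u) (\<iota> v)"
    using assms(2) by (auto simp: lie_algebra_iso_def)
  have inv: "\<iota> v \<in> left_invariant_fields A mul" for v
    using bij by (auto simp: bij_betw_def)
  define J where "J v = frame_coeff (\<iota> v) e" for v
  have \<iota>: "\<iota> v = left_field (J v)" for v
    unfolding J_def by (rule left_invariant_eq_left_field[OF inv])
  have J: "linear J"
    by (rule linearI) (simp_all add: J_def frame_coeff_def add scale vf_mult_def plus_fun_def times_fun_def
        scaleR_add_left sum.distrib scaleR_sum_right)
  have "inj J"
    using bij by (intro injI) (metis \<iota> bij_betw_def injD)
  have surj: "J (inv_into UNIV \<iota> (left_field w)) = w" for w
  proof -
    have "left_field w \<in> range \<iota>"
      using bij left_field_left_invariant by (simp add: bij_betw_def)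
    then have "left_field (J (inv_into UNIV \<iota> (left_field w))) = left_field w"
      by (metis \<iota> f_inv_into_f)
    then show ?thesis by (metis frame_coeff_left_field)
  qed
  then have "surj J" by (rule surjI)
  have "dim (J ` UNIV) = dim (UNIV :: 'a set)"
    by (rule dim_image_eq[OF J]) (use \<open>inj J\<close> in simp)
  then show "DIM('m) = DIM('a)"
    using \<open>surj J\<close> by (simp add: dim_UNIV)
  obtain K where K: "linear K" "\<And>v. K (J v) = v" "\<And>w. J (K w) = w"
    using linear_injective_left_inverse[OF J \<open>inj J\<close>] \<open>surj J\<close>
    by (metis (no_types, lifting) comp_apply id_apply surjD)
  have inj: "u = v" if "\<And>f. \<iota> u f p = \<iota> v f p" for u v p
  proof -
    have "frame_coeff (\<iota> u) p = frame_coeff (\<iota> v) p" using that by (simp add: frame_coeff_def)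
    then show "u = v" unfolding \<iota> frame_coeff_left_field using \<open>inj J\<close> by (simp add: inj_eq)
  qed
  have mc: "X f p = \<iota> (K (frame_coeff X p)) f p" if "X \<in> vector_fields A" for X f p
    unfolding \<iota> K(3) by (rule vector_field_eq_left_field[OF that])
  have mc_eq: "maurer_cartan \<iota> X p = K (frame_coeff X p)" if "X \<in> vector_fields A" for X p
    unfolding maurer_cartan_def
  proof (rule the_equality)
    show "\<forall>f. X f p = \<iota> (K (frame_coeff X p)) f p" using mc[OF that] by blast
    show "v = K (frame_coeff X p)" if "\<forall>f. X f p = \<iota> v f p" for v
      by (rule inj[of _ p]) (use that mc[OF \<open>X \<in> vector_fields A\<close>] in metis)
  qed
  have K_expand: "K w \<bullet> c = (\<Sum>b\<in>Basis. (w \<bullet> b) * (K b \<bullet> c))" for w c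
  proof -
    have "K w = (\<Sum>b\<in>Basis. (w \<bullet> b) *\<^sub>R K b)"
      by (subst euclidean_representation[of w, symmetric])
        (simp only: linear_sum[OF K(1)] linear_scale[OF K(1)])
    then show ?thesis by (simp add: inner_sum_left)
  qed
  show "left_invariant_frame A \<iota> br"
  proof
    show "\<iota> v \<in> vector_fields A" for v
      using inv by (simp add: left_invariant_fields_def)
    show "\<exists>v. \<forall>f. X f p = \<iota> v f p" if "X \<in> vector_fields A" for X p
      using mc[OF that] by blast
    show "(\<lambda>p. maurer_cartan \<iota> X p \<bullet> c) \<in> smooth_functions A" if "X \<in> vector_fields A" for X c
      unfolding mc_eq[OF that] K_expand[of "frame_coeff X _"]
      by (intro smooth_functions_sum smooth_functions_mult smooth_functions_const frame_coeff_smooth that)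
    show "u = v" if "\<And>f. \<iota> u f p = \<iota> v f p" for u v p by (rule inj[OF that])
  qed (rule add scale brk)+
qed

section \<open>Abelian almost 3-contact metric Lie algebras\<close>

lemma even_perm_cyclic:
  assumes "even_perm i j k"
  shows "even_perm j k i" "even_perm k i j"
  using assms by (auto simp: even_perm_def)

lemma even_perm_exists:
  fixes i :: 3
  obtains j k where "even_perm i j k"
  using exhaust_3[of i] by (auto simp: even_perm_def)

lemma even_perm_cases:
  assumes "even_perm i j k"
  shows "l = i \<or> l = j \<or> l = k"
  using exhaust_3[of l] assms by (auto simp: even_perm_def)

lemma sum_even_perm:
  assumes "even_perm i j k"
  shows "(\<Sum>l\<in>UNIV. f l) = f i + f j + (f k :: 'b::ab_group_add)"
  using assms by (auto simp: even_perm_def sum_3 add_ac)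

locale abelian_3contact =
  fixes br :: "'a::euclidean_space \<Rightarrow> 'a \<Rightarrow> 'a"
    and \<phi> :: "3 \<Rightarrow> 'a \<Rightarrow> 'a" and \<xi> :: "3 \<Rightarrow> 'a" and \<eta> :: "3 \<Rightarrow> 'a \<Rightarrow> real"
  assumes lie_alg: "almost_3contact_metric_lie_algebra br \<phi> \<xi> \<eta>"
    and abelian: "abelian_structure br \<phi> \<xi> \<eta>"
begin

abbreviation "hor \<equiv> horizontal \<eta>"
abbreviation "\<rho> \<equiv> horizontal_part \<xi> \<eta>"

lemma bilinear_br: "bilinear br" and br_self [simp]: "br X X = 0"
  using lie_alg by (auto simp: almost_3contact_metric_lie_algebra_def real_lie_bracket_def)

lemmas br_simps = bilinear_ladd[OF bilinear_br] bilinear_radd[OF bilinear_br]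
  bilinear_lmul[OF bilinear_br] bilinear_rmul[OF bilinear_br] bilinear_lneg[OF bilinear_br]
  bilinear_rneg[OF bilinear_br] bilinear_lsub[OF bilinear_br] bilinear_rsub[OF bilinear_br]
  bilinear_lzero[OF bilinear_br] bilinear_rzero[OF bilinear_br]

lemma br_skew: "br X Y = - br Y X"
proof -
  have "br (X + Y) (X + Y) = br X X + br Y X + (br X Y + br Y Y)"
    by (simp only: br_simps(1,2))
  then have "br X Y + br Y X = 0" by (simp add: add.commute)
  then show ?thesis by (simp add: eq_neg_iff_add_eq_0)
qed

lemma linear_\<phi>: "linear (\<phi> i)" and linear_\<eta>: "linear (\<eta> i)"
  and \<phi>_\<phi>: "\<phi> i (\<phi> i X) = - X + \<eta> i X *\<^sub>R \<xi> i" and \<eta>_\<xi> [simp]: "\<eta> i (\<xi> i) = 1"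
  using lie_alg by (auto simp: almost_3contact_metric_lie_algebra_def almost_contact_alg_def)

lemmas \<phi>_simps = linear_add[OF linear_\<phi>] linear_diff[OF linear_\<phi>] linear_neg[OF linear_\<phi>]
  linear_scale[OF linear_\<phi>] linear_0[OF linear_\<phi>]

lemmas \<eta>_simps = linear_add[OF linear_\<eta>] linear_diff[OF linear_\<eta>] linear_neg[OF linear_\<eta>]
  linear_scale[OF linear_\<eta>] linear_0[OF linear_\<eta>]

lemma metric: "\<phi> i X \<bullet> \<phi> i Y = X \<bullet> Y - \<eta> i X * \<eta> i Y"
  using lie_alg by (auto simp: almost_3contact_metric_lie_algebra_def)

lemma \<xi>_nonzero: "\<xi> i \<noteq> 0"
  by (metis \<eta>_\<xi> \<eta>_simps(5) zero_neq_one)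

lemma \<phi>_\<xi> [simp]: "\<phi> i (\<xi> i) = 0"
proof -
  have 0: "\<phi> i (\<phi> i (\<xi> i)) = 0" by (simp add: \<phi>_\<phi>)
  \<comment> \<open>As \<phi>^2 \<xi> = 0, the formula for \<phi>^2 at \<phi> \<xi> makes \<phi>
    \<xi> a multiple c \<xi>; applying \<phi> once more gives c \<phi> \<xi> = 0, so \<phi> \<xi>
    vanishes in either case.\<close>
  then have 1: "\<phi> i (\<xi> i) = \<eta> i (\<phi> i (\<xi> i)) *\<^sub>R \<xi> i"
    using \<phi>_\<phi>[of i "\<phi> i (\<xi> i)"] by (simp add: \<phi>_simps)
  then have "\<eta> i (\<phi> i (\<xi> i)) *\<^sub>R \<phi> i (\<xi> i) = 0"
    using 0 by (metis \<phi>_simps(4))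
  then show ?thesis using 1 by auto
qed

lemma \<eta>_\<phi> [simp]: "\<eta> i (\<phi> i X) = 0"
proof -
  have "\<eta> i (\<phi> i X) *\<^sub>R \<xi> i = \<phi> i (\<phi> i (\<phi> i X)) + \<phi> i X"
    by (subst \<phi>_\<phi>[of i "\<phi> i X"]) simp
  also have "\<dots> = \<phi> i (- X + \<eta> i X *\<^sub>R \<xi> i) + \<phi> i X" by (simp only: \<phi>_\<phi>[of i X])
  also have "\<dots> = 0" by (simp only: \<phi>_simps \<phi>_\<xi>) simp
  finally show ?thesis using \<xi>_nonzero by simp
qed

text \<open>This is \<open>metric\<close> at Y = \<open>\<xi> i\<close>, where the left side is
  zero.\<close>

lemma \<eta>_inner: "\<eta> i X = X \<bullet> \<xi> i"
  using metric[of i X "\<xi> i"] by simp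

lemma \<phi>_skew: "\<phi> i X \<bullet> Y = - (X \<bullet> \<phi> i Y)"
proof -
  have "\<phi> i X \<bullet> (- Y + \<eta> i Y *\<^sub>R \<xi> i) = X \<bullet> \<phi> i Y"
    using metric[of i X "\<phi> i Y"] by (simp add: \<phi>_\<phi>)
  then show ?thesis
    by (simp add: inner_add_right inner_diff_right flip: \<eta>_inner)
qed

lemma quaternionic:
  assumes "even_perm i j k"
  shows "\<phi> i (\<phi> j X) = \<phi> k X + \<eta> j X *\<^sub>R \<xi> i" "\<phi> j (\<phi> i X) = - \<phi> k X + \<eta> i X *\<^sub>R \<xi> j"
    and "\<phi> i (\<xi> j) = \<xi> k" "\<phi> j (\<xi> i) = - \<xi> k"
    and "\<eta> i (\<phi> j X) = \<eta> k X" "\<eta> j (\<phi> i X) = - \<eta> k X"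
proof -
  have *: "\<phi> k X = \<phi> i (\<phi> j X) - \<eta> j X *\<^sub>R \<xi> i" "\<phi> k X = - \<phi> j (\<phi> i X) + \<eta> i X *\<^sub>R \<xi> j"
    "\<xi> k = \<phi> i (\<xi> j)" "\<xi> k = - \<phi> j (\<xi> i)" "\<eta> k X = \<eta> i (\<phi> j X)" "\<eta> k X = - \<eta> j (\<phi> i X)"
    using lie_alg assms unfolding almost_3contact_metric_lie_algebra_def by blast+
  show "\<phi> i (\<phi> j X) = \<phi> k X + \<eta> j X *\<^sub>R \<xi> i" using *(1) by simp
  show "\<phi> j (\<phi> i X) = - \<phi> k X + \<eta> i X *\<^sub>R \<xi> j" using *(2) by simp
  show "\<phi> i (\<xi> j) = \<xi> k" using *(3) by simp
  show "\<phi> j (\<xi> i) = - \<xi> k" using *(4) by simp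
  show "\<eta> i (\<phi> j X) = \<eta> k X" using *(5) by simp
  show "\<eta> j (\<phi> i X) = - \<eta> k X" using *(6) by simp
qed

lemma \<eta>_\<xi>_cross:
  assumes "even_perm i j k"
  shows "\<eta> i (\<xi> j) = 0" "\<eta> j (\<xi> i) = 0"
  using quaternionic(3)[OF even_perm_cyclic(1)[OF assms]] quaternionic(4)[OF even_perm_cyclic(2)[OF assms]]
    \<eta>_\<phi>[of j "\<xi> k"] \<eta>_\<phi>[of i "\<xi> k"]
  by (simp_all add: \<eta>_simps)

lemma \<eta>_\<xi>_orthonormal: "\<eta> i (\<xi> j) = (if i = j then 1 else 0)"
proof -
  obtain k l where "even_perm i k l" by (rule even_perm_exists)
  from even_perm_cases[OF this, of j] \<eta>_\<xi>_cross[OF this] \<eta>_\<xi>_cross[OF even_perm_cyclic(2)[OF this]]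
  show ?thesis by auto
qed

lemma hor_\<eta>: "X \<in> hor \<Longrightarrow> \<eta> i X = 0"
  by (simp add: horizontal_def)

lemma hor_\<phi>:
  assumes "X \<in> hor"
  shows "\<phi> i X \<in> hor"
proof -
  obtain j k where p: "even_perm i j k" by (rule even_perm_exists)
  have "\<eta> l (\<phi> i X) = 0" for l
    using even_perm_cases[OF p, of l] quaternionic(6)[OF p, of X]
      quaternionic(5)[OF even_perm_cyclic(2)[OF p], of X] assms
    by (auto simp: hor_\<eta>)
  then show ?thesis by (simp add: horizontal_def)
qed

lemma hor_subspace: "subspace hor"
  unfolding subspace_def horizontal_def by (simp add: \<eta>_simps)

lemma hor_\<phi>_\<phi>:
  assumes "X \<in> hor"
  shows "\<phi> i (\<phi> i X) = - X" "even_perm i j k \<Longrightarrow> \<phi> i (\<phi> j X) = \<phi> k X"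
    "even_perm i j k \<Longrightarrow> \<phi> j (\<phi> i X) = - \<phi> k X"
  using assms by (simp_all add: \<phi>_\<phi> quaternionic(1,2) hor_\<eta>)

lemma \<rho>_3: "\<rho> X = X - (\<eta> 1 X *\<^sub>R \<xi> 1 + \<eta> 2 X *\<^sub>R \<xi> 2 + \<eta> 3 X *\<^sub>R \<xi> 3)"
  by (simp add: horizontal_part_def sum_3)

lemma \<rho>_hor [simp]: "\<rho> X \<in> hor"
proof -
  have "\<eta> i (\<rho> X) = 0" for i
    using exhaust_3[of i] by (auto simp: \<rho>_3 \<eta>_simps \<eta>_\<xi>_orthonormal)
  then show ?thesis by (simp add: horizontal_def)
qed

lemma \<rho>_decomp: "X = \<rho> X + (\<eta> 1 X *\<^sub>R \<xi> 1 + \<eta> 2 X *\<^sub>R \<xi> 2 + \<eta> 3 X *\<^sub>R \<xi> 3)"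
  by (simp add: \<rho>_3)

lemma \<rho>_id: "X \<in> hor \<Longrightarrow> \<rho> X = X"
  by (simp add: \<rho>_3 hor_\<eta>)

lemma \<rho>_linear: "linear \<rho>"
  by (rule linearI) (simp_all add: \<rho>_3 \<eta>_simps algebra_simps)

lemma inner_hor:
  assumes "X \<in> hor"
  shows "X \<bullet> Y = X \<bullet> \<rho> Y" "Y \<bullet> X = \<rho> Y \<bullet> X"
proof -
  have "X \<bullet> \<xi> i = 0" for i using hor_\<eta>[OF assms] by (simp add: \<eta>_inner)
  then show "X \<bullet> Y = X \<bullet> \<rho> Y" by (simp add: \<rho>_3 inner_diff_right inner_add_right)
  then show "Y \<bullet> X = \<rho> Y \<bullet> X" by (simp only: inner_commute)
qed

lemma \<rho>_zero_iff: "\<rho> W = 0 \<longleftrightarrow> (\<forall>Y\<in>hor. W \<bullet> Y = 0)"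
proof
  assume "\<forall>Y\<in>hor. W \<bullet> Y = 0"
  then have "W \<bullet> \<rho> W = 0" by simp
  then show "\<rho> W = 0" using inner_hor(2)[of "\<rho> W" W] by simp
qed (metis inner_hor(2) inner_zero_left)

lemma hor_eqI:
  assumes "U \<in> hor" "V \<in> hor" "\<And>Y. Y \<in> hor \<Longrightarrow> U \<bullet> Y = V \<bullet> Y"
  shows "U = V"
proof -
  have "U - V \<in> hor" using assms hor_subspace by (simp add: subspace_diff)
  then have "\<rho> (U - V) = U - V" by (rule \<rho>_id)
  moreover have "\<rho> (U - V) = 0" using assms(3) by (simp add: \<rho>_zero_iff inner_diff_left)
  ultimately show ?thesis by simp
qed

lemma vertical_iff: "X \<in> vertical \<xi> \<longleftrightarrow> \<rho> X = 0"
proof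
  assume "X \<in> vertical \<xi>"
  then show "\<rho> X = 0"
    unfolding vertical_def
  proof (induction rule: span_induct)
    case base
    show ?case by (rule linear_subspace_kernel[OF \<rho>_linear, unfolded mem_Collect_eq])
  next
    case (step X)
    then obtain i where "X = \<xi> i" by auto
    then show ?case
      using exhaust_3[of i] by (auto simp: \<rho>_3 \<eta>_\<xi>_orthonormal)
  qed
next
  assume "\<rho> X = 0"
  then have "X = (\<Sum>i\<in>UNIV. \<eta> i X *\<^sub>R \<xi> i)" by (simp add: horizontal_part_def)
  moreover have "(\<Sum>i\<in>UNIV. \<eta> i X *\<^sub>R \<xi> i) \<in> vertical \<xi>"
    unfolding vertical_def by (intro span_sum span_scale span_base) auto
  ultimately show "X \<in> vertical \<xi>" by simp
qed

text \<open>The dimension 4n + 3 with n >= 1 exceeds that of the vertical space. Such a vector makes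
  \<beta> visible in the algebra.\<close>

lemma horizontal_nonzero: obtains X where "X \<in> hor" "X \<noteq> 0"
proof -
  have "hor \<noteq> {0}"
  proof
    assume "hor = {0}"
    then have "UNIV = vertical \<xi>" using vertical_iff \<rho>_hor by blast
    then have "dim (UNIV :: 'a set) = dim (range \<xi>)" by (metis dim_span vertical_def)
    also have "\<dots> \<le> card (range \<xi>)" by (rule dim_le_card') simp
    also have "\<dots> \<le> 3" using card_image_le[of "UNIV :: 3 set" \<xi>] by simp
    finally have "DIM('a) \<le> 3" by (simp add: dim_UNIV)
    moreover have "\<exists>n\<ge>1. DIM('a) = 4 * n + 3"
      using lie_alg by (simp add: almost_3contact_metric_lie_algebra_def)
    ultimately show False by auto
  qed
  then show thesis using that subspace_0[OF hor_subspace] by blast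
qed

section \<open>Consequences of the abelian conditions\<close>

lemma br_\<phi>_\<phi>: "\<eta> i X = 0 \<Longrightarrow> \<eta> i Y = 0 \<Longrightarrow> br (\<phi> i X) (\<phi> i Y) = br X Y"
  and br_\<xi>_\<phi>: "br (\<xi> i) (\<phi> i X) = \<phi> i (br (\<xi> i) X)"
  using abelian by (auto simp: abelian_structure_def abelian_almost_contact_def)

text \<open>The abelian condition for the pair X, \<phi> Y together with \<phi>^2 = -1 on the kernel
  of \<eta>: \<phi> passes across the bracket with a sign.\<close>

lemma br_\<phi>_left:
  assumes "\<eta> i X = 0" "\<eta> i Y = 0"
  shows "br (\<phi> i X) Y = - br X (\<phi> i Y)"
proof -
  have "br (\<phi> i X) (\<phi> i (\<phi> i Y)) = br X (\<phi> i Y)"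
    using assms by (intro br_\<phi>_\<phi>) auto
  then show ?thesis using assms by (simp add: \<phi>_\<phi> br_simps minus_equation_iff)
qed

text \<open>The two terms with a single outer \<phi> cancel by \<open>br_\<phi>_left\<close>, and
  the first two leave \<eta>([X, Y]) \<xi>, which the last term removes; its sign comes from
  d\<eta>(X, Y) = -\<eta>([X, Y]).\<close>

lemma nijenhuis_vanishes:
  assumes "X \<in> hor" "Y \<in> hor"
  shows "br (\<phi> i X) (\<phi> i Y) + \<phi> i (\<phi> i (br X Y)) - \<phi> i (br (\<phi> i X) Y) - \<phi> i (br X (\<phi> i Y))
    - \<eta> i (br X Y) *\<^sub>R \<xi> i = 0"
  using assms by (simp add: hor_\<eta> br_\<phi>_\<phi> br_\<phi>_left \<phi>_\<phi> \<phi>_simps br_simps)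

text \<open>The right side no longer mentions i. With the Nijenhuis terms vanishing, this is the
  equality between the expressions for any two indices that the definition of canonical asks
  for.\<close>

lemma d_fund_form_\<phi>:
  assumes "X \<in> hor" "Y \<in> hor" "Z \<in> hor"
  shows "- (br (\<phi> i X) (\<phi> i Y) \<bullet> \<phi> i (\<phi> i Z)) - br (\<phi> i Y) (\<phi> i Z) \<bullet> \<phi> i (\<phi> i X)
    - br (\<phi> i Z) (\<phi> i X) \<bullet> \<phi> i (\<phi> i Y) = br X Y \<bullet> Z + br Y Z \<bullet> X + br Z X \<bullet> Y"
  using assms by (simp add: hor_\<eta> br_\<phi>_\<phi> \<phi>_\<phi>)

lemma torsion_form_skew:
  "torsion_form br \<xi> \<eta> b d X Y Z = - torsion_form br \<xi> \<eta> b d Y X Z"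
  "torsion_form br \<xi> \<eta> b d X Y Z = - torsion_form br \<xi> \<eta> b d X Z Y"
  unfolding torsion_form_def c_form_def Let_def wedge12_def wedge11_def alg_d_def sum_3
    br_skew[of Y X] br_skew[of Z Y] br_skew[of X Z] br_skew[of "\<rho> Y" "\<rho> X"]
    br_skew[of "\<rho> Z" "\<rho> Y"] br_skew[of "\<rho> X" "\<rho> Z"]
  by (simp_all add: \<eta>_simps algebra_simps)

definition alg_A :: "3 \<Rightarrow> 3 \<Rightarrow> 'a \<Rightarrow> 'a \<Rightarrow> real" where
  "alg_A i j X Y = (br (\<xi> j) (\<phi> i X) - \<phi> i (br (\<xi> j) X)) \<bullet> Y - \<eta> j (br X (\<phi> i Y)) - \<eta> j (br (\<phi> i X) Y)"

lemma alg_A_hor: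
  assumes "X \<in> hor" "Y \<in> hor"
  shows "alg_A i j X Y = (br (\<xi> j) (\<phi> i X) - \<phi> i (br (\<xi> j) X)) \<bullet> Y"
  using assms by (simp add: alg_A_def hor_\<eta> br_\<phi>_left \<eta>_simps)

lemma alg_A_diagonal: "X \<in> hor \<Longrightarrow> Y \<in> hor \<Longrightarrow> alg_A i i X Y = 0"
  by (simp add: alg_A_hor br_\<xi>_\<phi>)

text \<open>ad \<xi>_i commutes with \<phi>_i, which kills \<xi>_i and turns \<xi>_j into \<xi>_k
  and \<xi>_k into -\<xi>_j. So [\<xi>_i, \<xi>_j] lies in the image of \<phi>_i and has no \<xi>_i
  component; exchanging the roles of i and j removes the \<xi>_j component too.\<close>

lemma vertical_bracket_law_exists:
  assumes "lie_subalgebra br (vertical \<xi>)"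
  shows "\<exists>\<delta>. vertical_bracket_law br \<xi> \<delta>"
proof -
  have "\<xi> i \<in> vertical \<xi>" for i
    by (simp add: vertical_def span_base)
  then have vert: "\<rho> (br (\<xi> i) (\<xi> j)) = 0" for i j
    using assms by (simp add: lie_subalgebra_def flip: vertical_iff)
  have e1: "br (\<xi> i) (\<xi> k) = \<phi> i (br (\<xi> i) (\<xi> j))" "br (\<xi> i) (\<xi> j) = - \<phi> i (br (\<xi> i) (\<xi> k))"
    if "even_perm i j k" for i j k
  proof -
    show "br (\<xi> i) (\<xi> k) = \<phi> i (br (\<xi> i) (\<xi> j))"
      using br_\<xi>_\<phi>[of i "\<xi> j"] by (simp only: quaternionic(3)[OF that])
    have "br (\<xi> i) (- \<xi> j) = \<phi> i (br (\<xi> i) (\<xi> k))"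
      using br_\<xi>_\<phi>[of i "\<xi> k"] by (simp only: quaternionic(4)[OF even_perm_cyclic(2)[OF that]])
    then show "br (\<xi> i) (\<xi> j) = - \<phi> i (br (\<xi> i) (\<xi> k))"
      by (metis br_simps(6) minus_minus)
  qed
  have z: "\<eta> i (br (\<xi> i) (\<xi> j)) = 0" "\<eta> i (br (\<xi> i) (\<xi> k)) = 0" if "even_perm i j k" for i j k
  proof -
    show "\<eta> i (br (\<xi> i) (\<xi> j)) = 0" by (subst e1(2)[OF that]) (simp add: \<eta>_simps)
    show "\<eta> i (br (\<xi> i) (\<xi> k)) = 0" by (subst e1(1)[OF that]) simp
  qed
  have law: "br (\<xi> i) (\<xi> j) = \<eta> k (br (\<xi> i) (\<xi> j)) *\<^sub>R \<xi> k" if p: "even_perm i j k" for i j k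
  proof -
    have "\<eta> j (br (\<xi> i) (\<xi> j)) = - \<eta> j (br (\<xi> j) (\<xi> i))"
      by (subst br_skew) (simp add: \<eta>_simps)
    also have "\<dots> = 0" using z(2)[OF even_perm_cyclic(1)[OF p]] by simp
    finally have "\<eta> j (br (\<xi> i) (\<xi> j)) = 0" .
    moreover have "br (\<xi> i) (\<xi> j) = (\<Sum>l\<in>UNIV. \<eta> l (br (\<xi> i) (\<xi> j)) *\<^sub>R \<xi> l)"
      using vert[of i j] by (simp add: horizontal_part_def)
    ultimately show ?thesis using z(1)[OF p] by (simp add: sum_even_perm[OF p])
  qed
  \<comment> \<open>The three coefficients agree: \<phi>_j applied to [\<xi>_j, \<xi>_k] is
    [\<xi>_j, \<xi>_i] on the one hand and, since \<phi>_j \<xi>_i = -\<xi>_k, the coefficient of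
    [\<xi>_j, \<xi>_k] times -\<xi>_k on the other.\<close>
  have step: "\<eta> i (br (\<xi> j) (\<xi> k)) = \<eta> k (br (\<xi> i) (\<xi> j))" if p: "even_perm i j k" for i j k
  proof -
    let ?c = "\<eta> k (br (\<xi> i) (\<xi> j))" and ?d = "\<eta> i (br (\<xi> j) (\<xi> k))"
    have "- br (\<xi> i) (\<xi> j) = \<phi> j (br (\<xi> j) (\<xi> k))"
      using e1(1)[OF even_perm_cyclic(1)[OF p]] br_skew[of "\<xi> j" "\<xi> i"] by simp
    also have "\<dots> = ?d *\<^sub>R \<phi> j (\<xi> i)"
      by (subst law[OF even_perm_cyclic(1)[OF p]]) (simp add: \<phi>_simps)
    also have "\<dots> = - (?d *\<^sub>R \<xi> k)" by (simp add: quaternionic(4)[OF p])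
    finally have "br (\<xi> i) (\<xi> j) = ?d *\<^sub>R \<xi> k" by simp
    then show ?thesis by (simp add: \<eta>_simps)
  qed
  define \<delta> where "\<delta> = \<eta> 3 (br (\<xi> 1) (\<xi> 2)) / 2"
  have p: "even_perm 1 2 3" "even_perm 2 3 1" "even_perm 3 1 2" by (auto simp: even_perm_def)
  have "vertical_bracket_law br \<xi> \<delta>"
    unfolding vertical_bracket_law_def
  proof (intro allI impI)
    fix i j k assume ijk: "even_perm i j k"
    then have "\<eta> k (br (\<xi> i) (\<xi> j)) = 2 * \<delta>"
      using step[OF p(1)] step[OF p(2)] by (auto simp: even_perm_def \<delta>_def)
    then show "br (\<xi> i) (\<xi> j) = (2 * \<delta>) *\<^sub>R \<xi> k"
      using law[OF ijk] by simp
  qed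
  then show ?thesis ..
qed

subsection \<open>The canonical condition on the Lie algebra\<close>

text \<open>The part of the canonical conditions that is not automatic, at a single point of the
  group; \<beta> stands for the value there of the function b, which is not yet known to be
  constant.\<close>

definition alg_canonical :: "real \<Rightarrow> bool" where
  "alg_canonical \<beta> \<longleftrightarrow>
     (\<forall>i X Y. br (\<xi> i) X \<bullet> Y + X \<bullet> br (\<xi> i) Y = 0) \<and>
     (\<forall>i j k. even_perm i j k \<longrightarrow> (\<forall>X\<in>hor. \<forall>Y\<in>hor.
        alg_A i j X Y = \<beta> * (X \<bullet> \<phi> k Y) \<and> - alg_A j i X Y = \<beta> * (X \<bullet> \<phi> k Y)))"

text \<open>The abelian condition for \<phi>_j asks only for \<eta>_j = 0, which \<xi>_k satisfies
  as well, and \<phi>_j \<xi>_k = \<xi>_i. In the same way \<phi>_i \<xi>_k = -\<xi>_j gives the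
  second identity.\<close>

lemma br_\<xi>_shift:
  assumes p: "even_perm i j k" and X: "X \<in> hor"
  shows "br (\<xi> i) (\<phi> j X) = br (\<xi> k) X" "br (\<xi> j) (\<phi> i X) = - br (\<xi> k) X"
proof -
  note q = even_perm_cyclic[OF p]
  have "br (\<phi> j (\<xi> k)) (\<phi> j X) = br (\<xi> k) X"
    by (rule br_\<phi>_\<phi>) (use \<eta>_\<xi>_cross[OF q(1)] hor_\<eta>[OF X] in auto)
  then show "br (\<xi> i) (\<phi> j X) = br (\<xi> k) X" by (simp add: quaternionic(3)[OF q(1)])
  have "br (\<phi> i (\<xi> k)) (\<phi> i X) = br (\<xi> k) X"
    by (rule br_\<phi>_\<phi>) (use \<eta>_\<xi>_cross[OF q(2)] hor_\<eta>[OF X] in auto)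
  then show "br (\<xi> j) (\<phi> i X) = - br (\<xi> k) X"
    by (simp add: quaternionic(4)[OF q(2)] br_simps minus_equation_iff)
qed

lemma alg_canonical_imp_laws:
  assumes "alg_canonical \<beta>"
  shows "lie_subalgebra br (vertical \<xi>)" "horizontal_ad_law br \<phi> \<xi> \<eta> \<beta>"
proof -
  have kill: "br (\<xi> i) X \<bullet> Y = - (X \<bullet> br (\<xi> i) Y)" for i X Y
    using assms by (simp add: alg_canonical_def eq_neg_iff_add_eq_0)
  have self: "\<eta> i (br (\<xi> i) X) = 0" for i X
    by (simp add: \<eta>_inner kill)
  \<comment> \<open>[\<xi>_k, X] equals, up to sign, [\<xi>_i, \<phi>_j X] and
    [\<xi>_j, \<phi>_i X]. A bracket with \<xi>_l has no \<xi>_l component because ad \<xi>_l is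
    skew, so all three vertical components vanish.\<close>
  have hor: "br (\<xi> k) X \<in> hor" if X: "X \<in> hor" for k X
  proof -
    obtain i j where p: "even_perm k i j" by (rule even_perm_exists)
    note q = even_perm_cyclic(1)[OF p]
    have "\<eta> i (br (\<xi> k) X) = 0" "\<eta> j (br (\<xi> k) X) = 0"
      using self[of i "\<phi> j X"] self[of j "\<phi> i X"] br_\<xi>_shift[OF q X] by (simp_all add: \<eta>_simps)
    then have "\<eta> l (br (\<xi> k) X) = 0" for l
      using even_perm_cases[OF p, of l] self[of k X] by auto
    then show ?thesis by (simp add: horizontal_def)
  qed
  \<comment> \<open>Skewness of ad \<xi>_i moves the bracket onto the horizontal argument, which
    stays horizontal and hence orthogonal to \<xi>_j.\<close>
  have vert: "\<rho> (br (\<xi> i) (\<xi> j)) = 0" for i j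
  proof -
    have "br (\<xi> i) (\<xi> j) \<bullet> Y = 0" if "Y \<in> hor" for Y
      using hor_\<eta>[OF hor[OF that]] kill[of i "\<xi> j" Y] by (simp add: \<eta>_inner inner_commute)
    then show ?thesis by (simp add: \<rho>_zero_iff)
  qed
  show "lie_subalgebra br (vertical \<xi>)"
    unfolding lie_subalgebra_def
  proof (intro conjI ballI)
    show "subspace (vertical \<xi>)" by (simp add: vertical_def)
    fix X Y assume XY: "X \<in> vertical \<xi>" "Y \<in> vertical \<xi>"
    have exp: "Z = \<eta> 1 Z *\<^sub>R \<xi> 1 + \<eta> 2 Z *\<^sub>R \<xi> 2 + \<eta> 3 Z *\<^sub>R \<xi> 3" if "Z \<in> vertical \<xi>" for Z
      using \<rho>_decomp[of Z] that by (simp add: vertical_iff)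
    have "\<rho> (br X Y) = 0"
      by (subst exp[OF XY(1)], subst exp[OF XY(2)])
        (simp only: br_simps linear_add[OF \<rho>_linear] linear_scale[OF \<rho>_linear] vert scaleR_zero_right add_0)
    then show "br X Y \<in> vertical \<xi>" by (simp add: vertical_iff)
  qed
  have shift: "br (\<xi> i) (\<phi> j X) = \<phi> j (br (\<xi> i) X) + \<beta> *\<^sub>R \<phi> k X"
    if p: "even_perm i j k" and X: "X \<in> hor" for i j k X
  proof (rule hor_eqI)
    show "br (\<xi> i) (\<phi> j X) \<in> hor" by (intro hor hor_\<phi> X)
    show "\<phi> j (br (\<xi> i) X) + \<beta> *\<^sub>R \<phi> k X \<in> hor"
      using hor_subspace by (intro subspace_add subspace_scale hor hor_\<phi> X)
    fix Y assume Y: "Y \<in> hor"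
    have "- alg_A j i X Y = \<beta> * (X \<bullet> \<phi> k Y)"
      using assms p X Y unfolding alg_canonical_def by blast
    then show "br (\<xi> i) (\<phi> j X) \<bullet> Y = (\<phi> j (br (\<xi> i) X) + \<beta> *\<^sub>R \<phi> k X) \<bullet> Y"
      by (simp add: alg_A_hor[OF X Y] inner_diff_left inner_add_left \<phi>_skew[of k X])
  qed
  \<comment> \<open>Since \<phi>_i \<phi>_j - \<phi>_j \<phi>_i = 2 \<phi>_k on the horizontal
    space, subtracting (\<beta> / 2) \<phi>_i absorbs the inhomogeneous term of
    \<open>shift\<close>, so that C_i commutes with \<phi>_j; this fixes the factor 1/2.\<close>
  define C where "C i X = br (\<xi> i) X - (\<beta> / 2) *\<^sub>R \<phi> i X" for i X
  have C_hor: "C i X \<in> hor" if "X \<in> hor" for i X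
    unfolding C_def using that hor_subspace by (intro subspace_diff subspace_scale hor hor_\<phi>)
  have C_skew: "C i X \<bullet> Y = - (X \<bullet> C i Y)" for i X Y
    by (simp add: C_def inner_diff_left inner_diff_right kill[of i X] \<phi>_skew[of i X])
  have "C k X = 0" if X: "X \<in> hor" for k X
  proof -
    obtain i j where "even_perm k i j" by (rule even_perm_exists)
    then have p: "even_perm i j k" by (rule even_perm_cyclic)
    have C1: "C k X = C i (\<phi> j X)" if "X \<in> hor" for X
      using br_\<xi>_shift(1)[OF p that] hor_\<phi>_\<phi>(2)[OF that p] by (simp add: C_def)
    have C2: "C k X = \<phi> j (C i X)" if "X \<in> hor" for X
    proof -
      have "C k X = \<phi> j (br (\<xi> i) X) + \<beta> *\<^sub>R \<phi> k X - (\<beta> / 2) *\<^sub>R \<phi> k X"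
        using shift[OF p that] br_\<xi>_shift(1)[OF p that] by (simp add: C_def)
      also have "\<dots> = \<phi> j (br (\<xi> i) X) + (\<beta> / 2) *\<^sub>R \<phi> k X"
        by (simp add: algebra_simps flip: scaleR_add_left)
      also have "\<dots> = \<phi> j (C i X)"
        using hor_\<phi>_\<phi>(3)[OF that p] by (simp add: C_def \<phi>_simps)
      finally show ?thesis .
    qed
    let ?Y = "C k X"
    have Y: "?Y \<in> hor" by (rule C_hor[OF X])
    have "?Y \<bullet> ?Y = \<phi> j (C i X) \<bullet> ?Y" using C2[OF X] by simp
    also have "\<dots> = X \<bullet> C i (\<phi> j ?Y)" by (simp add: \<phi>_skew[of j] C_skew[of i X])
    also have "\<dots> = X \<bullet> C k ?Y" using C1[OF Y] by simp
    also have "\<dots> = - (?Y \<bullet> ?Y)" using C_skew[of k X ?Y] by simp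
    finally show ?thesis by simp
  qed
  then show "horizontal_ad_law br \<phi> \<xi> \<eta> \<beta>"
    by (simp add: horizontal_ad_law_def C_def)
qed

end

section \<open>The two laws as hypotheses: the converse direction and the Christoffel
  symbols\<close>

locale canonical_3contact = abelian_3contact +
  fixes \<beta> \<delta> :: real
  assumes vertical_law: "vertical_bracket_law br \<xi> \<delta>"
    and horizontal_law: "horizontal_ad_law br \<phi> \<xi> \<eta> \<beta>"
begin

lemma br_\<xi>_hor: "X \<in> hor \<Longrightarrow> br (\<xi> i) X = (\<beta> / 2) *\<^sub>R \<phi> i X"
  using horizontal_law by (simp add: horizontal_ad_law_def)

lemma br_hor_\<xi>: "X \<in> hor \<Longrightarrow> br X (\<xi> i) = - ((\<beta> / 2) *\<^sub>R \<phi> i X)"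
  by (subst br_skew) (simp add: br_\<xi>_hor)

lemma br_\<xi>_\<xi>:
  assumes "even_perm i j k"
  shows "br (\<xi> i) (\<xi> j) = (2 * \<delta>) *\<^sub>R \<xi> k" "br (\<xi> j) (\<xi> i) = - ((2 * \<delta>) *\<^sub>R \<xi> k)"
proof -
  show "br (\<xi> i) (\<xi> j) = (2 * \<delta>) *\<^sub>R \<xi> k"
    using vertical_law assms by (simp add: vertical_bracket_law_def)
  then show "br (\<xi> j) (\<xi> i) = - ((2 * \<delta>) *\<^sub>R \<xi> k)"
    by (subst br_skew) simp
qed

lemma perms: "even_perm 1 2 3" "even_perm 2 3 1" "even_perm 3 1 2"
  by (auto simp: even_perm_def)

lemmas br_\<xi>_\<xi>_3 = br_\<xi>_\<xi>[OF perms(1)] br_\<xi>_\<xi>[OF perms(2)] br_\<xi>_\<xi>[OF perms(3)]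

lemma br_expand:
  "br X Y = br (\<rho> X) (\<rho> Y)
    + (\<beta> / 2) *\<^sub>R ((\<eta> 1 X *\<^sub>R \<phi> 1 (\<rho> Y) + \<eta> 2 X *\<^sub>R \<phi> 2 (\<rho> Y) + \<eta> 3 X *\<^sub>R \<phi> 3 (\<rho> Y))
      - (\<eta> 1 Y *\<^sub>R \<phi> 1 (\<rho> X) + \<eta> 2 Y *\<^sub>R \<phi> 2 (\<rho> X) + \<eta> 3 Y *\<^sub>R \<phi> 3 (\<rho> X)))
    + (2 * \<delta>) *\<^sub>R ((\<eta> 2 X * \<eta> 3 Y - \<eta> 3 X * \<eta> 2 Y) *\<^sub>R \<xi> 1
      + (\<eta> 3 X * \<eta> 1 Y - \<eta> 1 X * \<eta> 3 Y) *\<^sub>R \<xi> 2 + (\<eta> 1 X * \<eta> 2 Y - \<eta> 2 X * \<eta> 1 Y) *\<^sub>R \<xi> 3)"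
proof -
  let ?v = "\<lambda>X. \<eta> 1 X *\<^sub>R \<xi> 1 + \<eta> 2 X *\<^sub>R \<xi> 2 + \<eta> 3 X *\<^sub>R \<xi> 3"
  have "br X Y = br (\<rho> X + ?v X) (\<rho> Y + ?v Y)"
    by (simp flip: \<rho>_decomp)
  also have "\<dots> = br (\<rho> X) (\<rho> Y) + br (?v X) (\<rho> Y) + br (\<rho> X) (?v Y) + br (?v X) (?v Y)"
  proof -
    have "br (a + b) (c + d) = br a c + br b c + br a d + br b d" for a b c d
      by (simp add: br_simps(1,2) add_ac)
    then show ?thesis .
  qed
  also have "br (?v X) (\<rho> Y) = (\<beta> / 2) *\<^sub>R (\<eta> 1 X *\<^sub>R \<phi> 1 (\<rho> Y) + \<eta> 2 X *\<^sub>R \<phi> 2 (\<rho> Y) + \<eta> 3 X *\<^sub>R \<phi> 3 (\<rho> Y))"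
    by (simp add: br_simps br_\<xi>_hor algebra_simps)
  also have "br (\<rho> X) (?v Y) = - ((\<beta> / 2) *\<^sub>R (\<eta> 1 Y *\<^sub>R \<phi> 1 (\<rho> X) + \<eta> 2 Y *\<^sub>R \<phi> 2 (\<rho> X) + \<eta> 3 Y *\<^sub>R \<phi> 3 (\<rho> X)))"
    by (simp add: br_simps br_hor_\<xi> algebra_simps)
  also have "br (?v X) (?v Y) = (2 * \<delta>) *\<^sub>R ((\<eta> 2 X * \<eta> 3 Y - \<eta> 3 X * \<eta> 2 Y) *\<^sub>R \<xi> 1
      + (\<eta> 3 X * \<eta> 1 Y - \<eta> 1 X * \<eta> 3 Y) *\<^sub>R \<xi> 2 + (\<eta> 1 X * \<eta> 2 Y - \<eta> 2 X * \<eta> 1 Y) *\<^sub>R \<xi> 3)"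
    by (simp add: br_simps br_\<xi>_\<xi>_3 algebra_simps)
  finally show ?thesis by (simp add: scaleR_diff_right)
qed

lemma \<phi>_\<rho>_inner: "\<phi> i (\<rho> X) \<bullet> Y = \<phi> i (\<rho> X) \<bullet> \<rho> Y"
  by (rule inner_hor(1)[OF hor_\<phi>[OF \<rho>_hor]])

lemma \<xi>_inner: "\<xi> i \<bullet> X = \<eta> i X"
  by (simp add: \<eta>_inner inner_commute)

lemma br_expand_inner:
  "br X Y \<bullet> Z = br (\<rho> X) (\<rho> Y) \<bullet> Z
    + (\<beta> / 2) * ((\<eta> 1 X * (\<phi> 1 (\<rho> Y) \<bullet> \<rho> Z) + \<eta> 2 X * (\<phi> 2 (\<rho> Y) \<bullet> \<rho> Z) + \<eta> 3 X * (\<phi> 3 (\<rho> Y) \<bullet> \<rho> Z))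
      - (\<eta> 1 Y * (\<phi> 1 (\<rho> X) \<bullet> \<rho> Z) + \<eta> 2 Y * (\<phi> 2 (\<rho> X) \<bullet> \<rho> Z) + \<eta> 3 Y * (\<phi> 3 (\<rho> X) \<bullet> \<rho> Z)))
    + (2 * \<delta>) * ((\<eta> 2 X * \<eta> 3 Y - \<eta> 3 X * \<eta> 2 Y) * \<eta> 1 Z
      + (\<eta> 3 X * \<eta> 1 Y - \<eta> 1 X * \<eta> 3 Y) * \<eta> 2 Z + (\<eta> 1 X * \<eta> 2 Y - \<eta> 2 X * \<eta> 1 Y) * \<eta> 3 Z)"
  by (subst br_expand)
    (simp only: inner_add_left inner_diff_left inner_scaleR_left \<phi>_\<rho>_inner[of _ _ Z] \<xi>_inner)

text \<open>On the horizontal space ad \<xi>_j \<phi>_i - \<phi>_i ad \<xi>_j = (\<beta> /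
  2)(\<phi>_j \<phi>_i - \<phi>_i \<phi>_j) = -\<beta> \<phi>_k. For the Killing condition both
  parts of ad \<xi>_i are skew: a multiple of \<phi>_i horizontally and of a cross product
  vertically.\<close>

lemma alg_canonical: "alg_canonical \<beta>"
  unfolding alg_canonical_def
proof (intro conjI allI impI ballI)
  fix i X Y
  obtain j k where p: "even_perm i j k" by (rule even_perm_exists)
  note q = even_perm_cyclic[OF p]
  have e: "br (\<xi> i) X \<bullet> Y = (\<beta> / 2) * (\<phi> i (\<rho> X) \<bullet> \<rho> Y) + 2 * \<delta> * (\<eta> j X * \<eta> k Y - \<eta> k X * \<eta> j Y)" for X Y
  proof -
    have "X = \<rho> X + (\<Sum>l\<in>UNIV. \<eta> l X *\<^sub>R \<xi> l)" by (simp add: horizontal_part_def)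
    then have "X = \<rho> X + (\<eta> i X *\<^sub>R \<xi> i + \<eta> j X *\<^sub>R \<xi> j + \<eta> k X *\<^sub>R \<xi> k)"
      by (simp only: sum_even_perm[OF p])
    then have "br (\<xi> i) X = br (\<xi> i) (\<rho> X + (\<eta> i X *\<^sub>R \<xi> i + \<eta> j X *\<^sub>R \<xi> j + \<eta> k X *\<^sub>R \<xi> k))" by simp
    also have "\<dots> = (\<beta> / 2) *\<^sub>R \<phi> i (\<rho> X) + (2 * \<delta>) *\<^sub>R (\<eta> j X *\<^sub>R \<xi> k - \<eta> k X *\<^sub>R \<xi> j)"
      by (simp add: br_simps br_\<xi>_hor br_\<xi>_\<xi>(1)[OF p] br_\<xi>_\<xi>(2)[OF q(2)] algebra_simps)
    finally show ?thesis
      by (simp only: inner_add_left inner_diff_left inner_scaleR_left \<phi>_\<rho>_inner[of _ _ Y] \<xi>_inner)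
  qed
  show "br (\<xi> i) X \<bullet> Y + X \<bullet> br (\<xi> i) Y = 0"
    using \<phi>_skew[of i "\<rho> X" "\<rho> Y"] by (simp add: inner_commute[of X] e) (simp add: inner_commute algebra_simps)
next
  fix i j k X Y assume p: "even_perm i j k" and X: "X \<in> hor" and Y: "Y \<in> hor"
  show "alg_A i j X Y = \<beta> * (X \<bullet> \<phi> k Y)" "- alg_A j i X Y = \<beta> * (X \<bullet> \<phi> k Y)"
    using \<phi>_skew[of k X Y]
    by (simp_all add: alg_A_hor[OF X Y] br_\<xi>_hor X hor_\<phi> \<phi>_simps hor_\<phi>_\<phi>(2,3)[OF X p] inner_diff_left inner_add_left)
qed

definition vol :: "'a \<Rightarrow> 'a \<Rightarrow> 'a \<Rightarrow> real" where
  "vol = wedge12 (\<eta> 1) (wedge11 (\<eta> 2) (\<eta> 3))"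

lemma vol_even_perm:
  assumes "even_perm i j k"
  shows "vol X Y Z = wedge12 (\<eta> i) (wedge11 (\<eta> j) (\<eta> k)) X Y Z"
  using assms by (auto simp: even_perm_def vol_def wedge12_def wedge11_def algebra_simps)

text \<open>The Christoffel symbols of the canonical connection in the left invariant frame.\<close>

definition K :: "'a \<Rightarrow> 'a \<Rightarrow> 'a \<Rightarrow> real" where
  "K X Y Z = - (br (\<rho> Y) (\<rho> Z) \<bullet> X) + (\<beta> / 2) * (\<Sum>i\<in>UNIV. \<eta> i X * (\<phi> i (\<rho> Y) \<bullet> \<rho> Z)) + \<beta> * vol X Y Z"

definition \<Gamma> :: "'a \<Rightarrow> 'a \<Rightarrow> 'a" where
  "\<Gamma> X Y = (\<Sum>b\<in>Basis. K X Y b *\<^sub>R b)"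

lemmas \<rho>_simps = linear_add[OF \<rho>_linear] linear_scale[OF \<rho>_linear]

lemmas K_unfold = K_def vol_def wedge12_def wedge11_def sum_3

lemma K_linear1: "linear (\<lambda>X. K X Y Z)"
  by (rule linearI) (simp_all add: K_unfold \<eta>_simps inner_add_right algebra_simps)

lemma K_linear2: "linear (\<lambda>Y. K X Y Z)"
  by (rule linearI) (simp_all add: K_unfold \<eta>_simps \<phi>_simps \<rho>_simps br_simps inner_add_left algebra_simps)

lemma K_linear3: "linear (K X Y)"
  by (rule linearI) (simp_all add: K_unfold \<eta>_simps \<phi>_simps \<rho>_simps br_simps inner_add_left inner_add_right algebra_simps)

lemma \<Gamma>_inner: "\<Gamma> X Y \<bullet> Z = K X Y Z"
proof -
  have "K X Y Z = K X Y (\<Sum>b\<in>Basis. (Z \<bullet> b) *\<^sub>R b)" by (simp only: euclidean_representation)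
  also have "\<dots> = (\<Sum>b\<in>Basis. (Z \<bullet> b) * K X Y b)"
    by (simp add: linear_sum[OF K_linear3] linear_scale[OF K_linear3])
  finally show ?thesis by (simp add: \<Gamma>_def inner_sum_right inner_commute[of _ Z] mult.commute)
qed

lemma \<Gamma>_bilinear: "bilinear \<Gamma>"
proof -
  have "linear (\<lambda>X. \<Gamma> X Y)" "linear (\<Gamma> X)" for X Y
    using linear_add[OF K_linear1] linear_scale[OF K_linear1] linear_add[OF K_linear2] linear_scale[OF K_linear2]
    by (auto intro!: linearI simp: \<Gamma>_def scaleR_add_left sum.distrib scaleR_sum_right)
  then show ?thesis by (simp add: bilinear_def)
qed

text \<open>Each of the three summands of \<open>K\<close> is skew in its last two
  arguments.\<close>

lemma \<Gamma>_metric: "\<Gamma> X Y \<bullet> Z + Y \<bullet> \<Gamma> X Z = 0"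
proof -
  have "K X Y Z + K X Z Y = 0"
    using \<phi>_skew[of _ "\<rho> Y" "\<rho> Z"] br_skew[of "\<rho> Y" "\<rho> Z"]
    by (simp add: K_unfold inner_commute algebra_simps)
  then show ?thesis by (simp add: \<Gamma>_inner inner_commute[of Y])
qed

lemma \<rho>_\<phi>: "\<rho> (\<phi> i X) = \<phi> i (\<rho> X)"
proof -
  obtain j k where p: "even_perm i j k" by (rule even_perm_exists)
  note q = even_perm_cyclic[OF p]
  have \<rho>_\<xi>: "\<rho> (\<xi> l) = 0" for l
    using vertical_iff[of "\<xi> l"] by (simp add: vertical_def span_base)
  have "X = \<rho> X + (\<Sum>l\<in>UNIV. \<eta> l X *\<^sub>R \<xi> l)" by (simp add: horizontal_part_def)
  then have "X = \<rho> X + (\<eta> i X *\<^sub>R \<xi> i + \<eta> j X *\<^sub>R \<xi> j + \<eta> k X *\<^sub>R \<xi> k)"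
    by (simp only: sum_even_perm[OF p])
  then have "\<phi> i X = \<phi> i (\<rho> X + (\<eta> i X *\<^sub>R \<xi> i + \<eta> j X *\<^sub>R \<xi> j + \<eta> k X *\<^sub>R \<xi> k))" by simp
  also have "\<dots> = \<phi> i (\<rho> X) + (\<eta> j X *\<^sub>R \<xi> k - \<eta> k X *\<^sub>R \<xi> j)"
    by (simp add: \<phi>_simps quaternionic(3)[OF p] quaternionic(4)[OF q(2)])
  also have "\<rho> \<dots> = \<rho> (\<phi> i (\<rho> X)) + (\<eta> j X *\<^sub>R \<rho> (\<xi> k) - \<eta> k X *\<^sub>R \<rho> (\<xi> j))"
    by (simp add: linear_add[OF \<rho>_linear] linear_diff[OF \<rho>_linear] linear_scale[OF \<rho>_linear])
  finally show ?thesis using \<rho>_\<xi> by (simp add: \<rho>_id hor_\<phi>)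
qed

text \<open>The bracket terms of \<open>K\<close> cancel by \<open>br_\<phi>_left\<close>. The
  middle term gives \<beta> / 2 times the commutators of the \<phi>_l with \<phi>_i, hence the
  factor \<beta> on horizontal parts; the volume term gives the same operator on vertical parts.
  This is why the coefficients in \<open>K\<close> are \<beta> / 2 and \<beta>.\<close>

lemma \<Gamma>_\<phi>:
  assumes p: "even_perm i j k"
  shows "\<Gamma> X (\<phi> i Y) - \<phi> i (\<Gamma> X Y) = \<beta> *\<^sub>R (\<eta> k X *\<^sub>R \<phi> j Y - \<eta> j X *\<^sub>R \<phi> k Y)"
proof -
  note q = even_perm_cyclic[OF p]
  have "(\<Gamma> X (\<phi> i Y) - \<phi> i (\<Gamma> X Y)) \<bullet> Z =
      (\<beta> *\<^sub>R (\<eta> k X *\<^sub>R \<phi> j Y - \<eta> j X *\<^sub>R \<phi> k Y)) \<bullet> Z" for Z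
  proof -
    let ?Y = "\<rho> Y" and ?Z = "\<rho> Z"
    have b: "br (\<phi> i ?Y) ?Z = - br ?Y (\<phi> i ?Z)"
      by (rule br_\<phi>_left) (auto simp: hor_\<eta>)
    have s: "(\<Sum>l\<in>UNIV. \<eta> l X * (\<phi> l (\<phi> i ?Y) \<bullet> ?Z)) + (\<Sum>l\<in>UNIV. \<eta> l X * (\<phi> l ?Y \<bullet> \<phi> i ?Z)) =
        2 * (\<eta> k X * (\<phi> j ?Y \<bullet> ?Z) - \<eta> j X * (\<phi> k ?Y \<bullet> ?Z))"
    proof -
      have "\<phi> l ?Y \<bullet> \<phi> i ?Z = - (\<phi> i (\<phi> l ?Y) \<bullet> ?Z)" for l
        by (simp add: \<phi>_skew[of i])
      then show ?thesis
        by (simp add: sum_even_perm[OF p] hor_\<phi>_\<phi>(2,3)[OF \<rho>_hor p] hor_\<phi>_\<phi>(2,3)[OF \<rho>_hor q(2)]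
            algebra_simps)
    qed
    have dec: "W \<bullet> Z = W \<bullet> ?Z + (\<eta> i W * \<eta> i Z + \<eta> j W * \<eta> j Z + \<eta> k W * \<eta> k Z)" for W
    proof -
      have "Z = \<rho> Z + (\<Sum>l\<in>UNIV. \<eta> l Z *\<^sub>R \<xi> l)" by (simp add: horizontal_part_def)
      then have "Z = \<rho> Z + (\<eta> i Z *\<^sub>R \<xi> i + \<eta> j Z *\<^sub>R \<xi> j + \<eta> k Z *\<^sub>R \<xi> k)"
        by (simp only: sum_even_perm[OF p])
      then have "W \<bullet> Z = W \<bullet> (\<rho> Z + (\<eta> i Z *\<^sub>R \<xi> i + \<eta> j Z *\<^sub>R \<xi> j + \<eta> k Z *\<^sub>R \<xi> k))" by simp
      then show ?thesis by (simp add: inner_add_right \<eta>_inner mult.commute)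
    qed
    have h: "\<phi> l Y \<bullet> ?Z = \<phi> l ?Y \<bullet> ?Z" for l
      using inner_hor(2)[OF \<rho>_hor, of "\<phi> l Y" Z] by (simp add: \<rho>_\<phi>)
    have v: "vol X (\<phi> i Y) Z + vol X Y (\<phi> i Z) =
        \<eta> k X * (\<eta> k Y * \<eta> i Z - \<eta> i Y * \<eta> k Z) - \<eta> j X * (\<eta> i Y * \<eta> j Z - \<eta> j Y * \<eta> i Z)"
      using quaternionic(6)[OF p] quaternionic(5)[OF q(2)]
      by (simp add: vol_even_perm[OF p] wedge12_def wedge11_def algebra_simps)
    have j: "\<phi> j Y \<bullet> Z = \<phi> j ?Y \<bullet> ?Z + (\<eta> k Y * \<eta> i Z - \<eta> i Y * \<eta> k Z)"
      using quaternionic(5)[OF p] quaternionic(6)[OF q(1)] by (simp add: dec h)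
    have k: "\<phi> k Y \<bullet> Z = \<phi> k ?Y \<bullet> ?Z + (\<eta> i Y * \<eta> j Z - \<eta> j Y * \<eta> i Z)"
      using quaternionic(5)[OF q(1)] quaternionic(6)[OF q(2)] by (simp add: dec h)
    have "(\<Gamma> X (\<phi> i Y) - \<phi> i (\<Gamma> X Y)) \<bullet> Z = K X (\<phi> i Y) Z + K X Y (\<phi> i Z)"
      by (simp add: inner_diff_left \<phi>_skew[of i "\<Gamma> X Y"] \<Gamma>_inner)
    also have "\<dots> = (\<beta> / 2) * ((\<Sum>l\<in>UNIV. \<eta> l X * (\<phi> l (\<phi> i ?Y) \<bullet> ?Z)) + (\<Sum>l\<in>UNIV. \<eta> l X * (\<phi> l ?Y \<bullet> \<phi> i ?Z)))
        + \<beta> * (vol X (\<phi> i Y) Z + vol X Y (\<phi> i Z))"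
      by (simp add: K_def \<rho>_\<phi> b distrib_left)
    finally show ?thesis
      unfolding s v inner_scaleR_left inner_diff_left j k by (simp add: algebra_simps)
  qed
  then show ?thesis
    using vector_eq_rdot by blast
qed

text \<open>The terms with \<beta> / 2 in \<open>K\<close> and in the bracket cancel.
  Antisymmetrising \<open>K\<close> yields 2\<beta> times the volume form and the bracket takes away
  2\<delta>. In the target each of the three \<eta>_i \<and> d\<eta>_i already contains -2\<delta>
  times the volume form, so the explicit coefficient is 2(\<beta> - \<delta>) + 6\<delta> =
  2(\<beta> + 2\<delta>).\<close>

lemma \<Gamma>_torsion: "(\<Gamma> X Y - \<Gamma> Y X - br X Y) \<bullet> Z = torsion_form br \<xi> \<eta> \<beta> \<delta> X Y Z"
proof -
  let ?P = "\<lambda>X Y. br (\<rho> X) (\<rho> Y)"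
  have skew: "?P X Z = - ?P Z X" for X Z by (rule br_skew)
  have dec: "W \<bullet> \<rho> Z = W \<bullet> Z - (\<eta> 1 W * \<eta> 1 Z + \<eta> 2 W * \<eta> 2 Z + \<eta> 3 W * \<eta> 3 Z)" for W Z
    by (simp add: \<rho>_3 inner_diff_right inner_add_right \<eta>_inner[of _ W] mult.commute)
  have \<eta>br: "\<eta> 1 (br X Y) = \<eta> 1 (?P X Y) + 2 * \<delta> * (\<eta> 2 X * \<eta> 3 Y - \<eta> 3 X * \<eta> 2 Y)"
    "\<eta> 2 (br X Y) = \<eta> 2 (?P X Y) + 2 * \<delta> * (\<eta> 3 X * \<eta> 1 Y - \<eta> 1 X * \<eta> 3 Y)"
    "\<eta> 3 (br X Y) = \<eta> 3 (?P X Y) + 2 * \<delta> * (\<eta> 1 X * \<eta> 2 Y - \<eta> 2 X * \<eta> 1 Y)" for X Y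
    by (subst br_expand; simp add: \<eta>_simps hor_\<eta>[OF hor_\<phi>[OF \<rho>_hor]] \<eta>_\<xi>_orthonormal)+
  have "(\<Gamma> X Y - \<Gamma> Y X - br X Y) \<bullet> Z = K X Y Z - K Y X Z - br X Y \<bullet> Z"
    by (simp add: inner_diff_left \<Gamma>_inner)
  also have "\<dots> = - (?P X Y \<bullet> Z) - (?P Y Z \<bullet> X) - (?P Z X \<bullet> Y) + 2 * (\<beta> - \<delta>) * vol X Y Z"
    using skew[of X Z] by (simp add: br_expand_inner[of X Y Z] K_unfold algebra_simps)
  also have "\<dots> = torsion_form br \<xi> \<eta> \<beta> \<delta> X Y Z"
    by (simp add: torsion_form_def c_form_def Let_def dec wedge12_def wedge11_def vol_def alg_d_def
        sum_3 \<eta>br[of X Y] \<eta>br[of Y Z] \<eta>br[of Z X] algebra_simps)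
  finally show ?thesis .
qed

end

subsection \<open>Uniqueness of the torsion\<close>

text \<open>The difference of two such connections is a 3-form that changes sign when \<open>\<phi> i\<close> is moved
  from one slot to another; three moves return it to its place, so it vanishes.\<close>

lemma (in abelian_3contact) torsion_unique:
  assumes metric: "\<And>X Y Z. B X Y \<bullet> Z + Y \<bullet> B X Z = 0" "\<And>X Y Z. B' X Y \<bullet> Z + Y \<bullet> B' X Z = 0"
    and skew: "\<And>X Y Z. T X Y Z = - T Y X Z" "\<And>X Y Z. T X Y Z = - T X Z Y"
      "\<And>X Y Z. T' X Y Z = - T' Y X Z" "\<And>X Y Z. T' X Y Z = - T' X Z Y"
    and T: "\<And>X Y Z. T X Y Z = (B X Y - B Y X - br X Y) \<bullet> Z"
      "\<And>X Y Z. T' X Y Z = (B' X Y - B' Y X - br X Y) \<bullet> Z"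
    and \<phi>: "\<And>i X Y. B X (\<phi> i Y) - \<phi> i (B X Y) = B' X (\<phi> i Y) - \<phi> i (B' X Y)"
  shows "T X Y Z = T' X Y Z"
proof -
  define H where "H X Y Z = (B X Y - B' X Y) \<bullet> Z" for X Y Z
  have H23: "H X Y Z = - H X Z Y" for X Y Z
    using metric[of X Y Z] by (simp add: H_def inner_diff_left inner_diff_right inner_commute)
  have TH: "T X Y Z - T' X Y Z = H X Y Z - H Y X Z" for X Y Z
    by (simp add: T H_def inner_diff_left)
  \<comment> \<open>The difference of the torsions is totally skew and H is skew in its last two
    slots; as in the uniqueness of the Levi-Civita connection, H is determined by that difference,
    here as half of it, so it is totally skew itself.\<close>
  have H12: "H X Y Z = - H Y X Z" for X Y Z
    using TH[of X Y Z] TH[of X Z Y] TH[of Y Z X] skew(1)[of X Y Z] skew(2)[of X Y Z] skew(3)[of X Y Z]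
      skew(4)[of X Y Z] skew(2)[of Y X Z] skew(4)[of Y X Z] skew(1)[of Y X Z]
      H23[of X Y Z] H23[of Y X Z] H23[of Z X Y] by linarith
  have H\<phi>: "H X (\<phi> i Y) Z = - H X Y (\<phi> i Z)" for i X Y Z
  proof -
    have "B X (\<phi> i Y) - B' X (\<phi> i Y) = \<phi> i (B X Y - B' X Y)"
      using \<phi>[of X i Y] by (simp add: \<phi>_simps algebra_simps)
    then show ?thesis by (simp add: H_def \<phi>_skew)
  qed
  have zero: "H X Y (\<phi> i Z) = 0" for i X Y Z
    using H\<phi>[of X i Y Z] H\<phi>[of Y i Z X] H\<phi>[of Z i X Y] H12[of X "\<phi> i Y" Z] H23[of X "\<phi> i Y" Z]
      H12[of X Y "\<phi> i Z"] H23[of X Y "\<phi> i Z"] H12[of "\<phi> i X" Y Z] H23[of "\<phi> i X" Y Z]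
      H12[of Y Z "\<phi> i X"] H12[of Z "\<phi> i X" Y] H23[of Y Z "\<phi> i X"] H23[of Z "\<phi> i X" Y]
      H12[of Z X "\<phi> i Y"] H12[of Y "\<phi> i Z" X] H23[of Z X "\<phi> i Y"] H23[of Y "\<phi> i Z" X] 
    by linarith
  have "H X Y Z = 0" for X Y Z
  proof -
    obtain j k where p: "even_perm 1 j k" by (rule even_perm_exists)
    \<comment> \<open>The image of \<phi>_1 is only the kernel of \<eta>_1; the missing direction
      lies in the image of \<phi>_j, as \<xi>_1 = \<phi>_j \<xi>_k.\<close>
    have "Z = - \<phi> 1 (\<phi> 1 Z) + \<eta> 1 Z *\<^sub>R \<phi> j (\<xi> k)"
      using quaternionic(3)[OF even_perm_cyclic(1)[OF p]] by (simp add: \<phi>_\<phi>)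
    then have "H X Y Z = H X Y (- \<phi> 1 (\<phi> 1 Z) + \<eta> 1 Z *\<^sub>R \<phi> j (\<xi> k))" by simp
    also have "\<dots> = - H X Y (\<phi> 1 (\<phi> 1 Z)) + \<eta> 1 Z * H X Y (\<phi> j (\<xi> k))"
      by (simp add: H_def inner_add_right inner_diff_right)
    finally show ?thesis by (simp add: zero)
  qed
  then show ?thesis using TH[of X Y Z] by simp
qed

section \<open>Tensor calculus in a left invariant frame\<close>

lemma bilinear_frame_expand:
  fixes B :: "'a::euclidean_space \<Rightarrow> 'a \<Rightarrow> 'b::real_vector"
  assumes "bilinear B"
  shows "B u v = (\<Sum>b\<in>Basis. \<Sum>c\<in>Basis. (u \<bullet> b * (v \<bullet> c)) *\<^sub>R B b c)"
proof -
  have "B u v = B (\<Sum>b\<in>Basis. (u \<bullet> b) *\<^sub>R b) (\<Sum>c\<in>Basis. (v \<bullet> c) *\<^sub>R c)"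
    by (simp only: euclidean_representation)
  also have "\<dots> = (\<Sum>(b, c)\<in>Basis \<times> Basis. B ((u \<bullet> b) *\<^sub>R b) ((v \<bullet> c) *\<^sub>R c))"
    by (rule bilinear_sum[OF assms])
  also have "\<dots> = (\<Sum>b\<in>Basis. \<Sum>c\<in>Basis. (u \<bullet> b * (v \<bullet> c)) *\<^sub>R B b c)"
    by (simp add: sum.cartesian_product bilinear_lmul[OF assms] bilinear_rmul[OF assms] mult.commute)
  finally show ?thesis .
qed

lemma linear_frame_expand:
  fixes L :: "'a::euclidean_space \<Rightarrow> 'b::real_vector"
  assumes "linear L"
  shows "L u = (\<Sum>b\<in>Basis. (u \<bullet> b) *\<^sub>R L b)"
proof -
  have "L u = L (\<Sum>b\<in>Basis. (u \<bullet> b) *\<^sub>R b)" by (simp only: euclidean_representation)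
  then show ?thesis by (simp add: linear_sum[OF assms] linear_scale[OF assms])
qed

context left_invariant_frame
begin

abbreviation "mc \<equiv> maurer_cartan \<iota>"
abbreviation "VF \<equiv> vector_fields A"
abbreviation "SF \<equiv> smooth_functions A"

text \<open>A relation instead of the function \<open>maurer_cartan\<close>: it passes through sums,
  differences and multiples without membership in \<open>vector_fields\<close>, and by
  \<open>repr_mc\<close> it still determines the value of the Maurer-Cartan form.\<close>

definition repr :: "'p vfield \<Rightarrow> 'p \<Rightarrow> 'a \<Rightarrow> bool" where
  "repr X p v \<longleftrightarrow> (\<forall>f. X f p = \<iota> v f p)"

definition smooth_vec :: "('p \<Rightarrow> 'a) \<Rightarrow> bool" where
  "smooth_vec u \<longleftrightarrow> (\<forall>c. (\<lambda>p. u p \<bullet> c) \<in> SF)"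

text \<open>\<open>dd X (mc Y)\<close> is the flat connection for which the left invariant fields
  are parallel; other connections are described by their difference from it.\<close>

definition dd :: "'p vfield \<Rightarrow> ('p \<Rightarrow> 'a) \<Rightarrow> 'p \<Rightarrow> 'a" where
  "dd X u p = (\<Sum>b\<in>Basis. X (\<lambda>q. u q \<bullet> b) p *\<^sub>R b)"

lemma repr_mc: "repr X p v \<Longrightarrow> mc X p = v"
  unfolding maurer_cartan_def repr_def
  by (rule the_equality) (auto intro: frame_inj)

lemma mc_repr: "X \<in> VF \<Longrightarrow> repr X p (mc X p)"
  using frame_spans[of X p] repr_mc[of X p] by (auto simp: repr_def)

lemma frame_linear: "linear (\<lambda>v. \<iota> v f p)"
  by (rule linearI) (simp_all add: frame_add frame_scale vf_mult_def)

lemma repr_frame [simp]: "repr (\<iota> v) p v"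
  by (simp add: repr_def)

lemma mc_frame [simp]: "mc (\<iota> v) p = v"
  by (rule repr_mc) simp

lemma mc_frame_fun: "mc (\<iota> v) = (\<lambda>_. v)"
  by (intro ext) simp

lemma repr_add: "repr X p v \<Longrightarrow> repr Y p w \<Longrightarrow> repr (X + Y) p (v + w)"
  by (simp add: repr_def frame_add)

lemma repr_uminus: "repr X p v \<Longrightarrow> repr (- X) p (- v)"
  using linear_neg[OF frame_linear] by (simp add: repr_def)

lemma repr_diff: "repr X p v \<Longrightarrow> repr Y p w \<Longrightarrow> repr (X - Y) p (v - w)"
  using linear_diff[OF frame_linear] by (simp add: repr_def)

lemma repr_mult: "repr X p v \<Longrightarrow> repr (h \<cdot> X) p (h p *\<^sub>R v)"
  using linear_scale[OF frame_linear] by (simp add: repr_def vf_mult_def)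

lemma repr_sum:
  "finite I \<Longrightarrow> (\<And>i. i \<in> I \<Longrightarrow> repr (X i) p (v i)) \<Longrightarrow> repr (\<Sum>i\<in>I. X i) p (\<Sum>i\<in>I. v i)"
proof (induction I rule: finite_induct)
  case empty
  show ?case using linear_0[OF frame_linear] by (simp add: repr_def)
qed (simp add: repr_add)

lemma vf_eqI: "(\<And>p. repr X p (u p)) \<Longrightarrow> (\<And>p. repr Y p (u p)) \<Longrightarrow> X = Y"
  by (intro ext) (simp add: repr_def)

lemma smooth_vec_mc: "X \<in> VF \<Longrightarrow> smooth_vec (mc X)"
  using frame_smooth by (simp add: smooth_vec_def)

lemma smooth_vec_const: "smooth_vec (\<lambda>_. v)"
  by (simp add: smooth_vec_def smooth_functions_const)

lemma smooth_vec_add: "smooth_vec u \<Longrightarrow> smooth_vec v \<Longrightarrow> smooth_vec (\<lambda>p. u p + v p)"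
  by (simp add: smooth_vec_def inner_add_left smooth_functions_add)

lemma smooth_vec_scale: "h \<in> SF \<Longrightarrow> smooth_vec u \<Longrightarrow> smooth_vec (\<lambda>p. h p *\<^sub>R u p)"
  by (simp add: smooth_vec_def smooth_functions_mult)

lemma smooth_vec_sum: "(\<And>i. i \<in> I \<Longrightarrow> smooth_vec (u i)) \<Longrightarrow> smooth_vec (\<lambda>p. \<Sum>i\<in>I. u i p)"
  by (simp add: smooth_vec_def inner_sum_left smooth_functions_sum)

lemma smooth_vec_linear:
  assumes "linear L" "smooth_vec u"
  shows "smooth_vec (\<lambda>p. L (u p))"
  using assms(2) by (subst linear_frame_expand[OF assms(1)])
    (intro smooth_vec_sum smooth_vec_scale smooth_vec_const, simp add: smooth_vec_def)

lemma smooth_functional: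
  fixes L :: "'a \<Rightarrow> real"
  assumes "linear L" "smooth_vec u"
  shows "(\<lambda>p. L (u p)) \<in> SF"
  using assms(2) by (subst linear_frame_expand[OF assms(1)])
    (simp add: smooth_vec_def smooth_functions_sum smooth_functions_mult smooth_functions_const)

lemma smooth_vec_bilinear:
  assumes "bilinear B" "smooth_vec u" "smooth_vec v"
  shows "smooth_vec (\<lambda>p. B (u p) (v p))"
  using assms(2,3) by (subst bilinear_frame_expand[OF assms(1)])
    (intro smooth_vec_sum smooth_vec_scale smooth_vec_const smooth_functions_mult; simp add: smooth_vec_def)

lemma smooth_inner:
  assumes "smooth_vec u" "smooth_vec v"
  shows "(\<lambda>p. u p \<bullet> v p) \<in> SF"
  using assms by (subst euclidean_inner)
    (simp add: smooth_vec_def smooth_functions_sum smooth_functions_mult)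

lemma frame_expand: "\<iota> v f p = (\<Sum>b\<in>Basis. (v \<bullet> b) * \<iota> b f p)"
  by (subst linear_frame_expand[OF frame_linear]) simp

lemma vf_pd: "X \<in> VF \<Longrightarrow> point_derivation A p (\<lambda>f. X f p)"
  by (rule vector_field_point_derivation)

lemmas vf_rules = point_derivation_add[OF vf_pd] point_derivation_mult[OF vf_pd]
  point_derivation_scale[OF vf_pd] point_derivation_const[OF vf_pd]

lemma vf_sum:
  "X \<in> VF \<Longrightarrow> finite I \<Longrightarrow> (\<And>i. i \<in> I \<Longrightarrow> f i \<in> SF) \<Longrightarrow> X (\<lambda>q. \<Sum>i\<in>I. f i q) p = (\<Sum>i\<in>I. X (f i) p)"
  by (rule point_derivation_sum[OF vf_pd])

lemma vf_smooth: "X \<in> VF \<Longrightarrow> f \<in> SF \<Longrightarrow> X f \<in> SF"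
  by (simp add: vector_fields_def)

lemma vf_not_smooth: "X \<in> VF \<Longrightarrow> f \<notin> SF \<Longrightarrow> X f = 0"
  by (auto simp: vector_fields_def)

text \<open>Smooth coefficients in the frame make a vector field: the product rule and the vanishing
  on nonsmooth functions are inherited, point by point, from the frame fields.\<close>

lemma vfI:
  assumes "smooth_vec u" "\<And>p. repr X p (u p)"
  shows "X \<in> VF"
proof -
  have X: "X f p = \<iota> (u p) f p" for f p using assms(2) by (simp add: repr_def)
  have s: "X f \<in> SF" if "f \<in> SF" for f
  proof -
    have "X f = (\<lambda>p. \<Sum>b\<in>Basis. (u p \<bullet> b) * \<iota> b f p)"
      by (intro ext) (simp add: X frame_expand[of "u _"])
    then show ?thesis
      using assms(1) vf_smooth[OF frame_vf that]
      by (simp add: smooth_vec_def smooth_functions_sum smooth_functions_mult)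
  qed
  show ?thesis
    unfolding vector_fields_def
  proof (intro CollectI conjI allI impI ballI)
    show "X f = 0" if "f \<notin> SF" for f
      using vf_not_smooth[OF frame_vf that] by (simp add: fun_eq_iff X)
    fix f h assume fh: "f \<in> SF" "h \<in> SF"
    show "X (f + h) = X f + X h" "X (f * h) = f * X h + h * X f"
      using vf_rules(1,2)[OF frame_vf fh] by (simp_all add: fun_eq_iff X plus_fun_def times_fun_def)
  next
    fix f a assume f: "f \<in> SF"
    show "X ((\<lambda>_. a) * f) = (\<lambda>_. a) * X f"
      using vf_rules(3)[OF frame_vf f] by (simp add: fun_eq_iff X times_fun_def)
  qed (rule s)
qed

lemma vf_add: "X \<in> VF \<Longrightarrow> Y \<in> VF \<Longrightarrow> X + Y \<in> VF"
  by (rule vfI[OF smooth_vec_add[OF smooth_vec_mc smooth_vec_mc] repr_add[OF mc_repr mc_repr]])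

lemma vf_mult: "h \<in> SF \<Longrightarrow> X \<in> VF \<Longrightarrow> h \<cdot> X \<in> VF"
  by (rule vfI[OF smooth_vec_scale[OF _ smooth_vec_mc] repr_mult[OF mc_repr]])

lemma mc_add: "X \<in> VF \<Longrightarrow> Y \<in> VF \<Longrightarrow> mc (X + Y) p = mc X p + mc Y p"
  by (rule repr_mc[OF repr_add[OF mc_repr mc_repr]])

lemma mc_mult: "X \<in> VF \<Longrightarrow> mc (h \<cdot> X) p = h p *\<^sub>R mc X p"
  by (rule repr_mc[OF repr_mult[OF mc_repr]])

lemma mc_zeroD: "X \<in> VF \<Longrightarrow> mc X p = 0 \<Longrightarrow> X f p = 0"
  using mc_repr[of X p] linear_0[OF frame_linear] by (simp add: repr_def)

lemma smooth_vec_dd: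
  assumes "X \<in> VF" "smooth_vec u"
  shows "smooth_vec (dd X u)"
proof -
  have "X (\<lambda>q. u q \<bullet> b) \<in> SF" for b
    using assms(2) by (intro vf_smooth[OF assms(1)]) (simp add: smooth_vec_def)
  then show ?thesis
    unfolding dd_def[abs_def] by (intro smooth_vec_sum smooth_vec_scale smooth_vec_const)
qed

lemma dd_functional:
  fixes L :: "'a \<Rightarrow> real"
  assumes X: "X \<in> VF" and u: "smooth_vec u" and L: "linear L"
  shows "X (\<lambda>q. L (u q)) p = L (dd X u p)"
proof -
  have s: "(\<lambda>q. u q \<bullet> b) \<in> SF" for b using u by (simp add: smooth_vec_def)
  have "(\<lambda>q. L (u q)) = (\<lambda>q. \<Sum>b\<in>Basis. L b * (u q \<bullet> b))"
    by (subst linear_frame_expand[OF L]) (simp add: mult.commute)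
  then have "X (\<lambda>q. L (u q)) p = (\<Sum>b\<in>Basis. X (\<lambda>q. L b * (u q \<bullet> b)) p)"
    by (simp add: vf_sum[OF X finite_Basis] smooth_functions_mult smooth_functions_const s)
  also have "\<dots> = (\<Sum>b\<in>Basis. X (\<lambda>q. u q \<bullet> b) p * L b)"
    by (simp add: vf_rules(3)[OF X s] mult.commute)
  also have "\<dots> = L (dd X u p)"
    by (simp add: dd_def linear_sum[OF L] linear_scale[OF L])
  finally show ?thesis .
qed

lemma dd_component: "X \<in> VF \<Longrightarrow> smooth_vec u \<Longrightarrow> X (\<lambda>q. u q \<bullet> b) p = dd X u p \<bullet> b"
  using dd_functional[of X u "\<lambda>v. v \<bullet> b"] by (simp add: bounded_linear.linear bounded_linear_inner_left)

lemma dd_eqI: "(\<And>b. b \<in> Basis \<Longrightarrow> X (\<lambda>q. u q \<bullet> b) p = w \<bullet> b) \<Longrightarrow> dd X u p = w"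
  by (simp add: dd_def euclidean_representation)

lemma dd_linear:
  assumes "X \<in> VF" "smooth_vec u" "linear L"
  shows "dd X (\<lambda>q. L (u q)) p = L (dd X u p)"
proof (rule dd_eqI)
  fix b
  have "linear (\<lambda>v. L v \<bullet> b)"
    using assms(3) by (intro linearI) (simp_all add: linear_add linear_scale inner_add_left)
  then show "X (\<lambda>q. L (u q) \<bullet> b) p = L (dd X u p) \<bullet> b"
    by (rule dd_functional[OF assms(1,2)])
qed

lemma dd_const: "X \<in> VF \<Longrightarrow> dd X (\<lambda>_. v) p = 0"
  by (rule dd_eqI) (simp add: vf_rules(4))

lemma dd_frame [simp]: "X \<in> VF \<Longrightarrow> dd X (mc (\<iota> v)) p = 0"
  using dd_const[of X v p] by (simp add: mc_frame_fun)

lemma dd_add: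
  assumes "X \<in> VF" "smooth_vec u" "smooth_vec v"
  shows "dd X (\<lambda>q. u q + v q) p = dd X u p + dd X v p"
proof (rule dd_eqI)
  fix b
  show "X (\<lambda>q. (u q + v q) \<bullet> b) p = (dd X u p + dd X v p) \<bullet> b"
    using assms vf_rules(1)[OF assms(1), of "\<lambda>q. u q \<bullet> b" "\<lambda>q. v q \<bullet> b" p]
    by (simp add: inner_add_left dd_component smooth_vec_def)
qed

lemma dd_scale:
  assumes "X \<in> VF" "h \<in> SF" "smooth_vec u"
  shows "dd X (\<lambda>q. h q *\<^sub>R u q) p = X h p *\<^sub>R u p + h p *\<^sub>R dd X u p"
proof (rule dd_eqI)
  fix b
  show "X (\<lambda>q. (h q *\<^sub>R u q) \<bullet> b) p = (X h p *\<^sub>R u p + h p *\<^sub>R dd X u p) \<bullet> b"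
    using assms vf_rules(2)[OF assms(1,2), of "\<lambda>q. u q \<bullet> b" p]
    by (simp add: inner_add_left dd_component smooth_vec_def)
qed

lemma dd_inner:
  assumes X: "X \<in> VF" and u: "smooth_vec u" and v: "smooth_vec v"
  shows "X (\<lambda>q. u q \<bullet> v q) p = dd X u p \<bullet> v p + u p \<bullet> dd X v p"
proof -
  have s: "(\<lambda>q. u q \<bullet> b) \<in> SF" "(\<lambda>q. v q \<bullet> b) \<in> SF" for b using u v by (simp_all add: smooth_vec_def)
  have "(\<lambda>q. u q \<bullet> v q) = (\<lambda>q. \<Sum>b\<in>Basis. (u q \<bullet> b) * (v q \<bullet> b))"
    by (intro ext) (rule euclidean_inner)
  then have "X (\<lambda>q. u q \<bullet> v q) p = (\<Sum>b\<in>Basis. X (\<lambda>q. (u q \<bullet> b) * (v q \<bullet> b)) p)"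
    by (simp add: vf_sum[OF X finite_Basis] smooth_functions_mult s)
  also have "\<dots> = (\<Sum>b\<in>Basis. (u p \<bullet> b) * (dd X v p \<bullet> b) + (v p \<bullet> b) * (dd X u p \<bullet> b))"
    by (simp add: vf_rules(2)[OF X s] dd_component X u v)
  also have "\<dots> = (\<Sum>b\<in>Basis. (dd X u p \<bullet> b) * (v p \<bullet> b)) + (\<Sum>b\<in>Basis. (u p \<bullet> b) * (dd X v p \<bullet> b))"
    by (simp add: sum.distrib mult.commute)
  finally show ?thesis by (simp flip: euclidean_inner)
qed

lemma dd_plus_field: "dd (X + Y) u p = dd X u p + dd Y u p"
  by (simp add: dd_def scaleR_add_left sum.distrib)

lemma dd_mult_field: "dd (h \<cdot> X) u p = h p *\<^sub>R dd X u p"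
  by (simp add: dd_def vf_mult_def scaleR_sum_right)

lemma repr_bracket:
  assumes X: "X \<in> VF" and Y: "Y \<in> VF" and br: "bilinear br"
  shows "repr (vf_bracket X Y) p (dd X (mc Y) p - dd Y (mc X) p + br (mc X p) (mc Y p))"
  unfolding repr_def
proof
  fix f
  \<comment> \<open>The second-order part of X(Y f) is kept as a double sum over the frame:
    exchanging X and Y then pairs each product of two frame fields with the opposite one, and the
    differences are the frame brackets.\<close>
  have iter: "X (Y f) p = \<iota> (dd X (mc Y) p) f p
      + (\<Sum>b\<in>Basis. \<Sum>c\<in>Basis. (mc X p \<bullet> b * (mc Y p \<bullet> c)) * \<iota> b (\<iota> c f) p)"
    if f: "f \<in> SF" and X: "X \<in> VF" and Y: "Y \<in> VF" for X Y
  proof -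
    have s: "(\<lambda>q. mc Y q \<bullet> c) \<in> SF" "\<iota> c f \<in> SF" for c
      using frame_smooth[OF Y] vf_smooth[OF frame_vf f] by simp_all
    have rep: "Z h q = (\<Sum>b\<in>Basis. (mc Z q \<bullet> b) * \<iota> b h q)" if "Z \<in> VF" for Z h q
      using mc_repr[OF that, of q] frame_expand[of "mc Z q" h q] by (simp add: repr_def)
    have "Y f = (\<lambda>q. \<Sum>c\<in>Basis. (mc Y q \<bullet> c) * \<iota> c f q)"
      by (intro ext) (rule rep[OF Y])
    then have "X (Y f) p = (\<Sum>c\<in>Basis. X (\<lambda>q. (mc Y q \<bullet> c) * \<iota> c f q) p)"
      by (simp add: vf_sum[OF X finite_Basis] smooth_functions_mult s)
    also have "\<dots> = (\<Sum>c\<in>Basis. (dd X (mc Y) p \<bullet> c) * \<iota> c f p + (mc Y p \<bullet> c) * X (\<iota> c f) p)"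
      by (simp only: vf_rules(2)[OF X s] dd_component[OF X smooth_vec_mc[OF Y]]) (simp add: algebra_simps)
    also have "\<dots> = \<iota> (dd X (mc Y) p) f p + (\<Sum>c\<in>Basis. \<Sum>b\<in>Basis. (mc X p \<bullet> b * (mc Y p \<bullet> c)) * \<iota> b (\<iota> c f) p)"
      by (simp add: sum.distrib frame_expand[of "dd X (mc Y) p"] rep[OF X] sum_distrib_left mult_ac)
    finally show ?thesis by (subst sum.swap)
  qed
  show "vf_bracket X Y f p = \<iota> (dd X (mc Y) p - dd Y (mc X) p + br (mc X p) (mc Y p)) f p"
  proof (cases "f \<in> SF")
    case True
    let ?c = "\<lambda>b c. mc X p \<bullet> b * (mc Y p \<bullet> c)"
    have swap: "(\<Sum>b\<in>Basis. \<Sum>c\<in>Basis. (mc Y p \<bullet> b * (mc X p \<bullet> c)) * \<iota> b (\<iota> c f) p) =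
        (\<Sum>b\<in>Basis. \<Sum>c\<in>Basis. ?c b c * \<iota> c (\<iota> b f) p)"
      by (subst sum.swap) (simp add: mult_ac)
    have "bilinear (\<lambda>u v. \<iota> (br u v) f p)"
      using bilinear_ladd[OF br] bilinear_radd[OF br] bilinear_lmul[OF br] bilinear_rmul[OF br]
        linear_add[OF frame_linear] linear_scale[OF frame_linear]
      by (auto simp: bilinear_def intro!: linearI)
    from bilinear_frame_expand[OF this, of "mc X p" "mc Y p"]
    have "\<iota> (br (mc X p) (mc Y p)) f p = (\<Sum>b\<in>Basis. \<Sum>c\<in>Basis. ?c b c * (\<iota> b (\<iota> c f) p - \<iota> c (\<iota> b f) p))"
      by (simp add: frame_bracket vf_bracket_def)
    also have "\<dots> = (\<Sum>b\<in>Basis. \<Sum>c\<in>Basis. ?c b c * \<iota> b (\<iota> c f) p) - (\<Sum>b\<in>Basis. \<Sum>c\<in>Basis. ?c b c * \<iota> c (\<iota> b f) p)"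
      by (simp add: right_diff_distrib sum_subtractf)
    finally show ?thesis
      using iter[OF True X Y] iter[OF True Y X]
      by (simp add: vf_bracket_def swap linear_add[OF frame_linear] linear_diff[OF frame_linear])
  next
    case False
    have "X f = (\<lambda>_. 0)" "Y f = (\<lambda>_. 0)" "\<iota> v f p = 0" for v
      using vf_not_smooth[OF _ False] X Y frame_vf by (simp_all add: fun_eq_iff)
    then show ?thesis
      using vf_rules(4)[OF X, of 0 p] vf_rules(4)[OF Y, of 0 p] by (simp add: vf_bracket_def)
  qed
qed

end

section \<open>The left invariant structure in frame coefficients\<close>

locale abelian_left_invariant =
  left_invariant_frame A \<iota> br + abelian_3contact br \<phi> \<xi> \<eta>
  for A :: "('p::{t2_space,second_countable_topology}, 'm::euclidean_space) atlas"
    and \<iota> :: "'a::euclidean_space \<Rightarrow> 'p vfield" and br \<phi> \<xi> \<eta> +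
  assumes dim_eq: "DIM('m) = DIM('a)"
begin

abbreviation "S \<equiv> left_invariant_structure \<iota> \<phi> \<xi> \<eta>"

lemma repr_phi: "repr (phi S i X) p (\<phi> i (mc X p))"
  by (simp add: left_invariant_structure_def repr_def)

lemma mc_phi: "mc (phi S i X) p = \<phi> i (mc X p)"
  by (rule repr_mc[OF repr_phi])

lemma vf_phi: "X \<in> VF \<Longrightarrow> phi S i X \<in> VF"
  by (rule vfI[OF smooth_vec_linear[OF linear_\<phi> smooth_vec_mc] repr_phi])

lemma xi_eq: "xi S i = \<iota> (\<xi> i)"
  by (simp add: left_invariant_structure_def)

lemma eta_eq: "eta S i X = (\<lambda>p. \<eta> i (mc X p))"
  by (simp add: left_invariant_structure_def)

lemma met_eq: "met S X Y = (\<lambda>p. mc X p \<bullet> mc Y p)"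
  by (simp add: left_invariant_structure_def)

lemma fund_form_eq: "fund_form S i X Y = (\<lambda>p. mc X p \<bullet> \<phi> i (mc Y p))"
  by (simp add: fund_form_def met_eq mc_phi)

lemma mc_bracket:
  "X \<in> VF \<Longrightarrow> Y \<in> VF \<Longrightarrow> mc (vf_bracket X Y) p = dd X (mc Y) p - dd Y (mc X) p + br (mc X p) (mc Y p)"
  by (rule repr_mc[OF repr_bracket[OF _ _ bilinear_br]])

lemma one_form_inner:
  assumes "linear L"
  shows "one_form A (\<lambda>X p. L (mc X p) :: real)"
  unfolding one_form_def
  by (auto simp: mc_add mc_mult linear_add[OF assms] linear_scale[OF assms] fun_eq_iff
      intro: smooth_functional[OF assms smooth_vec_mc])

lemma almost_3contact: "almost_3contact_metric_manifold A S"
  unfolding almost_3contact_metric_manifold_def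
proof (intro conjI allI impI ballI)
  show "smooth_atlas A" by (rule atlas)
  show "\<exists>n\<ge>1. DIM('m) = 4 * n + 3"
    using lie_alg by (simp add: dim_eq almost_3contact_metric_lie_algebra_def)
  show "endo_field A (phi S i)" for i
    unfolding endo_field_def
    by (auto intro!: vf_phi vf_eqI[OF repr_phi] repr_add repr_mult repr_phi
        simp: mc_add mc_mult \<phi>_simps)
  show "xi S i \<in> VF" for i by (simp add: xi_eq frame_vf)
  show "one_form A (eta S i)" for i
    using one_form_inner[OF linear_\<eta>] by (simp add: eta_eq[abs_def])
  show "phi S i (phi S i X) = - X + eta S i X \<cdot> xi S i" if "X \<in> VF" for i X
  proof (rule vf_eqI[OF repr_phi])
    fix q
    have "repr (- X + eta S i X \<cdot> xi S i) q (- mc X q + eta S i X q *\<^sub>R \<xi> i)"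
      unfolding xi_eq by (intro repr_add repr_uminus repr_mult mc_repr that repr_frame)
    then show "repr (- X + eta S i X \<cdot> xi S i) q (\<phi> i (mc (phi S i X) q))"
      by (simp only: mc_phi \<phi>_\<phi> eta_eq)
  qed
  show "eta S i (xi S i) = 1" for i by (simp add: eta_eq xi_eq fun_eq_iff)
  fix i j k assume p: "even_perm i j k"
  show "phi S k X = phi S i (phi S j X) - eta S j X \<cdot> xi S i" if "X \<in> VF" for X
  proof (rule vf_eqI[OF repr_phi])
    fix q
    have "repr (phi S i (phi S j X) - eta S j X \<cdot> xi S i) q (\<phi> i (mc (phi S j X) q) - eta S j X q *\<^sub>R \<xi> i)"
      unfolding xi_eq by (intro repr_diff repr_mult repr_phi repr_frame)
    then show "repr (phi S i (phi S j X) - eta S j X \<cdot> xi S i) q (\<phi> k (mc X q))"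
      by (simp add: mc_phi quaternionic(1)[OF p] eta_eq)
  qed
  show "phi S k X = - phi S j (phi S i X) + eta S i X \<cdot> xi S j" if "X \<in> VF" for X
  proof (rule vf_eqI[OF repr_phi])
    fix q
    have "repr (- phi S j (phi S i X) + eta S i X \<cdot> xi S j) q (- \<phi> j (mc (phi S i X) q) + eta S i X q *\<^sub>R \<xi> j)"
      unfolding xi_eq by (intro repr_add repr_uminus repr_mult repr_phi repr_frame)
    then show "repr (- phi S j (phi S i X) + eta S i X \<cdot> xi S j) q (\<phi> k (mc X q))"
      by (simp add: mc_phi quaternionic(2)[OF p] eta_eq)
  qed
  show "xi S k = phi S i (xi S j)"
  proof (rule vf_eqI[OF _ repr_phi])
    show "repr (xi S k) q (\<phi> i (mc (xi S j) q))" for q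
      by (simp add: xi_eq quaternionic(3)[OF p])
  qed
  show "xi S k = - phi S j (xi S i)"
  proof (rule vf_eqI[OF _ repr_uminus[OF repr_phi]])
    show "repr (xi S k) q (- \<phi> j (mc (xi S i) q))" for q
      by (simp add: xi_eq quaternionic(4)[OF p])
  qed
  show "eta S k X = eta S i (phi S j X)" "eta S k X = - eta S j (phi S i X)" if "X \<in> VF" for X
    by (simp_all add: eta_eq mc_phi quaternionic(5,6)[OF p] fun_eq_iff)
next
  show "riemannian_metric A (met S)"
    unfolding riemannian_metric_def
  proof (intro conjI ballI allI)
    fix Y assume Y: "Y \<in> VF"
    show "one_form A (\<lambda>X. met S X Y)"
      unfolding one_form_def met_eq
      by (auto simp: mc_add mc_mult inner_add_left fun_eq_iff intro: smooth_inner smooth_vec_mc Y)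
  next
    fix X p assume X: "X \<in> VF"
    show "0 \<le> met S X X p" by (simp add: met_eq)
    show "met S X X p = 0 \<longrightarrow> (\<forall>f. X f p = 0)"
      using mc_zeroD[OF X] by (simp add: met_eq)
  qed (simp add: met_eq inner_commute)
next
  show "met S (phi S i X) (phi S i Y) = met S X Y - eta S i X * eta S i Y"
    if "X \<in> VF" "Y \<in> VF" for i X Y
    by (simp add: met_eq mc_phi metric eta_eq fun_eq_iff)
qed

lemma horizontal_fieldsD: "X \<in> horizontal_fields A S \<Longrightarrow> X \<in> VF \<and> mc X p \<in> hor"
  by (auto simp: horizontal_fields_def eta_eq horizontal_def fun_eq_iff)

lemma horizontal_fields_frame: "v \<in> hor \<Longrightarrow> \<iota> v \<in> horizontal_fields A S"
  by (auto simp: horizontal_fields_def eta_eq horizontal_def fun_eq_iff frame_vf)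

lemma ext_d1_eta:
  assumes "X \<in> VF" "Y \<in> VF"
  shows "ext_d1 (eta S i) X Y p = - \<eta> i (br (mc X p) (mc Y p))"
proof -
  have "X (eta S i Y) p = \<eta> i (dd X (mc Y) p)" "Y (eta S i X) p = \<eta> i (dd Y (mc X) p)"
    using assms unfolding eta_eq by (auto intro!: dd_functional smooth_vec_mc linear_\<eta>)
  then show ?thesis
    using assms by (simp add: ext_d1_def mc_bracket eta_eq[of i "vf_bracket X Y"] \<eta>_simps)
qed

text \<open>\<phi>_i has constant components in the frame. This constancy is why the derivative
  terms drop out of the Nijenhuis tensor, of d\<Phi>_i and of the Lie derivative of
  \<phi>_i.\<close>

lemma dd_phi: "X \<in> VF \<Longrightarrow> Y \<in> VF \<Longrightarrow> dd X (mc (phi S i Y)) p = \<phi> i (dd X (mc Y) p)"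
  using dd_linear[OF _ smooth_vec_mc linear_\<phi>, of X Y i p] by (simp add: mc_phi[abs_def])

lemma mc_N_tensor:
  assumes X: "X \<in> VF" and Y: "Y \<in> VF"
  shows "mc (N_tensor S i X Y) p = br (\<phi> i (mc X p)) (\<phi> i (mc Y p)) + \<phi> i (\<phi> i (br (mc X p) (mc Y p)))
    - \<phi> i (br (\<phi> i (mc X p)) (mc Y p)) - \<phi> i (br (mc X p) (\<phi> i (mc Y p))) - \<eta> i (br (mc X p) (mc Y p)) *\<^sub>R \<xi> i"
proof -
  note V = X Y vf_phi[OF X] vf_phi[OF Y]
  note b = repr_bracket[OF _ _ bilinear_br]
  have "repr (N_tensor S i X Y) p
      ((dd (phi S i X) (mc (phi S i Y)) p - dd (phi S i Y) (mc (phi S i X)) p + br (mc (phi S i X) p) (mc (phi S i Y) p))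
       + \<phi> i (mc (phi S i (vf_bracket X Y)) p) - \<phi> i (mc (vf_bracket (phi S i X) Y) p)
       - \<phi> i (mc (vf_bracket X (phi S i Y)) p) + ext_d1 (eta S i) X Y p *\<^sub>R \<xi> i)"
    unfolding N_tensor_def xi_eq
    by (intro repr_add repr_diff repr_mult repr_phi repr_frame b V)
  from repr_mc[OF this] show ?thesis
    by (simp add: mc_phi mc_bracket V dd_phi ext_d1_eta \<phi>_simps)
qed

lemma N_form_zero:
  assumes "X \<in> horizontal_fields A S" "Y \<in> horizontal_fields A S"
  shows "N_form S i X Y Z p = 0"
  using assms nijenhuis_vanishes[of "mc X p" "mc Y p" i] horizontal_fieldsD[of X p] horizontal_fieldsD[of Y p]
  by (simp add: N_form_def met_eq mc_N_tensor)

lemma ext_d2_fund_form: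
  assumes X: "X \<in> VF" and Y: "Y \<in> VF" and Z: "Z \<in> VF"
  shows "ext_d2 (fund_form S i) X Y Z p = - (br (mc X p) (mc Y p) \<bullet> \<phi> i (mc Z p))
    - br (mc Y p) (mc Z p) \<bullet> \<phi> i (mc X p) - br (mc Z p) (mc X p) \<bullet> \<phi> i (mc Y p)"
proof -
  \<comment> \<open>By skewness \<phi>_i is made to act on undifferentiated fields only; the six
    derivative terms then match those of the three brackets.\<close>
  have d: "X (fund_form S i Y Z) p = dd X (mc Y) p \<bullet> \<phi> i (mc Z p) - \<phi> i (mc Y p) \<bullet> dd X (mc Z) p"
    if "X \<in> VF" "Y \<in> VF" "Z \<in> VF" for X Y Z
  proof -
    have "X (fund_form S i Y Z) p = dd X (mc Y) p \<bullet> \<phi> i (mc Z p) + mc Y p \<bullet> \<phi> i (dd X (mc Z) p)"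
      unfolding fund_form_eq using that
      by (subst dd_inner) (auto intro!: smooth_vec_mc smooth_vec_linear[OF linear_\<phi>] simp: dd_linear[OF _ smooth_vec_mc linear_\<phi>])
    then show ?thesis by (simp add: \<phi>_skew)
  qed
  show ?thesis
    using assms
    by (simp add: ext_d2_def d fund_form_eq[of _ "vf_bracket _ _"] mc_bracket inner_add_left inner_diff_left
        inner_commute[of "\<phi> i (mc X p)"] inner_commute[of "\<phi> i (mc Y p)"] inner_commute[of "\<phi> i (mc Z p)"])
qed

lemma killing_defect:
  assumes X: "X \<in> VF" and Y: "Y \<in> VF"
  shows "(\<iota> v) (met S X Y) p - met S (vf_bracket (\<iota> v) X) Y p - met S X (vf_bracket (\<iota> v) Y) p
    = - (br v (mc X p) \<bullet> mc Y p + mc X p \<bullet> br v (mc Y p))"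
  using dd_inner[OF frame_vf smooth_vec_mc[OF X] smooth_vec_mc[OF Y], of v p] assms
  by (simp add: met_eq mc_bracket frame_vf inner_add_left inner_add_right)

lemma A_tensor_eq:
  assumes X: "X \<in> VF" and Y: "Y \<in> VF"
  shows "A_tensor S i j X Y p = alg_A i j (mc X p) (mc Y p)"
proof -
  have "repr (lie_deriv_endo (xi S j) (phi S i) X) p
     ((dd (\<iota> (\<xi> j)) (mc (phi S i X)) p - dd (phi S i X) (mc (\<iota> (\<xi> j))) p + br (mc (\<iota> (\<xi> j)) p) (mc (phi S i X) p))
      - \<phi> i (mc (vf_bracket (\<iota> (\<xi> j)) X) p))"
    unfolding lie_deriv_endo_def xi_eq
    by (intro repr_diff repr_phi repr_bracket bilinear_br frame_vf vf_phi X)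
  from repr_mc[OF this]
  have "mc (lie_deriv_endo (xi S j) (phi S i) X) p = br (\<xi> j) (\<phi> i (mc X p)) - \<phi> i (br (\<xi> j) (mc X p))"
    by (simp add: mc_bracket frame_vf X vf_phi mc_phi dd_phi \<phi>_simps)
  then show ?thesis
    by (simp add: A_tensor_def met_eq ext_d1_eta X Y vf_phi mc_phi alg_A_def)
qed

text \<open>Forwards, the conditions are tested on frame fields, which take every value at every
  point; backwards, both sides depend only on the values of the fields at a point, where the
  algebraic identities apply.\<close>

lemma canonical_with_iff: "canonical_with A S b \<longleftrightarrow> b \<in> SF \<and> (\<forall>p. alg_canonical (b p))"
proof
  assume c: "canonical_with A S b"
  have "alg_canonical (b p)" for p
    unfolding alg_canonical_def
  proof (intro conjI allI impI ballI)
    fix i u v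
    have "killing A (met S) (\<iota> (\<xi> i))" using c by (simp add: canonical_with_def xi_eq)
    then have "(\<iota> (\<xi> i)) (met S (\<iota> u) (\<iota> v)) - met S (vf_bracket (\<iota> (\<xi> i)) (\<iota> u)) (\<iota> v)
        - met S (\<iota> u) (vf_bracket (\<iota> (\<xi> i)) (\<iota> v)) = 0"
      using frame_vf by (simp add: killing_def)
    from fun_cong[OF this, of p] show "br (\<xi> i) u \<bullet> v + u \<bullet> br (\<xi> i) v = 0"
      using killing_defect[OF frame_vf frame_vf, of "\<xi> i" u v p] by simp
  next
    fix i j k u v assume p: "even_perm i j k" and uv: "u \<in> hor" "v \<in> hor"
    have "A_tensor S i j (\<iota> u) (\<iota> v) = b * fund_form S k (\<iota> u) (\<iota> v)"
      "- A_tensor S j i (\<iota> u) (\<iota> v) = b * fund_form S k (\<iota> u) (\<iota> v)"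
      using c p uv[THEN horizontal_fields_frame] unfolding canonical_with_def by blast+
    from this[THEN fun_cong, of p]
    show "alg_A i j u v = b p * (u \<bullet> \<phi> k v)" "- alg_A j i u v = b p * (u \<bullet> \<phi> k v)"
      by (simp_all add: A_tensor_eq frame_vf fund_form_eq)
  qed
  then show "b \<in> SF \<and> (\<forall>p. alg_canonical (b p))"
    using c by (simp add: canonical_with_def)
next
  assume c: "b \<in> SF \<and> (\<forall>p. alg_canonical (b p))"
  show "canonical_with A S b"
    unfolding canonical_with_def
  proof (intro conjI allI impI ballI)
    show "almost_3contact_metric_manifold A S" by (rule almost_3contact)
    show "b \<in> SF" using c by simp
    show "skew3_on (horizontal_fields A S) (N_form S i)" for i
      by (simp add: skew3_on_def fun_eq_iff N_form_zero)
    show "killing A (met S) (xi S i)" for i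
      unfolding killing_def
    proof (intro ballI)
      fix X Y assume "X \<in> VF" "Y \<in> VF"
      moreover have "br (\<xi> i) (mc X p) \<bullet> mc Y p + mc X p \<bullet> br (\<xi> i) (mc Y p) = 0" for p
        using c by (simp add: alg_canonical_def)
      ultimately show "xi S i (met S X Y) - met S (vf_bracket (xi S i) X) Y - met S X (vf_bracket (xi S i) Y) = 0"
        using killing_defect[of X Y "\<xi> i"] by (simp add: fun_eq_iff xi_eq)
    qed
  next
    fix i j X Y Z
    assume h: "X \<in> horizontal_fields A S" "Y \<in> horizontal_fields A S" "Z \<in> horizontal_fields A S"
    then have v: "X \<in> VF" "Y \<in> VF" "Z \<in> VF" "mc X p \<in> hor" "mc Y p \<in> hor" "mc Z p \<in> hor" for p
      using horizontal_fieldsD by blast+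
    show "N_form S i X Y Z - ext_d2 (fund_form S i) (phi S i X) (phi S i Y) (phi S i Z) =
        N_form S j X Y Z - ext_d2 (fund_form S j) (phi S j X) (phi S j Y) (phi S j Z)"
      by (intro ext) (simp only: minus_apply N_form_zero[OF h(1,2)] ext_d2_fund_form[OF v(1-3)[THEN vf_phi]]
          mc_phi d_fund_form_\<phi>[OF v(4-6)])
  next
    fix i X Y assume h: "X \<in> horizontal_fields A S" "Y \<in> horizontal_fields A S"
    then have v: "X \<in> VF" "Y \<in> VF" "mc X p \<in> hor" "mc Y p \<in> hor" for p
      using horizontal_fieldsD by blast+
    show "A_tensor S i i X Y = 0"
      using v by (simp add: fun_eq_iff A_tensor_eq alg_A_diagonal)
    fix j k assume p: "even_perm i j k"
    have "alg_A i j (mc X q) (mc Y q) = b q * (mc X q \<bullet> \<phi> k (mc Y q))"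
      "- alg_A j i (mc X q) (mc Y q) = b q * (mc X q \<bullet> \<phi> k (mc Y q))" for q
      using c p v(3,4)[of q] unfolding alg_canonical_def by blast+
    then show "A_tensor S i j X Y = b * fund_form S k X Y" "- A_tensor S j i X Y = b * fund_form S k X Y"
      using v by (simp_all add: fun_eq_iff A_tensor_eq fund_form_eq)
  qed
qed

text \<open>Both constants are read off from the adjoint action of \<open>\<xi> 1\<close> on a
  nonzero horizontal vector, which \<phi>_1 does not kill.\<close>

lemma alg_canonical_unique:
  assumes "alg_canonical \<beta>" "alg_canonical \<beta>'"
  shows "\<beta> = \<beta>'"
proof -
  obtain X where X: "X \<in> hor" "X \<noteq> 0" by (rule horizontal_nonzero)
  have "br (\<xi> 1) X = (\<beta> / 2) *\<^sub>R \<phi> 1 X"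
    using alg_canonical_imp_laws(2)[OF assms(1)] X(1) by (simp add: horizontal_ad_law_def)
  moreover have "br (\<xi> 1) X = (\<beta>' / 2) *\<^sub>R \<phi> 1 X"
    using alg_canonical_imp_laws(2)[OF assms(2)] X(1) by (simp add: horizontal_ad_law_def)
  moreover have "\<phi> 1 X \<noteq> 0"
    using hor_\<phi>_\<phi>(1)[OF X(1), of 1] X(2) by (metis \<phi>_simps(5) neg_0_equal_iff_equal)
  ultimately show ?thesis by simp
qed

lemma canonical_with_const:
  assumes "canonical_with A S b"
  obtains \<beta> where "b = (\<lambda>_. \<beta>)" "alg_canonical \<beta>"
proof -
  \<comment> \<open>\<open>undefined\<close> is merely some point of the group: b takes the same
    value at any two points.\<close>
  have "b = (\<lambda>_. b undefined)"
    using assms alg_canonical_unique by (auto simp: canonical_with_iff fun_eq_iff)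
  then show thesis using that assms by (metis canonical_with_iff)
qed

section \<open>Affine connections in frame coefficients\<close>

lemma affine_connection_sum:
  assumes D: "affine_connection A D" and X: "X \<in> VF" and I: "finite I"
    and Y: "\<And>i. i \<in> I \<Longrightarrow> Y i \<in> VF"
  shows "(\<Sum>i\<in>I. Y i) \<in> VF" "D X (\<Sum>i\<in>I. Y i) = (\<Sum>i\<in>I. D X (Y i))" "D (\<Sum>i\<in>I. Y i) X = (\<Sum>i\<in>I. D (Y i) X)"
proof -
  have z: "(0 :: 'p vfield) \<in> VF"
  proof (rule vfI[OF smooth_vec_const])
    show "repr 0 p 0" for p using linear_0[OF frame_linear] by (simp add: repr_def)
  qed
  have a: "D X (Y + Z) = D X Y + D X Z" "D (Y + Z) X = D Y X + D Z X" if "Y \<in> VF" "Z \<in> VF" for Y Z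
    using D X that unfolding affine_connection_def endo_field_def by blast+
  \<comment> \<open>The three claims are proved together: a connection is additive only on vector
    fields, so the induction step needs the partial sum to be one.\<close>
  have "(\<Sum>i\<in>I. Y i) \<in> VF \<and> D X (\<Sum>i\<in>I. Y i) = (\<Sum>i\<in>I. D X (Y i)) \<and> D (\<Sum>i\<in>I. Y i) X = (\<Sum>i\<in>I. D (Y i) X)"
    using I Y
  proof (induction I rule: finite_induct)
    case empty
    have "D X 0 = 0" "D 0 X = 0" using a[OF z z] by simp_all
    then show ?case using z by (simp only: sum.empty)
  next
    case (insert i I)
    then have "Y i \<in> VF" and "(\<Sum>i\<in>I. Y i) \<in> VF \<and> D X (\<Sum>i\<in>I. Y i) = (\<Sum>i\<in>I. D X (Y i)) \<and>
        D (\<Sum>i\<in>I. Y i) X = (\<Sum>i\<in>I. D (Y i) X)"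
      by blast+
    then show ?case by (simp only: sum.insert[OF insert.hyps] a vf_add)
  qed
  then show "(\<Sum>i\<in>I. Y i) \<in> VF" "D X (\<Sum>i\<in>I. Y i) = (\<Sum>i\<in>I. D X (Y i))" "D (\<Sum>i\<in>I. Y i) X = (\<Sum>i\<in>I. D (Y i) X)"
    by simp_all
qed

lemma vf_frame_expand:
  assumes "X \<in> VF"
  shows "X = (\<Sum>b\<in>Basis. (\<lambda>p. mc X p \<bullet> b) \<cdot> \<iota> b)"
proof (rule vf_eqI[OF mc_repr[OF assms]])
  fix p
  have "repr (\<Sum>b\<in>Basis. (\<lambda>p. mc X p \<bullet> b) \<cdot> \<iota> b) p (\<Sum>b\<in>Basis. (mc X p \<bullet> b) *\<^sub>R b)"
    by (intro repr_sum repr_mult[where h = "\<lambda>p. mc X p \<bullet> _"] repr_frame finite_Basis)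
  then show "repr (\<Sum>b\<in>Basis. (\<lambda>p. mc X p \<bullet> b) \<cdot> \<iota> b) p (mc X p)"
    by (simp add: euclidean_representation)
qed

text \<open>The symbols depend on the point because a canonical connection is not known in advance
  to be left invariant.\<close>

definition christoffel :: "('p vfield \<Rightarrow> 'p vfield \<Rightarrow> 'p vfield) \<Rightarrow> 'p \<Rightarrow> 'a \<Rightarrow> 'a \<Rightarrow> 'a" where
  "christoffel D p u v = (\<Sum>b\<in>Basis. (v \<bullet> b) *\<^sub>R (\<Sum>c\<in>Basis. (u \<bullet> c) *\<^sub>R mc (D (\<iota> c) (\<iota> b)) p))"

lemma mc_connection:
  assumes D: "affine_connection A D" and X: "X \<in> VF" and Y: "Y \<in> VF"
  shows "mc (D X Y) p = dd X (mc Y) p + christoffel D p (mc X p) (mc Y p)"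
proof -
  have vf: "D X Y \<in> VF" if "X \<in> VF" "Y \<in> VF" for X Y
    using D that by (simp add: affine_connection_def endo_field_def)
  have first: "repr (D X (\<iota> b)) p (\<Sum>c\<in>Basis. (mc X p \<bullet> c) *\<^sub>R mc (D (\<iota> c) (\<iota> b)) p)" for b
  proof -
    have "D X (\<iota> b) = D (\<Sum>c\<in>Basis. (\<lambda>p. mc X p \<bullet> c) \<cdot> \<iota> c) (\<iota> b)"
      using vf_frame_expand[OF X] by simp
    also have "\<dots> = (\<Sum>c\<in>Basis. D ((\<lambda>p. mc X p \<bullet> c) \<cdot> \<iota> c) (\<iota> b))"
      by (intro affine_connection_sum(3)[OF D frame_vf] vf_mult frame_smooth[OF X] frame_vf finite_Basis)
    also have "\<dots> = (\<Sum>c\<in>Basis. (\<lambda>p. mc X p \<bullet> c) \<cdot> D (\<iota> c) (\<iota> b))"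
      using D frame_vf frame_smooth[OF X] by (simp add: affine_connection_def endo_field_def)
    finally show ?thesis
      by (simp only:) (intro repr_sum repr_mult[where h = "\<lambda>p. mc X p \<bullet> _"] mc_repr vf frame_vf finite_Basis)
  qed
  have "D X Y = D X (\<Sum>b\<in>Basis. (\<lambda>p. mc Y p \<bullet> b) \<cdot> \<iota> b)"
    using vf_frame_expand[OF Y] by simp
  also have "\<dots> = (\<Sum>b\<in>Basis. D X ((\<lambda>p. mc Y p \<bullet> b) \<cdot> \<iota> b))"
    by (intro affine_connection_sum(2)[OF D X] vf_mult frame_smooth[OF Y] frame_vf finite_Basis)
  also have "\<dots> = (\<Sum>b\<in>Basis. X (\<lambda>p. mc Y p \<bullet> b) \<cdot> \<iota> b + (\<lambda>p. mc Y p \<bullet> b) \<cdot> D X (\<iota> b))"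
    using D frame_vf frame_smooth[OF Y] X by (simp add: affine_connection_def)
  finally have "repr (D X Y) p (\<Sum>b\<in>Basis. X (\<lambda>p. mc Y p \<bullet> b) p *\<^sub>R b
      + (mc Y p \<bullet> b) *\<^sub>R (\<Sum>c\<in>Basis. (mc X p \<bullet> c) *\<^sub>R mc (D (\<iota> c) (\<iota> b)) p))"
    by (simp only:) (intro repr_sum repr_add repr_mult[where h = "X _"] repr_mult[where h = "\<lambda>p. mc Y p \<bullet> _"]
        repr_frame first finite_Basis)
  from repr_mc[OF this] show ?thesis
    by (simp add: sum.distrib dd_def christoffel_def)
qed

lemma torsion3_eq:
  assumes D: "affine_connection A D" and X: "X \<in> VF" and Y: "Y \<in> VF"
  shows "torsion3 (met S) D X Y Z p = (christoffel D p (mc X p) (mc Y p) - christoffel D p (mc Y p) (mc X p)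
    - br (mc X p) (mc Y p)) \<bullet> mc Z p"
proof -
  have vf: "D X Y \<in> VF" "D Y X \<in> VF"
    using D X Y by (simp_all add: affine_connection_def endo_field_def)
  have mc: "mc (D X Y - D Y X - vf_bracket X Y) p = mc (D X Y) p - mc (D Y X) p
      - (dd X (mc Y) p - dd Y (mc X) p + br (mc X p) (mc Y p))"
    by (intro repr_mc repr_diff mc_repr vf repr_bracket X Y bilinear_br)
  show ?thesis
    by (simp only: torsion3_def met_eq mc mc_connection[OF D X Y] mc_connection[OF D Y X]) (simp add: algebra_simps)
qed

end

section \<open>Existence of the canonical connection on the group, and its torsion\<close>

locale canonical_left_invariant =
  abelian_left_invariant A \<iota> br \<phi> \<xi> \<eta> + canonical_3contact br \<phi> \<xi> \<eta> \<beta> \<delta>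
  for A :: "('p::{t2_space,second_countable_topology}, 'm::euclidean_space) atlas"
    and \<iota> :: "'a::euclidean_space \<Rightarrow> 'p vfield" and br \<phi> \<xi> \<eta> \<beta> \<delta>
begin

definition conn :: "'p vfield \<Rightarrow> 'p vfield \<Rightarrow> 'p vfield" where
  "conn X Y f p = \<iota> (dd X (mc Y) p + \<Gamma> (mc X p) (mc Y p)) f p"

lemma repr_conn: "repr (conn X Y) p (dd X (mc Y) p + \<Gamma> (mc X p) (mc Y p))"
  by (simp add: repr_def conn_def)

lemma mc_conn: "mc (conn X Y) p = dd X (mc Y) p + \<Gamma> (mc X p) (mc Y p)"
  by (rule repr_mc[OF repr_conn])

lemma vf_conn: "X \<in> VF \<Longrightarrow> Y \<in> VF \<Longrightarrow> conn X Y \<in> VF"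
  by (rule vfI[OF smooth_vec_add[OF smooth_vec_dd[OF _ smooth_vec_mc]
        smooth_vec_bilinear[OF \<Gamma>_bilinear smooth_vec_mc smooth_vec_mc]] repr_conn])

lemmas \<Gamma>_simps = bilinear_ladd[OF \<Gamma>_bilinear] bilinear_radd[OF \<Gamma>_bilinear]
  bilinear_lmul[OF \<Gamma>_bilinear] bilinear_rmul[OF \<Gamma>_bilinear]

lemma dd_mc_add:
  assumes "X \<in> VF" "Y \<in> VF" "Z \<in> VF"
  shows "dd X (mc (Y + Z)) p = dd X (mc Y) p + dd X (mc Z) p"
proof -
  have "mc (Y + Z) = (\<lambda>p. mc Y p + mc Z p)"
    using assms by (intro ext) (rule mc_add)
  then show ?thesis using assms by (simp only: dd_add smooth_vec_mc)
qed

lemma dd_mc_mult: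
  assumes "X \<in> VF" "Y \<in> VF" "h \<in> SF"
  shows "dd X (mc (h \<cdot> Y)) p = X h p *\<^sub>R mc Y p + h p *\<^sub>R dd X (mc Y) p"
proof -
  have "mc (h \<cdot> Y) = (\<lambda>p. h p *\<^sub>R mc Y p)"
    using assms by (intro ext) (rule mc_mult)
  then show ?thesis using assms by (simp only: dd_scale smooth_vec_mc)
qed

lemma affine_conn: "affine_connection A conn"
  unfolding affine_connection_def endo_field_def
proof (intro conjI ballI)
  fix X Y assume X: "X \<in> VF" and Y: "Y \<in> VF"
  show "conn Y X \<in> VF" by (rule vf_conn[OF Y X])
next
  fix X Y Z assume V: "X \<in> VF" "Y \<in> VF" "Z \<in> VF"
  have "repr (conn Y X + conn Z X) p (dd (Y + Z) (mc X) p + \<Gamma> (mc (Y + Z) p) (mc X p))"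
    "repr (conn X Y + conn X Z) p (dd X (mc (Y + Z)) p + \<Gamma> (mc X p) (mc (Y + Z) p))" for p
    using repr_add[OF repr_conn[of Y X p] repr_conn[of Z X p]] repr_add[OF repr_conn[of X Y p] repr_conn[of X Z p]] V
    by (simp_all add: dd_plus_field mc_add dd_mc_add \<Gamma>_simps add_ac)
  then show "conn (Y + Z) X = conn Y X + conn Z X" "conn X (Y + Z) = conn X Y + conn X Z"
    by (blast intro: vf_eqI[OF repr_conn])+
next
  fix X Y h assume V: "X \<in> VF" "Y \<in> VF" "h \<in> SF"
  have "repr (X h \<cdot> Y + h \<cdot> conn X Y) p (dd X (mc (h \<cdot> Y)) p + \<Gamma> (mc X p) (mc (h \<cdot> Y) p))" for p
    using repr_add[OF repr_mult[OF mc_repr[OF V(2)], of "X h" p] repr_mult[OF repr_conn[of X Y p], of h]] V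
    by (simp add: dd_mc_mult mc_mult \<Gamma>_simps scaleR_add_right add_ac)
  then show "conn X (h \<cdot> Y) = X h \<cdot> Y + h \<cdot> conn X Y"
    by (blast intro: vf_eqI[OF repr_conn])
next
  fix X Y h assume V: "X \<in> VF" "h \<in> SF" "Y \<in> VF"
  have "repr (h \<cdot> conn Y X) p (dd (h \<cdot> Y) (mc X) p + \<Gamma> (mc (h \<cdot> Y) p) (mc X p))" for p
    using repr_mult[OF repr_conn[of Y X p], of h] V
    by (simp add: dd_mult_field mc_mult \<Gamma>_simps scaleR_add_right)
  then show "conn (h \<cdot> Y) X = h \<cdot> conn Y X"
    by (blast intro: vf_eqI[OF repr_conn])
qed

text \<open>The flat part \<open>dd\<close> preserves the metric and the \<phi>_i, and its torsion
  is minus the algebraic bracket of the values, so everything reduces to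
  \<open>\<Gamma>_metric\<close>, \<open>\<Gamma>_torsion\<close> and
  \<open>\<Gamma>_\<phi>\<close>.\<close>

lemma canonical_conn: "canonical_connection A S (\<lambda>_. \<beta>) conn"
  unfolding canonical_connection_def metric_connection_def
proof (intro conjI affine_conn ballI allI impI)
  fix X Y Z assume V: "X \<in> VF" "Y \<in> VF" "Z \<in> VF"
  show "X (met S Y Z) = met S (conn X Y) Z + met S Y (conn X Z)"
    using \<Gamma>_metric V
    by (simp add: fun_eq_iff met_eq mc_conn dd_inner smooth_vec_mc inner_add_left inner_add_right)
next
  have "torsion3 (met S) conn X Y Z p = torsion_form br \<xi> \<eta> \<beta> \<delta> (mc X p) (mc Y p) (mc Z p)"
    if "X \<in> VF" "Y \<in> VF" for X Y Z p
  proof -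
    have "mc (conn X Y - conn Y X - vf_bracket X Y) p =
        (dd X (mc Y) p + \<Gamma> (mc X p) (mc Y p)) - (dd Y (mc X) p + \<Gamma> (mc Y p) (mc X p))
        - (dd X (mc Y) p - dd Y (mc X) p + br (mc X p) (mc Y p))"
      by (intro repr_mc repr_diff repr_conn repr_bracket that bilinear_br)
    also have "\<dots> = \<Gamma> (mc X p) (mc Y p) - \<Gamma> (mc Y p) (mc X p) - br (mc X p) (mc Y p)"
      by (simp add: algebra_simps)
    finally show ?thesis by (simp add: torsion3_def met_eq \<Gamma>_torsion)
  qed
  then show "skew3_on (vector_fields A) (torsion3 (met S) conn)"
    unfolding skew3_on_def fun_eq_iff uminus_apply
    using torsion_form_skew by metis
next
  fix i j k X Y assume p: "even_perm i j k" and V: "X \<in> VF" "Y \<in> VF"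
  show "conn X (phi S i Y) - phi S i (conn X Y) = (\<lambda>_. \<beta>) \<cdot> (eta S k X \<cdot> phi S j Y - eta S j X \<cdot> phi S k Y)"
  proof (rule vf_eqI[OF repr_diff[OF repr_conn repr_phi]])
    fix q
    have "repr ((\<lambda>_. \<beta>) \<cdot> (eta S k X \<cdot> phi S j Y - eta S j X \<cdot> phi S k Y)) q
        (\<beta> *\<^sub>R (eta S k X q *\<^sub>R \<phi> j (mc Y q) - eta S j X q *\<^sub>R \<phi> k (mc Y q)))"
      by (intro repr_mult[where h = "\<lambda>_. \<beta>"] repr_diff repr_mult repr_phi)
    moreover have "\<beta> *\<^sub>R (eta S k X q *\<^sub>R \<phi> j (mc Y q) - eta S j X q *\<^sub>R \<phi> k (mc Y q)) =
        \<Gamma> (mc X q) (\<phi> i (mc Y q)) - \<phi> i (\<Gamma> (mc X q) (mc Y q))"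
      by (simp only: \<Gamma>_\<phi>[OF p] eta_eq)
    ultimately show "repr ((\<lambda>_. \<beta>) \<cdot> (eta S k X \<cdot> phi S j Y - eta S j X \<cdot> phi S k Y)) q
        (dd X (mc (phi S i Y)) q + \<Gamma> (mc X q) (mc (phi S i Y) q) - \<phi> i (mc (conn X Y) q))"
      using V by (simp add: dd_phi mc_phi mc_conn \<phi>_simps)
  qed
qed

text \<open>At each point p the symbols of D and \<Gamma> satisfy the hypotheses of
  \<open>torsion_unique\<close>: the defining properties of D are tested on frame fields, whose
  \<open>dd\<close> vanishes, so that they become algebraic identities for the symbols.\<close>

lemma torsion_canonical_connection:
  assumes D: "canonical_connection A S (\<lambda>_. \<beta>) D" and V: "X \<in> VF" "Y \<in> VF"
  shows "torsion3 (met S) D X Y Z p = torsion_form br \<xi> \<eta> \<beta> \<delta> (mc X p) (mc Y p) (mc Z p)"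
proof -
  have aff: "affine_connection A D" and metric_D: "\<And>X Y Z. X \<in> VF \<Longrightarrow> Y \<in> VF \<Longrightarrow> Z \<in> VF \<Longrightarrow>
      X (met S Y Z) = met S (D X Y) Z + met S Y (D X Z)"
    and skew: "skew3_on VF (torsion3 (met S) D)"
    and D\<phi>: "\<And>i j k X Y. even_perm i j k \<Longrightarrow> X \<in> VF \<Longrightarrow> Y \<in> VF \<Longrightarrow>
      D X (phi S i Y) - phi S i (D X Y) = (\<lambda>_. \<beta>) \<cdot> (eta S k X \<cdot> phi S j Y - eta S j X \<cdot> phi S k Y)"
    using D unfolding canonical_connection_def metric_connection_def by blast+
  define B where "B = christoffel D p"
  have B: "mc (D X Y) p = dd X (mc Y) p + B (mc X p) (mc Y p)" if "X \<in> VF" "Y \<in> VF" for X Y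
    unfolding B_def by (rule mc_connection[OF aff that])
  have T: "torsion3 (met S) D X Y Z p = (B (mc X p) (mc Y p) - B (mc Y p) (mc X p) - br (mc X p) (mc Y p)) \<bullet> mc Z p"
    if "X \<in> VF" "Y \<in> VF" for X Y Z
    unfolding B_def by (rule torsion3_eq[OF aff that])
  have "(B u v - B v u - br u v) \<bullet> w = torsion_form br \<xi> \<eta> \<beta> \<delta> u v w" for u v w
  proof (rule torsion_unique[where B = B and B' = \<Gamma>])
    fix u v w
    show "B u v \<bullet> w + v \<bullet> B u w = 0"
    proof -
      have "(\<iota> u) (\<lambda>q. mc (\<iota> v) q \<bullet> mc (\<iota> w) q) p = dd (\<iota> u) (mc (\<iota> v)) p \<bullet> w + v \<bullet> dd (\<iota> u) (mc (\<iota> w)) p"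
        by (subst dd_inner) (simp_all add: frame_vf smooth_vec_mc)
      then show ?thesis
        using fun_cong[OF metric_D[OF frame_vf frame_vf frame_vf, of u v w], of p]
        by (simp add: met_eq B frame_vf)
    qed
    have "torsion3 (met S) D (\<iota> u) (\<iota> v) (\<iota> w) = - torsion3 (met S) D (\<iota> v) (\<iota> u) (\<iota> w)"
      "torsion3 (met S) D (\<iota> u) (\<iota> v) (\<iota> w) = - torsion3 (met S) D (\<iota> u) (\<iota> w) (\<iota> v)"
      using skew frame_vf unfolding skew3_on_def by blast+
    from this[THEN fun_cong, of p]
    show "(B u v - B v u - br u v) \<bullet> w = - ((B v u - B u v - br v u) \<bullet> w)"
      "(B u v - B v u - br u v) \<bullet> w = - ((B u w - B w u - br u w) \<bullet> v)"
      by (simp_all only: uminus_apply T[OF frame_vf frame_vf] mc_frame)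
    show "\<Gamma> u v \<bullet> w + v \<bullet> \<Gamma> u w = 0" by (rule \<Gamma>_metric)
    show "torsion_form br \<xi> \<eta> \<beta> \<delta> u v w = - torsion_form br \<xi> \<eta> \<beta> \<delta> v u w"
      "torsion_form br \<xi> \<eta> \<beta> \<delta> u v w = - torsion_form br \<xi> \<eta> \<beta> \<delta> u w v"
      by (rule torsion_form_skew)+
    show "torsion_form br \<xi> \<eta> \<beta> \<delta> u v w = (\<Gamma> u v - \<Gamma> v u - br u v) \<bullet> w" by (rule \<Gamma>_torsion[symmetric])
  next
    fix i u v
    obtain j k where p: "even_perm i j k" by (rule even_perm_exists)
    have vf: "D (\<iota> u) (phi S i (\<iota> v)) \<in> VF" "D (\<iota> u) (\<iota> v) \<in> VF"
      using aff frame_vf vf_phi[OF frame_vf] by (simp_all add: affine_connection_def endo_field_def)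
    have "mc (D (\<iota> u) (phi S i (\<iota> v)) - phi S i (D (\<iota> u) (\<iota> v))) p
        = mc (D (\<iota> u) (phi S i (\<iota> v))) p - \<phi> i (mc (D (\<iota> u) (\<iota> v)) p)"
      by (intro repr_mc repr_diff repr_phi mc_repr vf)
    also have "\<dots> = B u (\<phi> i v) - \<phi> i (B u v)"
      by (simp add: B frame_vf vf_phi dd_phi mc_phi \<phi>_simps)
    finally have 1: "B u (\<phi> i v) - \<phi> i (B u v) = mc (D (\<iota> u) (phi S i (\<iota> v)) - phi S i (D (\<iota> u) (\<iota> v))) p" ..
    have "mc ((\<lambda>_. \<beta>) \<cdot> (eta S k (\<iota> u) \<cdot> phi S j (\<iota> v) - eta S j (\<iota> u) \<cdot> phi S k (\<iota> v))) p
        = \<beta> *\<^sub>R (eta S k (\<iota> u) p *\<^sub>R \<phi> j (mc (\<iota> v) p) - eta S j (\<iota> u) p *\<^sub>R \<phi> k (mc (\<iota> v) p))"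
      by (intro repr_mc repr_mult[where h = "\<lambda>_. \<beta>"] repr_diff repr_mult repr_phi)
    then show "B u (\<phi> i v) - \<phi> i (B u v) = \<Gamma> u (\<phi> i v) - \<phi> i (\<Gamma> u v)"
      unfolding 1 D\<phi>[OF p frame_vf frame_vf] \<Gamma>_\<phi>[OF p] by (simp add: eta_eq)
  qed (rule refl)
  then show ?thesis using T[OF V] by simp
qed

end

theorem theorem6p7:
  fixes br :: "'a::euclidean_space \<Rightarrow> 'a \<Rightarrow> 'a"
    and \<phi> :: "3 \<Rightarrow> 'a \<Rightarrow> 'a" and \<xi> :: "3 \<Rightarrow> 'a" and \<eta> :: "3 \<Rightarrow> 'a \<Rightarrow> real"
    and A :: "('p::{t2_space,second_countable_topology}, 'm::euclidean_space) atlas"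
    and mul :: "'p \<Rightarrow> 'p \<Rightarrow> 'p" and e :: 'p and iv :: "'p \<Rightarrow> 'p"
    and \<iota> :: "'a \<Rightarrow> 'p vfield" and S :: "'p a3c_structure"
  assumes "almost_3contact_metric_lie_algebra br \<phi> \<xi> \<eta>"
    and "abelian_structure br \<phi> \<xi> \<eta>"
    and "lie_group A mul e iv"
    and "lie_algebra_iso A mul br \<iota>"
    and "S = left_invariant_structure \<iota> \<phi> \<xi> \<eta>"
  shows
    "(canonical A S \<longleftrightarrow>
        (lie_subalgebra br (vertical \<xi>) \<and> (\<exists>\<delta>. vertical_bracket_law br \<xi> \<delta>)) \<and>
        (\<exists>\<beta>. horizontal_ad_law br \<phi> \<xi> \<eta> \<beta>)) \<and>
     (lie_subalgebra br (vertical \<xi>) \<longrightarrow> (\<exists>\<delta>. vertical_bracket_law br \<xi> \<delta>)) \<and>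
     (\<forall>b. canonical_with A S b \<longrightarrow>
        (\<exists>\<beta> \<delta>. b = (\<lambda>_. \<beta>) \<and> vertical_bracket_law br \<xi> \<delta> \<and> horizontal_ad_law br \<phi> \<xi> \<eta> \<beta> \<and>
           (\<exists>D. canonical_connection A S b D) \<and>
           (\<forall>D. canonical_connection A S b D \<longrightarrow>
              (\<forall>X\<in>vector_fields A. \<forall>Y\<in>vector_fields A. \<forall>Z\<in>vector_fields A.
                 torsion3 (met S) D X Y Z
                 = left_invariant_form3 \<iota> (torsion_form br \<xi> \<eta> \<beta> \<delta>) X Y Z))))"
proof -
  interpret abelian_3contact br \<phi> \<xi> \<eta>
    by unfold_locales (rule assms)+
  interpret left_invariant_frame A \<iota> br
    by (rule left_invariant_frameI[OF assms(3,4)])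
  interpret abelian_left_invariant A \<iota> br \<phi> \<xi> \<eta>
    by unfold_locales (rule left_invariant_frameI[OF assms(3,4)])
  have laws: "\<exists>\<beta> \<delta>. b = (\<lambda>_. \<beta>) \<and> vertical_bracket_law br \<xi> \<delta> \<and> horizontal_ad_law br \<phi> \<xi> \<eta> \<beta> \<and>
      lie_subalgebra br (vertical \<xi>)" if "canonical_with A S b" for b
  proof -
    obtain \<beta> where \<beta>: "b = (\<lambda>_. \<beta>)" "alg_canonical \<beta>"
      using canonical_with_const[of b] \<open>canonical_with A S b\<close> assms(5) by metis
    show ?thesis
      using \<beta> alg_canonical_imp_laws[OF \<beta>(2)] vertical_bracket_law_exists by blast
  qed
  have conv: "canonical_with A S (\<lambda>_. \<beta>)"
    if "vertical_bracket_law br \<xi> \<delta>" "horizontal_ad_law br \<phi> \<xi> \<eta> \<beta>" for \<beta> \<delta>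
  proof -
    interpret canonical_3contact br \<phi> \<xi> \<eta> \<beta> \<delta> by unfold_locales (rule that)+
    show ?thesis
      unfolding assms(5) canonical_with_iff using alg_canonical smooth_functions_const by blast
  qed
  have conn: "(\<exists>D. canonical_connection A S (\<lambda>_. \<beta>) D) \<and>
      (\<forall>D. canonical_connection A S (\<lambda>_. \<beta>) D \<longrightarrow>
        (\<forall>X\<in>vector_fields A. \<forall>Y\<in>vector_fields A. \<forall>Z\<in>vector_fields A.
          torsion3 (met S) D X Y Z = left_invariant_form3 \<iota> (torsion_form br \<xi> \<eta> \<beta> \<delta>) X Y Z))"
    if "vertical_bracket_law br \<xi> \<delta>" "horizontal_ad_law br \<phi> \<xi> \<eta> \<beta>" for \<beta> \<delta>
  proof -
    interpret canonical_3contact br \<phi> \<xi> \<eta> \<beta> \<delta> by unfold_locales (rule that)+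
    interpret canonical_left_invariant A \<iota> br \<phi> \<xi> \<eta> \<beta> \<delta> by unfold_locales
    show ?thesis
      unfolding assms(5) left_invariant_form3_def fun_eq_iff
      using canonical_conn torsion_canonical_connection by blast
  qed
  show ?thesis
  proof (intro conjI)
    show "canonical A S \<longleftrightarrow>
        (lie_subalgebra br (vertical \<xi>) \<and> (\<exists>\<delta>. vertical_bracket_law br \<xi> \<delta>)) \<and>
        (\<exists>\<beta>. horizontal_ad_law br \<phi> \<xi> \<eta> \<beta>)"
      unfolding canonical_def using laws conv by blast
    show "lie_subalgebra br (vertical \<xi>) \<longrightarrow> (\<exists>\<delta>. vertical_bracket_law br \<xi> \<delta>)"
      using vertical_bracket_law_exists by blast
    show "\<forall>b. canonical_with A S b \<longrightarrow>
        (\<exists>\<beta> \<delta>. b = (\<lambda>_. \<beta>) \<and> vertical_bracket_law br \<xi> \<delta> \<and> horizontal_ad_law br \<phi> \<xi> \<eta> \<beta> \<and>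
           (\<exists>D. canonical_connection A S b D) \<and>
           (\<forall>D. canonical_connection A S b D \<longrightarrow>
              (\<forall>X\<in>vector_fields A. \<forall>Y\<in>vector_fields A. \<forall>Z\<in>vector_fields A.
                 torsion3 (met S) D X Y Z
                 = left_invariant_form3 \<iota> (torsion_form br \<xi> \<eta> \<beta> \<delta>) X Y Z)))"
    proof (intro allI impI)
      fix b assume "canonical_with A S b"
      then obtain \<beta> \<delta> where l: "b = (\<lambda>_. \<beta>)" "vertical_bracket_law br \<xi> \<delta>" "horizontal_ad_law br \<phi> \<xi> \<eta> \<beta>"
        using laws by blast
      show "\<exists>\<beta> \<delta>. b = (\<lambda>_. \<beta>) \<and> vertical_bracket_law br \<xi> \<delta> \<and> horizontal_ad_law br \<phi> \<xi> \<eta> \<beta> \<and>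
           (\<exists>D. canonical_connection A S b D) \<and>
           (\<forall>D. canonical_connection A S b D \<longrightarrow>
              (\<forall>X\<in>vector_fields A. \<forall>Y\<in>vector_fields A. \<forall>Z\<in>vector_fields A.
                 torsion3 (met S) D X Y Z
                 = left_invariant_form3 \<iota> (torsion_form br \<xi> \<eta> \<beta> \<delta>) X Y Z))"
        using l conn[OF l(2,3)] by blast
    qed
  qed
qed

end
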